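(* Let $0<\alpha<\pi/2$. Let $\mu$ be a symmetric complex Borel measure with compact support contained in $S_\alpha$ such that $\int_{S_\alpha} d\mu(z)=0$, let $\varphi\in H(S_\alpha)'$ be the functional induced by $\mu$, i.e. $\langle f,\varphi\rangle=\int f\,d\mu$, and let $F=\mathcal{F}\mathcal{B}(\varphi)$ be its Fourier--Borel transform. Let $(T(t))_{t\in S_\alpha}=(\exp(tA))_{t\in S_\alpha}$ be an analytic non-quasinilpotent semigroup and let $\mathcal A_T$ be the Banach algebra generated by $(T(t))_{t\in S_\alpha}$. If there exists $t_0>0$ such that $$\rho(F(-tA))<\sup_{x>0}|F(x)|$$ for all $0<t\le t_0$, then $\mathcal A_T/\operatorname{Rad}\mathcal A_T$ is unital and the generator of $(\pi(T(t)))_{t\in S_\alpha}$ is bounded, where $\pi:\mathcal A_T\to\mathcal A_T/\operatorname{Rad}\mathcal A_T$ denotes the canonical surjection.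
   Context: For $0<\gamma<\pi/2$, $S_\gamma=\{z\in\mathbb C:\operatorname{Re}z>0,\ |\arg z|<\gamma\}$. $H(S_\alpha)$ is the Fr\'echet space of analytic functions on $S_\alpha$ with the topology of local uniform convergence, and $H(S_\alpha)'$ is its dual. A measure $\mu$ is symmetric if $\mu(\overline S)=\overline{\mu(S)}$ for all Borel sets $S\subset S_\alpha$, where $\overline S=\{\overline z: z\in S\}$. The Fourier--Borel transform of $\varphi$ (induced by $\mu$) is the entire function $F(z)=\mathcal{F}\mathcal{B}(\varphi)(z)=\langle e_{-z},\varphi\rangle=\int e^{-z\xi}\,d\mu(\xi)$, where $e_{-z}(\xi)=e^{-z\xi}$. An analytic semigroup $(T(t))_{t\in S_\alpha}$ is an analytic map from $S_\alpha$ to the bounded operators on a Banach space $\mathcal X$ with $T(s+t)=T(s)T(t)$ for $s,t\in S_\alpha$; its infinitesimal generator is denoted by $A$ and one writes $T(t)=\exp(tA)$. It is non-quasinilpotent if the operators $T(t)$ are not all quasinilpotent. $\mathcal A_T$ is the (commutative) Banach algebra generated by the elements $T(t)$, $t\in S_\alpha$ (the norm-closed subalgebra they generate, no identity being adjoined). For $t>0$, $F(-tA)$ is defined by the Bochner integral $F(-tA)=\int T(t\xi)\,d\mu(\xi)\in\mathcal A_T$. $\rho$ denotes the spectral radius and $\operatorname{Rad}$ the (Jacobson) radical. The generator of $(\pi(T(t)))_{t\in S_\alpha}$ is bounded means that there is an element $B$ of the unital Banach algebra $\mathcal A_T/\operatorname{Rad}\mathcal A_T$ with $\pi(T(t))=e^{tB}$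 for all $t\in S_\alpha$. *)

theory Defs
  imports "HOL-Complex_Analysis.Complex_Analysis"
begin

section \<open>Complex normed spaces\<close>

text \<open>
  A complex normed space is a real normed space with a compatible complex scalar multiplication;
  a complex Banach space is a type of sort \<open>{complex_normed_vector, banach}\<close>.
\<close>

class complex_normed_vector = real_normed_vector +
  fixes scaleC :: "complex \<Rightarrow> 'a \<Rightarrow> 'a"  (infixr "*\<^sub>C" 75)
  assumes scaleC_add_right: "c *\<^sub>C (x + y) = c *\<^sub>C x + c *\<^sub>C y"
    and scaleC_add_left: "(c + d) *\<^sub>C x = c *\<^sub>C x + d *\<^sub>C x"
    and scaleC_scaleC: "c *\<^sub>C d *\<^sub>C x = (c * d) *\<^sub>C x"
    and scaleC_of_real: "complex_of_real r *\<^sub>C x = r *\<^sub>R x"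
    and norm_scaleC: "norm (c *\<^sub>C x) = norm c * norm x"

instantiation complex :: complex_normed_vector
begin

definition scaleC_complex :: "complex \<Rightarrow> complex \<Rightarrow> complex"
  where "scaleC_complex c z = c * z"

instance
  by standard (auto simp: scaleC_complex_def algebra_simps norm_mult scaleR_conv_of_real)

end

lemma bounded_linear_scaleC_right:
  "bounded_linear (\<lambda>x::'a::complex_normed_vector. c *\<^sub>C x)"
proof (rule bounded_linear_intro[where K = "norm c"])
  fix x y :: 'a and r :: real
  show "c *\<^sub>C (x + y) = c *\<^sub>C x + c *\<^sub>C y" by (rule scaleC_add_right)
  show "c *\<^sub>C r *\<^sub>R x = r *\<^sub>R c *\<^sub>C x"
    by (metis scaleC_scaleC scaleC_of_real mult.commute)
  show "norm (c *\<^sub>C x) \<le> norm x * norm c"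
    by (simp add: norm_scaleC mult.commute)
qed

text \<open>
  The library type of bounded operators consists of the real-linear ones. Composition with scalars
  on the left makes it a complex normed space as soon as the target is one; the bounded
  complex-linear operators are singled out by \<open>complex_linear_op\<close> below.
\<close>

instantiation blinfun :: (real_normed_vector, complex_normed_vector) complex_normed_vector
begin

lift_definition scaleC_blinfun :: "complex \<Rightarrow> 'a \<Rightarrow>\<^sub>L 'b \<Rightarrow> 'a \<Rightarrow>\<^sub>L 'b"
  is "\<lambda>c f x. c *\<^sub>C f x"
  by (rule bounded_linear_compose[OF bounded_linear_scaleC_right])

instance
proof
  fix c d :: complex and r :: real and f g :: "'a \<Rightarrow>\<^sub>L 'b"
  show "c *\<^sub>C (f + g) = c *\<^sub>C f + c *\<^sub>C g"
    by transfer (simp add: scaleC_add_right)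
  show "(c + d) *\<^sub>C f = c *\<^sub>C f + d *\<^sub>C f"
    by transfer (simp add: scaleC_add_left)
  show "c *\<^sub>C d *\<^sub>C f = (c * d) *\<^sub>C f"
    by transfer (simp add: scaleC_scaleC)
  show "complex_of_real r *\<^sub>C f = r *\<^sub>R f"
    by transfer (simp add: scaleC_of_real)
  have le: "norm (c *\<^sub>C f) \<le> norm c * norm f" for c and f :: "'a \<Rightarrow>\<^sub>L 'b"
  proof (rule norm_blinfun_bound)
    fix x
    have "norm (blinfun_apply (c *\<^sub>C f) x) = norm c * norm (blinfun_apply f x)"
      by (simp add: scaleC_blinfun.rep_eq norm_scaleC)
    also have "\<dots> \<le> norm c * (norm f * norm x)"
      by (intro mult_left_mono norm_blinfun) auto
    finally show "norm (blinfun_apply (c *\<^sub>C f) x) \<le> norm c * norm f * norm x"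
      by (simp add: mult.assoc)
  qed simp
  show "norm (c *\<^sub>C f) = norm c * norm f"
  proof (cases "c = 0")
    case True
    then show ?thesis using le[of c f] by simp
  next
    case False
    have "inverse c *\<^sub>C c *\<^sub>C f = f"
      using False scaleC_of_real[of 1]
      by (intro blinfun_eqI) (simp add: scaleC_blinfun.rep_eq scaleC_scaleC)
    then have "norm f \<le> norm (inverse c) * norm (c *\<^sub>C f)"
      by (metis le)
    then have "norm c * norm f \<le> norm (c *\<^sub>C f)"
      using False by (simp add: norm_divide field_simps)
    then show ?thesis using le[of c f] by simp
  qed
qed

end

definition complex_linear_op :: "('a::complex_normed_vector \<Rightarrow>\<^sub>L 'a) \<Rightarrow> bool"
  where "complex_linear_op f \<longleftrightarrow>
    (\<forall>c x. blinfun_apply f (c *\<^sub>C x) = c *\<^sub>C blinfun_apply f x)"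

definition op_spectrum :: "('a::complex_normed_vector \<Rightarrow>\<^sub>L 'a) \<Rightarrow> complex set"
  where "op_spectrum f =
    {c. \<not> (\<exists>g. complex_linear_op g \<and>
             g o\<^sub>L (c *\<^sub>C id_blinfun - f) = id_blinfun \<and>
             (c *\<^sub>C id_blinfun - f) o\<^sub>L g = id_blinfun)}"

text \<open>
  Values are taken in \<open>ennreal\<close> so that the supremum is \<open>0\<close> on the zero space, where the
  spectrum is empty.
\<close>

definition spectral_radius :: "('a::complex_normed_vector \<Rightarrow>\<^sub>L 'a) \<Rightarrow> ennreal"
  where "spectral_radius f = (SUP c\<in>op_spectrum f. ennreal (norm c))"

definition quasinilpotent :: "('a::complex_normed_vector \<Rightarrow>\<^sub>L 'a) \<Rightarrow> bool"
  where "quasinilpotent f \<longleftrightarrow> spectral_radius f = 0"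


section \<open>Complex Borel measures on the plane\<close>

definition complex_borel_measure :: "(complex set \<Rightarrow> complex) \<Rightarrow> bool"
  where "complex_borel_measure \<mu> \<longleftrightarrow>
    (\<forall>E :: nat \<Rightarrow> complex set. range E \<subseteq> sets borel \<longrightarrow> disjoint_family E \<longrightarrow>
       (\<lambda>n. \<mu> (E n)) sums \<mu> (\<Union>n. E n))"

definition measure_support :: "(complex set \<Rightarrow> complex) \<Rightarrow> complex set"
  where "measure_support \<mu> =
    {z. \<forall>U. open U \<longrightarrow> z \<in> U \<longrightarrow> (\<exists>E\<in>sets borel. E \<subseteq> U \<and> \<mu> E \<noteq> 0)}"

definition total_variation :: "(complex set \<Rightarrow> complex) \<Rightarrow> complex measure"
  where "total_variation \<mu> = measure_of UNIV (sets borel)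
    (\<lambda>S. SUP E\<in>{E :: nat \<Rightarrow> complex set.
                    range E \<subseteq> sets borel \<and> disjoint_family E \<and> (\<Union>n. E n) = S}.
           (\<Sum>n. ennreal (norm (\<mu> (E n)))))"

text \<open>
  Bochner integral of a vector-valued function against a complex measure. The library's Bochner
  integral is restricted to positive measures and to second countable target spaces, which spaces
  of operators are not; as usual, strong measurability (almost everywhere limit of simple
  functions) takes the place of Borel measurability. Neither side depends on the values
  of \<open>f\<close> on a null set of the total variation.
\<close>

definition has_cm_integral ::
    "(complex set \<Rightarrow> complex) \<Rightarrow> (complex \<Rightarrow> 'b::complex_normed_vector) \<Rightarrow> 'b \<Rightarrow> bool"
  where "has_cm_integral \<mu> f I \<longleftrightarrow>
    (\<exists>s :: nat \<Rightarrow> complex \<Rightarrow> 'b.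
       (\<forall>n. simple_function borel (s n)) \<and>
       (AE x in total_variation \<mu>. (\<lambda>n. s n x) \<longlonglongrightarrow> f x) \<and>
       (\<lambda>n. \<integral>\<^sup>+ x. ennreal (norm (f x - s n x)) \<partial>total_variation \<mu>) \<longlonglongrightarrow> 0 \<and>
       (\<lambda>n. \<Sum>y\<in>range (s n). \<mu> (s n -` {y}) *\<^sub>C y) \<longlonglongrightarrow> I)"

definition cm_integral ::
    "(complex set \<Rightarrow> complex) \<Rightarrow> (complex \<Rightarrow> 'b::complex_normed_vector) \<Rightarrow> 'b"
  where "cm_integral \<mu> f = (THE I. has_cm_integral \<mu> f I)"


section \<open>Sectors, analytic functionals, Fourier--Borel transform\<close>

definition sector :: "real \<Rightarrow> complex set"
  where "sector \<gamma> = {z. Re z > 0 \<and> \<bar>Arg z\<bar> < \<gamma>}"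

definition symmetric_on :: "complex set \<Rightarrow> (complex set \<Rightarrow> complex) \<Rightarrow> bool"
  where "symmetric_on S \<mu> \<longleftrightarrow>
    (\<forall>E\<in>sets borel. E \<subseteq> S \<longrightarrow> \<mu> (cnj ` E) = cnj (\<mu> E))"

text \<open>
  The dual of the Frechet space of holomorphic functions on \<open>S\<close>. That space is metrizable, so
  continuity is sequential continuity. Elements of the space are represented by total functions;
  continuity along constant sequences forces the functional to depend only on the restriction
  to \<open>S\<close>.
\<close>

definition holomorphic_dual :: "complex set \<Rightarrow> ((complex \<Rightarrow> complex) \<Rightarrow> complex) set"
  where "holomorphic_dual S = {\<phi>.
    (\<forall>f g c d. f holomorphic_on S \<longrightarrow> g holomorphic_on S \<longrightarrow>
       \<phi> (\<lambda>z. c * f z + d * g z) = c * \<phi> f + d * \<phi> g) \<and>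
    (\<forall>f g. (\<forall>n::nat. f n holomorphic_on S) \<longrightarrow> g holomorphic_on S \<longrightarrow>
       (\<forall>K. compact K \<longrightarrow> K \<subseteq> S \<longrightarrow> uniform_limit K f g sequentially) \<longrightarrow>
       (\<lambda>n. \<phi> (f n)) \<longlonglongrightarrow> \<phi> g)}"

definition fourier_borel :: "((complex \<Rightarrow> complex) \<Rightarrow> complex) \<Rightarrow> complex \<Rightarrow> complex"
  where "fourier_borel \<phi> z = \<phi> (\<lambda>\<xi>. exp (- z * \<xi>))"


section \<open>Analytic semigroups\<close>

text \<open>
  Analyticity is complex differentiability in operator norm at every point of the (open) sector:
  the Frechet derivative has the form \<open>\<lambda>h. h *\<^sub>C D\<close>. The values of \<open>T\<close> outside the sector are
  irrelevant.
\<close>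

definition analytic_semigroup ::
    "real \<Rightarrow> (complex \<Rightarrow> 'a::complex_normed_vector \<Rightarrow>\<^sub>L 'a) \<Rightarrow> bool"
  where "analytic_semigroup \<gamma> T \<longleftrightarrow>
    (\<forall>t\<in>sector \<gamma>. complex_linear_op (T t)) \<and>
    (\<forall>t\<in>sector \<gamma>. \<exists>D. (T has_derivative (\<lambda>h. h *\<^sub>C D)) (at t)) \<and>
    (\<forall>s\<in>sector \<gamma>. \<forall>t\<in>sector \<gamma>. T (s + t) = T s o\<^sub>L T t)"

text \<open>\<open>F(-tA)\<close>, where \<open>F\<close> is the transform of \<open>\<mu>\<close> and \<open>A\<close> is the generator of \<open>T\<close>.\<close>

definition semigroup_calculus ::
    "(complex set \<Rightarrow> complex) \<Rightarrow> (complex \<Rightarrow> 'a::complex_normed_vector \<Rightarrow>\<^sub>L 'a) \<Rightarrow> real \<Rightarrow> 'a \<Rightarrow>\<^sub>L 'a"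
  where "semigroup_calculus \<mu> T t = cm_integral \<mu> (\<lambda>\<xi>. T (complex_of_real t * \<xi>))"


section \<open>Normed algebras without identity\<close>

text \<open>
  Carrier-based, since both the algebra generated by a semigroup and its quotients are needed and
  neither is assumed to have an identity.
\<close>

record 'x normed_alg =
  acarrier :: "'x set"
  azero :: 'x
  aplus :: "'x \<Rightarrow> 'x \<Rightarrow> 'x"
  ascale :: "complex \<Rightarrow> 'x \<Rightarrow> 'x"
  atimes :: "'x \<Rightarrow> 'x \<Rightarrow> 'x"
  anorm :: "'x \<Rightarrow> real"

definition aminus :: "'x normed_alg \<Rightarrow> 'x \<Rightarrow> 'x \<Rightarrow> 'x"
  where "aminus A x y = aplus A x (ascale A (- 1) y)"

definition left_ideal :: "'x normed_alg \<Rightarrow> 'x set \<Rightarrow> bool"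
  where "left_ideal A I \<longleftrightarrow> I \<subseteq> acarrier A \<and> azero A \<in> I \<and>
    (\<forall>x\<in>I. \<forall>y\<in>I. aplus A x y \<in> I) \<and> (\<forall>c. \<forall>x\<in>I. ascale A c x \<in> I) \<and>
    (\<forall>a\<in>acarrier A. \<forall>x\<in>I. atimes A a x \<in> I)"

definition modular_left_ideal :: "'x normed_alg \<Rightarrow> 'x set \<Rightarrow> bool"
  where "modular_left_ideal A I \<longleftrightarrow> left_ideal A I \<and>
    (\<exists>u\<in>acarrier A. \<forall>a\<in>acarrier A. aminus A a (atimes A a u) \<in> I)"

definition maximal_modular_left_ideal :: "'x normed_alg \<Rightarrow> 'x set \<Rightarrow> bool"
  where "maximal_modular_left_ideal A I \<longleftrightarrow> modular_left_ideal A I \<and> I \<noteq> acarrier A \<and>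
    (\<forall>J. left_ideal A J \<longrightarrow> I \<subseteq> J \<longrightarrow> J \<noteq> acarrier A \<longrightarrow> J = I)"

text \<open>The intersection with the carrier makes the radical everything if there is no such ideal.\<close>

definition jacobson_radical :: "'x normed_alg \<Rightarrow> 'x set"
  where "jacobson_radical A = acarrier A \<inter> \<Inter>{I. maximal_modular_left_ideal A I}"

definition acoset :: "'x normed_alg \<Rightarrow> 'x set \<Rightarrow> 'x \<Rightarrow> 'x set"
  where "acoset A I x = aplus A x ` I"

definition quotient_alg :: "'x normed_alg \<Rightarrow> 'x set \<Rightarrow> 'x set normed_alg"
  where "quotient_alg A I =
    \<lparr> acarrier = acoset A I ` acarrier A,
      azero = acoset A I (azero A),
      aplus = (\<lambda>X Y. \<Union>x\<in>X. \<Union>y\<in>Y. acoset A I (aplus A x y)),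
      ascale = (\<lambda>c X. \<Union>x\<in>X. acoset A I (ascale A c x)),
      atimes = (\<lambda>X Y. \<Union>x\<in>X. \<Union>y\<in>Y. acoset A I (atimes A x y)),
      anorm = (\<lambda>X. INF x\<in>X. anorm A x) \<rparr>"

definition is_aone :: "'x normed_alg \<Rightarrow> 'x \<Rightarrow> bool"
  where "is_aone A e \<longleftrightarrow>
    e \<in> acarrier A \<and> (\<forall>a\<in>acarrier A. atimes A e a = a \<and> atimes A a e = a)"

definition unital_alg :: "'x normed_alg \<Rightarrow> bool"
  where "unital_alg A \<longleftrightarrow> (\<exists>e. is_aone A e)"

definition aone :: "'x normed_alg \<Rightarrow> 'x"
  where "aone A = (THE e. is_aone A e)"

primrec apower :: "'x normed_alg \<Rightarrow> 'x \<Rightarrow> nat \<Rightarrow> 'x" where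
  "apower A x 0 = aone A"
| "apower A x (Suc n) = atimes A x (apower A x n)"

primrec aexp_partial :: "'x normed_alg \<Rightarrow> 'x \<Rightarrow> nat \<Rightarrow> 'x" where
  "aexp_partial A x 0 = azero A"
| "aexp_partial A x (Suc n) =
     aplus A (aexp_partial A x n) (ascale A (1 / fact n) (apower A x n))"

text \<open>\<open>y\<close> is the sum of the exponential series of \<open>x\<close> in the norm of \<open>A\<close>.\<close>

definition is_aexp :: "'x normed_alg \<Rightarrow> 'x \<Rightarrow> 'x \<Rightarrow> bool"
  where "is_aexp A x y \<longleftrightarrow> y \<in> acarrier A \<and>
    (\<lambda>n. anorm A (aminus A (aexp_partial A x n) y)) \<longlonglongrightarrow> 0"

text \<open>For a semigroup \<open>U\<close> in a unital algebra \<open>A\<close>: \<open>U t = exp (t B)\<close> on \<open>S\<close> for some element \<open>B\<close> of \<open>A\<close>.\<close>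

definition has_bounded_generator :: "'x normed_alg \<Rightarrow> complex set \<Rightarrow> (complex \<Rightarrow> 'x) \<Rightarrow> bool"
  where "has_bounded_generator A S U \<longleftrightarrow>
    (\<exists>B\<in>acarrier A. \<forall>t\<in>S. is_aexp A (ascale A t B) (U t))"


section \<open>The algebra generated by a semigroup\<close>

definition closed_op_subalgebra :: "('a::complex_normed_vector \<Rightarrow>\<^sub>L 'a) set \<Rightarrow> bool"
  where "closed_op_subalgebra B \<longleftrightarrow> closed B \<and> 0 \<in> B \<and>
    (\<forall>f\<in>B. \<forall>g\<in>B. f + g \<in> B) \<and> (\<forall>c. \<forall>f\<in>B. c *\<^sub>C f \<in> B) \<and>
    (\<forall>f\<in>B. \<forall>g\<in>B. f o\<^sub>L g \<in> B)"

definition generated_alg ::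
    "('a::complex_normed_vector \<Rightarrow>\<^sub>L 'a) set \<Rightarrow> ('a \<Rightarrow>\<^sub>L 'a) normed_alg"
  where "generated_alg G =
    \<lparr> acarrier = closed_op_subalgebra hull G, azero = 0, aplus = (+), ascale = (*\<^sub>C),
      atimes = (o\<^sub>L), anorm = norm \<rparr>"

end

theory Submission
  imports Defs
begin

text \<open>
  Every character \<open>\<psi>\<close> of a commutative algebra of operators containing the semigroup either vanishes on
  it or has the form \<open>\<psi> (T t) = exp (- t z)\<close>, and then \<open>\<psi> (F(- t A)) = F (t z)\<close>, so that
  \<open>|F (t z)| \<le> \<rho> (F(- t A)) < sup |F|\<close> for small \<open>t\<close>. The bounds \<open>|exp (- t z)| \<le> \<parallel>T t\<parallel>\<close> for \<open>t\<close> near the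
  boundary of the sector confine large exponents \<open>z\<close> to a cone in which \<open>F\<close> decays. There the
  maximum principle on a triangle symmetric about the real axis, together with \<open>F 0 = 0\<close> and
  \<open>|F (cnj z)| = |F z|\<close>, shows that \<open>|F|\<close> is on every ray somewhere at least as large as its supremum
  on the positive axis. Hence the exponents \<open>z\<close> are bounded. Then the values \<open>\<psi> (T s)\<close> for small
  \<open>s > 0\<close> lie in \<open>{0}\<close> or near \<open>1\<close>, and power series in \<open>T s\<close> yield elements that become an identity
  and an inverse of \<open>T s\<close> modulo the radical; the generator is \<open>T' s\<close> times that inverse.
\<close>

section \<open>Complex scalar multiplication\<close>

text \<open>The algebra generated by the semigroup has no identity and, even with one adjoined, may
  lack inverses that its elements have as operators. Characters are therefore taken on a larger
  algebra, the bicommutant of the semigroup in the unitization of the operators: it is commutative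
  and contains all existing inverses, so |\<psi> f| is bounded by the operator spectral radius in
  the hypothesis. Characters also control the radical: an element killed by all of them has spectral
  radius 0, and so have its multiples, which puts it into every maximal modular ideal. Thus all that
  is claimed about the quotient reduces to identities between numbers \<psi> x. The elements
  realising them must lie in the generated algebra itself, hence every power series used lacks a
  constant term. For each character the spectral hypothesis is used at one t only: for an exponent z
  of large real part, |F| reaches its supremum over the positive axis at some point r z with r Re z
  below a constant independent of z. Then r \<le> t0, and t = r gives the contradiction.\<close>

lemma additive_scaleC_left: "Modules.additive (\<lambda>c. c *\<^sub>C x)"
  by standard (rule scaleC_add_left)

lemmas scaleC_sum_left = additive.sum[OF additive_scaleC_left]
  and scaleC_zero_left [simp] = additive.zero[OF additive_scaleC_left]
  and scaleC_minus_left [simp] = additive.minus[OF additive_scaleC_left]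
  and scaleC_diff_left = additive.diff[OF additive_scaleC_left]

lemma additive_scaleC_right: "Modules.additive (\<lambda>x. c *\<^sub>C x)"
  by standard (rule scaleC_add_right)

lemmas scaleC_diff_right = additive.diff[OF additive_scaleC_right]
  and scaleC_minus_right [simp] = additive.minus[OF additive_scaleC_right]
  and scaleC_zero_right [simp] = additive.zero[OF additive_scaleC_right]

lemma scaleC_one [simp]: "1 *\<^sub>C x = x"
  using scaleC_of_real[of 1 x] by simp

lemma scaleC_minus_one: "(- 1) *\<^sub>C x = - x"
  using scaleC_of_real[of "-1" x] by simp

section \<open>The total variation of a complex measure\<close>

lemma norm_sums_le_suminf:
  fixes f :: "nat \<Rightarrow> 'a::real_normed_vector"
  assumes "f sums s"
  shows "ennreal (norm s) \<le> (\<Sum>n. ennreal (norm (f n)))"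
proof (rule LIMSEQ_le_const2)
  show "(\<lambda>n. ennreal (norm (\<Sum>i<n. f i))) \<longlonglongrightarrow> ennreal (norm s)"
    using assms by (auto simp: sums_def intro!: tendsto_ennrealI tendsto_norm)
  have "ennreal (norm (\<Sum>i<n. f i)) \<le> (\<Sum>i. ennreal (norm (f i)))" for n
  proof -
    have "ennreal (norm (\<Sum>i<n. f i)) \<le> ennreal (\<Sum>i<n. norm (f i))"
      by (intro ennreal_leI norm_sum)
    also have "\<dots> = (\<Sum>i<n. ennreal (norm (f i)))" by simp
    also have "\<dots> \<le> (\<Sum>i. ennreal (norm (f i)))"
      by (intro sum_le_suminf) auto
    finally show ?thesis .
  qed
  then show "\<exists>N. \<forall>n\<ge>N. ennreal (norm (\<Sum>i<n. f i)) \<le> (\<Sum>i. ennreal (norm (f i)))" by blast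
qed

text \<open>As |z| is at most the sum of the positive and negative parts of Re z and Im z, one of
  the four index sets cut out by the sign of Re or Im carries at least a quarter of the total; hence
  the 4.\<close>

lemma exists_subset_norm_sum_ge:
  fixes z :: "'i \<Rightarrow> complex"
  assumes "finite I"
  shows "\<exists>J\<subseteq>I. (\<Sum>i\<in>I. norm (z i)) \<le> 4 * norm (\<Sum>i\<in>J. z i)"
proof (rule ccontr)
  assume neg: "\<not> ?thesis"
  have le: "4 * norm (\<Sum>i\<in>J. z i) < (\<Sum>i\<in>I. norm (z i))" if "J \<subseteq> I" for J
    using neg that by (meson not_le)
  have part: "(\<Sum>i\<in>I. max 0 (l i)) \<le> norm (\<Sum>i\<in>{i\<in>I. l i > 0}. z i)"
    if "\<And>J. (\<Sum>i\<in>J. l i) \<le> norm (\<Sum>i\<in>J. z i)" for l :: "'i \<Rightarrow> real"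
  proof -
    have "(\<Sum>i\<in>I. max 0 (l i)) = (\<Sum>i\<in>{i\<in>I. l i > 0}. l i)"
      using assms by (intro sum.mono_neutral_cong_right) auto
    with that show ?thesis by simp
  qed
  have "(\<Sum>i\<in>I. norm (z i)) \<le> (\<Sum>i\<in>I. max 0 (Re (z i)) + max 0 (- Re (z i))
      + max 0 (Im (z i)) + max 0 (- Im (z i)))"
    by (intro sum_mono) (use cmod_le in \<open>smt (verit)\<close>)
  also have "\<dots> = (\<Sum>i\<in>I. max 0 (Re (z i))) + (\<Sum>i\<in>I. max 0 (- Re (z i)))
      + (\<Sum>i\<in>I. max 0 (Im (z i))) + (\<Sum>i\<in>I. max 0 (- Im (z i)))"
    by (simp add: sum.distrib)
  also have "\<dots> \<le> norm (\<Sum>i\<in>{i\<in>I. Re (z i) > 0}. z i) + norm (\<Sum>i\<in>{i\<in>I. - Re (z i) > 0}. z i)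
      + norm (\<Sum>i\<in>{i\<in>I. Im (z i) > 0}. z i) + norm (\<Sum>i\<in>{i\<in>I. - Im (z i) > 0}. z i)"
  proof (intro add_mono part)
    fix J
    show "(\<Sum>i\<in>J. Re (z i)) \<le> norm (\<Sum>i\<in>J. z i)"
      using complex_Re_le_cmod[of "\<Sum>i\<in>J. z i"] by simp
    show "(\<Sum>i\<in>J. - Re (z i)) \<le> norm (\<Sum>i\<in>J. z i)"
      using abs_Re_le_cmod[of "\<Sum>i\<in>J. z i"] by (simp add: sum_negf)
    show "(\<Sum>i\<in>J. Im (z i)) \<le> norm (\<Sum>i\<in>J. z i)"
      using abs_Im_le_cmod[of "\<Sum>i\<in>J. z i"] by simp
    show "(\<Sum>i\<in>J. - Im (z i)) \<le> norm (\<Sum>i\<in>J. z i)"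
      using abs_Im_le_cmod[of "\<Sum>i\<in>J. z i"] by (simp add: sum_negf)
  qed
  also have "\<dots> < (\<Sum>i\<in>I. norm (z i))"
    using le[of "{i\<in>I. Re (z i) > 0}"] le[of "{i\<in>I. - Re (z i) > 0}"]
      le[of "{i\<in>I. Im (z i) > 0}"] le[of "{i\<in>I. - Im (z i) > 0}"] by auto
  finally show False by simp
qed

locale complex_measure =
  fixes \<mu> :: "complex set \<Rightarrow> complex"
  assumes complex_borel_measure: "complex_borel_measure \<mu>"
begin

lemma sums_UN:
  assumes "\<And>n. E n \<in> sets borel" "disjoint_family E"
  shows "(\<lambda>n::nat. \<mu> (E n)) sums \<mu> (\<Union>n. E n)"
  using complex_borel_measure assms unfolding complex_borel_measure_def by blast

text \<open>Additivity along the constant sequence \<open>{}\<close> makes a constant series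
  converge, which forces its term to be 0.\<close>

lemma measure_empty: "\<mu> {} = 0"
  using sums_summable[OF sums_UN[of "\<lambda>_. {}"]] by (simp add: disjoint_family_on_def summable_const_iff)

lemma measure_Un:
  assumes "A \<in> sets borel" "B \<in> sets borel" "A \<inter> B = {}"
  shows "\<mu> (A \<union> B) = \<mu> A + \<mu> B"
proof -
  have "(\<lambda>n. \<mu> (binaryset A B n)) sums \<mu> (\<Union>n. binaryset A B n)"
    using assms by (intro sums_UN) (auto simp: binaryset_def disjoint_family_on_def)
  moreover have "(\<lambda>n. \<mu> (binaryset A B n)) sums (\<mu> A + \<mu> B)"
    by (rule binaryset_sums) (rule measure_empty)
  ultimately show ?thesis by (metis UN_binaryset_eq sums_unique2)
qed

lemma measure_Diff:
  assumes "A \<in> sets borel" "B \<in> sets borel" "A \<subseteq> B"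
  shows "\<mu> (B - A) = \<mu> B - \<mu> A"
  using measure_Un[of A "B - A"] assms by (simp add: Un_absorb1)

lemma measure_UN:
  assumes "finite I" "\<And>i. i \<in> I \<Longrightarrow> A i \<in> sets borel" "disjoint_family_on A I"
  shows "\<mu> (\<Union>i\<in>I. A i) = (\<Sum>i\<in>I. \<mu> (A i))"
  using assms
proof (induction I)
  case empty
  then show ?case by (simp add: measure_empty)
next
  case (insert i I)
  have "\<mu> (A i \<union> (\<Union>i\<in>I. A i)) = \<mu> (A i) + \<mu> (\<Union>i\<in>I. A i)"
  proof (rule measure_Un)
    show "A i \<inter> \<Union> (A ` I) = {}"
      using insert.prems(2) insert.hyps(2) by (auto simp: disjoint_family_on_def)
  qed (use insert in auto)
  also have "\<mu> (\<Union>i\<in>I. A i) = (\<Sum>i\<in>I. \<mu> (A i))"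
    using insert.prems by (intro insert.IH) (auto simp: disjoint_family_on_def)
  finally show ?case using insert.hyps by simp
qed

definition variation :: "complex set \<Rightarrow> ennreal"
  where "variation S = (SUP E\<in>{E :: nat \<Rightarrow> complex set.
      range E \<subseteq> sets borel \<and> disjoint_family E \<and> (\<Union>n. E n) = S}.
        (\<Sum>n. ennreal (norm (\<mu> (E n)))))"

lemma total_variation_eq: "total_variation \<mu> = measure_of UNIV (sets borel) variation"
  by (simp add: total_variation_def variation_def[abs_def])

lemma suminf_le_variation:
  assumes "\<And>n::nat. E n \<in> sets borel" "disjoint_family E" "\<And>n. E n \<subseteq> S" "S \<in> sets borel"
  shows "(\<Sum>n. ennreal (norm (\<mu> (E n)))) \<le> variation S"
proof -
  \<comment> \<open>The supremum in \<open>variation\<close> runs over exact partitions, so the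
    uncovered part of S is inserted as piece 0.\<close>
  define E' where "E' n = (case n of 0 \<Rightarrow> S - (\<Union>n. E n) | Suc n \<Rightarrow> E n)" for n
  have "(\<Sum>n. ennreal (norm (\<mu> (E n)))) = (\<Sum>n. ennreal (norm (\<mu> (E' (n + 1)))))"
    by (simp add: E'_def)
  also have "\<dots> \<le> (\<Sum>n. ennreal (norm (\<mu> (E' (n + 1))))) + (\<Sum>n<1. ennreal (norm (\<mu> (E' n))))"
    by simp
  also have "\<dots> = (\<Sum>n. ennreal (norm (\<mu> (E' n))))"
    by (rule suminf_offset[symmetric]) simp
  also have "\<dots> \<le> variation S"
    unfolding variation_def
  proof (rule SUP_upper, safe)
    show "E' n \<in> sets borel" for n using assms by (auto simp: E'_def split: nat.split)
    show "disjoint_family E'"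
      using assms(2) by (auto simp: E'_def disjoint_family_on_def split: nat.splits)
    show "x \<in> S" if "x \<in> E' n" for x n
      using that assms(3) by (auto simp: E'_def split: nat.splits)
    show "x \<in> (\<Union>n. E' n)" if "x \<in> S" for x
    proof (cases "x \<in> (\<Union>n. E n)")
      case True
      then obtain n where "x \<in> E n" by blast
      then have "x \<in> E' (Suc n)" by (simp add: E'_def)
      then show ?thesis by blast
    next
      case False
      with that have "x \<in> E' 0" by (simp add: E'_def)
      then show ?thesis by blast
    qed
  qed
  finally show ?thesis .
qed

lemma norm_le_variation:
  assumes "S \<in> sets borel" shows "ennreal (norm (\<mu> S)) \<le> variation S"
proof -
  have "ennreal (norm (\<mu> S)) \<le> (\<Sum>n. ennreal (norm (\<mu> (binaryset S {} n))))"
    by (rule norm_sums_le_suminf) (use binaryset_sums[of \<mu> S "{}"] measure_empty in simp)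
  also have "\<dots> \<le> variation S"
    using assms
    by (intro suminf_le_variation) (auto simp: binaryset_def disjoint_family_on_def)
  finally show ?thesis .
qed

lemma variation_mono:
  assumes "A \<subseteq> B" "B \<in> sets borel" shows "variation A \<le> variation B"
  unfolding variation_def[of A]
proof (rule SUP_least, safe)
  fix E :: "nat \<Rightarrow> complex set"
  assume "range E \<subseteq> sets borel" "disjoint_family E" "A = (\<Union>n. E n)"
  then show "(\<Sum>n. ennreal (norm (\<mu> (E n)))) \<le> variation B"
    using assms by (intro suminf_le_variation) auto
qed

lemma variation_empty: "variation {} = 0"
proof -
  have "variation {} \<le> 0"
    unfolding variation_def by (rule SUP_least) (auto simp: measure_empty)
  then show ?thesis by simp
qed

text \<open>Each piece of a partition of the union is cut along the S i; the triangle inequality and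
  Tonelli's theorem for counting measures give the bound.\<close>

lemma variation_UN_le:
  assumes S: "\<And>i::nat. S i \<in> sets borel" and disj: "disjoint_family S"
  shows "variation (\<Union>i. S i) \<le> (\<Sum>i. variation (S i))"
  unfolding variation_def[of "\<Union>i. S i"]
proof (rule SUP_least, safe)
  fix E :: "nat \<Rightarrow> complex set"
  assume E: "range E \<subseteq> sets borel" "disjoint_family E" "(\<Union>n. E n) = (\<Union>i. S i)"
  then have Eb: "E n \<in> sets borel" for n by auto
  define f where "f = (\<lambda>(n, i). ennreal (norm (\<mu> (E n \<inter> S i))))"
  define f' where "f' = (\<lambda>(i, n). ennreal (norm (\<mu> (E n \<inter> S i))))"
  have "(\<Sum>n. ennreal (norm (\<mu> (E n)))) \<le> (\<Sum>n. \<Sum>i. f (n, i))"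
  proof (intro suminf_le)
    fix n
    have "E n = (\<Union>i. E n \<inter> S i)" using E(3) by blast
    moreover have "(\<lambda>i. \<mu> (E n \<inter> S i)) sums \<mu> (\<Union>i. E n \<inter> S i)"
      using disj Eb S by (intro sums_UN) (auto simp: disjoint_family_on_def)
    ultimately have "(\<lambda>i. \<mu> (E n \<inter> S i)) sums \<mu> (E n)" by simp
    from norm_sums_le_suminf[OF this]
    show "ennreal (norm (\<mu> (E n))) \<le> (\<Sum>i. f (n, i))" by (simp add: f_def)
  qed auto
  also have "\<dots> = (\<Sum>i. \<Sum>n. f' (i, n))"
  proof -
    have "(\<integral>\<^sup>+n. (\<integral>\<^sup>+i. f (n, i) \<partial>count_space UNIV) \<partial>count_space UNIV)
        = (\<integral>\<^sup>+i. (\<integral>\<^sup>+n. f (n, i) \<partial>count_space UNIV) \<partial>count_space UNIV)"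
      by (rule nn_integral_fst_count_space[THEN trans, OF nn_integral_snd_count_space[symmetric]])
    then show ?thesis by (simp add: nn_integral_count_space_nat f_def f'_def)
  qed
  also have "\<dots> \<le> (\<Sum>i. variation (S i))"
  proof (intro suminf_le)
    fix i
    show "(\<Sum>n. f' (i, n)) \<le> variation (S i)"
      unfolding f'_def prod.case using E(2) Eb S
      by (intro suminf_le_variation) (auto simp: disjoint_family_on_def)
  qed auto
  finally show "(\<Sum>n. ennreal (norm (\<mu> (E n)))) \<le> (\<Sum>i. variation (S i))" .
qed

text \<open>Only finite variation of the union has to be considered, so each S i has a nearly
  optimal partition. The errors e / 2^(i+1) add up to e, and \<open>prod_decode\<close> lists all
  pieces as one sequence.\<close>

lemma variation_UN_ge:
  assumes S: "\<And>i::nat. S i \<in> sets borel" and disj: "disjoint_family S"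
  shows "(\<Sum>i. variation (S i)) \<le> variation (\<Union>i. S i)"
proof (rule ennreal_le_epsilon)
  fix e :: real assume fin: "variation (\<Union>i. S i) < top" and e: "0 < e"
  have "\<exists>E :: nat \<Rightarrow> complex set. range E \<subseteq> sets borel \<and> disjoint_family E \<and> (\<Union>n. E n) = S i \<and>
      variation (S i) < (\<Sum>n. ennreal (norm (\<mu> (E n)))) + ennreal (e * (1/2)^Suc i)" for i
  proof -
    have "variation (S i) \<le> variation (\<Union>i. S i)"
      using S by (intro variation_mono) auto
    with fin have "variation (S i) \<noteq> \<infinity>" by (auto simp: top_unique)
    moreover have "{E :: nat \<Rightarrow> complex set.
      range E \<subseteq> sets borel \<and> disjoint_family E \<and> (\<Union>n. E n) = S i} \<noteq> {}"
    proof -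
      have "binaryset (S i) {} \<in> {E :: nat \<Rightarrow> complex set.
          range E \<subseteq> sets borel \<and> disjoint_family E \<and> (\<Union>n. E n) = S i}"
        using S by (auto simp: binaryset_def disjoint_family_on_def split: if_splits)
      then show ?thesis by blast
    qed
    moreover have "0 < e * (1/2)^Suc i" using e by simp
    ultimately have "\<exists>E\<in>{E :: nat \<Rightarrow> complex set.
        range E \<subseteq> sets borel \<and> disjoint_family E \<and> (\<Union>n. E n) = S i}.
        variation (S i) < (\<Sum>n. ennreal (norm (\<mu> (E n)))) + ennreal (e * (1/2)^Suc i)"
      by (intro SUP_approx_ennreal[OF _ _ variation_def])
    then show ?thesis by blast
  qed
  then obtain E where E: "\<And>i. range (E i :: nat \<Rightarrow> complex set) \<subseteq> sets borel"
    "\<And>i. disjoint_family (E i)" "\<And>i. (\<Union>n. E i n) = S i"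
    "\<And>i. variation (S i) < (\<Sum>n. ennreal (norm (\<mu> (E i n)))) + ennreal (e * (1/2)^Suc i)"
    by metis
  have half: "(\<lambda>i. e * (1/2::real)^Suc i) sums e"
    using sums_mult[OF power_half_series, of e] by simp
  have "(\<Sum>i. variation (S i)) \<le> (\<Sum>i. (\<Sum>n. ennreal (norm (\<mu> (E i n)))) + ennreal (e * (1/2)^Suc i))"
    using E(4) by (intro suminf_le) (auto intro: less_imp_le)
  also have "\<dots> = (\<Sum>i. \<Sum>n. ennreal (norm (\<mu> (E i n)))) + (\<Sum>i. ennreal (e * (1/2)^Suc i))"
    by (intro suminf_add[symmetric]) auto
  also have "(\<Sum>i. ennreal (e * (1/2)^Suc i)) = ennreal e"
    using e half by (intro sums_unique[symmetric]) (subst sums_ennreal, auto)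
  also have "(\<Sum>i. \<Sum>n. ennreal (norm (\<mu> (E i n)))) \<le> variation (\<Union>i. S i)"
  proof -
    have "(\<Sum>i. \<Sum>n. ennreal (norm (\<mu> (E i n))))
        = (\<Sum>k. ennreal (norm (\<mu> ((\<lambda>(i, n). E i n) (prod_decode k)))))"
      by (subst suminf_ennreal_2dimen[symmetric, where f = "\<lambda>(i, n). ennreal (norm (\<mu> (E i n)))"])
         (auto simp: case_prod_unfold)
    also have "\<dots> \<le> variation (\<Union>i. S i)"
    proof (rule suminf_le_variation)
      show "(\<lambda>(i, n). E i n) (prod_decode k) \<in> sets borel" for k
        using E(1) by (auto simp: case_prod_unfold)
      show "(\<lambda>(i, n). E i n) (prod_decode k) \<subseteq> (\<Union>i. S i)" for k
        using E(3)[symmetric] by (auto simp: case_prod_unfold)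
      have "E i n \<inter> E j m = {}" if "(i, n) \<noteq> (j, m)" for i j n m
      proof (cases "i = j")
        case True
        with that E(2)[of i] show ?thesis by (auto simp: disjoint_family_on_def)
      next
        case False
        with disj have "S i \<inter> S j = {}" by (auto simp: disjoint_family_on_def)
        with E(3) show ?thesis by blast
      qed
      moreover have "prod_decode k \<noteq> prod_decode l" if "k \<noteq> l" for k l
        using that by (metis prod_decode_inverse)
      ultimately show "disjoint_family (\<lambda>k. (\<lambda>(i, n). E i n) (prod_decode k))"
        unfolding disjoint_family_on_def case_prod_unfold by (metis prod.collapse)
    qed (use S in auto)
    finally show ?thesis .
  qed
  finally show "(\<Sum>i. variation (S i)) \<le> variation (\<Union>i. S i) + ennreal e" by simp
qed

lemma sets_total_variation [simp, measurable_cong]: "sets (total_variation \<mu>) = sets borel"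
  by (simp add: total_variation_eq sets_measure_of_conv sets.sigma_sets_eq[of borel, simplified])

lemma space_total_variation [simp]: "space (total_variation \<mu>) = UNIV"
  by (simp add: total_variation_eq space_measure_of_conv)

lemma emeasure_total_variation:
  assumes "S \<in> sets borel" shows "emeasure (total_variation \<mu>) S = variation S"
proof (rule emeasure_measure_of[OF total_variation_eq])
  show "positive (sets (total_variation \<mu>)) variation"
    by (simp add: positive_def variation_empty)
  show "countably_additive (sets (total_variation \<mu>)) variation"
    unfolding countably_additive_def
    by (auto intro!: antisym variation_UN_le variation_UN_ge)
qed (use assms in auto)

lemma norm_le_emeasure:
  assumes "S \<in> sets borel" shows "ennreal (norm (\<mu> S)) \<le> emeasure (total_variation \<mu>) S"
  using assms by (simp add: emeasure_total_variation norm_le_variation)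

text \<open>Some finite union A of pieces of a partition has |\<mu> A| > 1 + |\<mu> S|, so both A
  and S - A have measure of modulus at least 1. One of them still has infinite variation; the other
  is removed.\<close>

lemma variation_infinite_split:
  assumes S: "S \<in> sets borel" and inf: "emeasure (total_variation \<mu>) S = \<infinity>"
  shows "\<exists>S'\<in>sets borel. S' \<subseteq> S \<and> emeasure (total_variation \<mu>) S' = \<infinity> \<and> 1 \<le> norm (\<mu> (S - S'))"
proof -
  define t where "t = 1 + norm (\<mu> S)"
  then have t0: "0 \<le> t" by (simp add: add_nonneg_nonneg)
  have "ennreal (4 * t) < variation S"
    using inf S by (simp add: emeasure_total_variation)
  then obtain E :: "nat \<Rightarrow> complex set" where E: "range E \<subseteq> sets borel" "disjoint_family E"
      "(\<Union>n. E n) = S" "ennreal (4 * t) < (\<Sum>n. ennreal (norm (\<mu> (E n))))"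
    unfolding variation_def less_SUP_iff by blast
  obtain N where "ennreal (4 * t) < (\<Sum>n<N. ennreal (norm (\<mu> (E n))))"
    using E(4) by (metis less_SUP_iff suminf_eq_SUP)
  then have "4 * t < (\<Sum>n<N. norm (\<mu> (E n)))"
    using t0 by (subst (asm) sum_ennreal) (auto simp: ennreal_less_iff simp del: sum_ennreal)
  moreover obtain J where J: "J \<subseteq> {..<N}" "(\<Sum>n<N. norm (\<mu> (E n))) \<le> 4 * norm (\<Sum>n\<in>J. \<mu> (E n))"
    using exists_subset_norm_sum_ge[of "{..<N}" "\<lambda>n. \<mu> (E n)"] by auto
  ultimately have *: "t < norm (\<Sum>n\<in>J. \<mu> (E n))" by linarith
  define A where "A = (\<Union>n\<in>J. E n)"
  have fJ: "finite J" using J(1) finite_subset by blast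
  have A: "A \<in> sets borel" using E(1) fJ by (auto simp: A_def)
  have AS: "A \<subseteq> S" using E(3) by (auto simp: A_def)
  have "\<mu> A = (\<Sum>n\<in>J. \<mu> (E n))"
    unfolding A_def using E fJ by (intro measure_UN) (auto simp: disjoint_family_on_def)
  with * have tA: "t < norm (\<mu> A)" by simp
  then have 1: "1 \<le> norm (\<mu> A)" by (simp add: t_def) (use norm_ge_zero[of "\<mu> S"] in linarith)
  have "norm (\<mu> A) \<le> norm (\<mu> S) + norm (\<mu> (S - A))"
    using measure_Diff[OF A S AS] by (metis norm_minus_commute norm_triangle_sub add.commute)
  with tA have 2: "1 \<le> norm (\<mu> (S - A))" by (simp add: t_def)
  have "emeasure (total_variation \<mu>) S
      = emeasure (total_variation \<mu>) A + emeasure (total_variation \<mu>) (S - A)"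
    using A S AS by (subst plus_emeasure) (auto simp: Un_absorb1)
  with inf consider "emeasure (total_variation \<mu>) A = \<infinity>" | "emeasure (total_variation \<mu>) (S - A) = \<infinity>"
    by (metis ennreal_add_eq_top infinity_ennreal_def)
  then show ?thesis
  proof cases
    case 1
    with A AS 2 show ?thesis by blast
  next
    case 2
    moreover have "S - (S - A) = A" using AS by blast
    ultimately show ?thesis using A S \<open>1 \<le> norm (\<mu> A)\<close>
      by (intro bexI[of _ "S - A"]) auto
  qed
qed

text \<open>If the variation were infinite, the splitting could be repeated forever; the removed
  sets are disjoint with |\<mu>| at least 1, against the convergence of their series.\<close>

sublocale total_variation: finite_measure "total_variation \<mu>"
proof
  show "emeasure (total_variation \<mu>) (space (total_variation \<mu>)) \<noteq> \<infinity>"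
  proof
    assume "emeasure (total_variation \<mu>) (space (total_variation \<mu>)) = \<infinity>"
    then have inf: "emeasure (total_variation \<mu>) UNIV = \<infinity>" by simp
    define P where "P S \<longleftrightarrow> S \<in> sets borel \<and> emeasure (total_variation \<mu>) S = \<infinity>" for S
    have "\<exists>f. \<forall>n. P (f n) \<and> (f (Suc n) \<subseteq> f n \<and> 1 \<le> norm (\<mu> (f n - f (Suc n))))"
    proof (rule dependent_nat_choice)
      show "\<exists>S. P S" using inf by (auto simp: P_def intro!: exI[of _ UNIV])
    next
      fix S and n :: nat assume "P S"
      then show "\<exists>S'. P S' \<and> (S' \<subseteq> S \<and> 1 \<le> norm (\<mu> (S - S')))"
        using variation_infinite_split[of S] unfolding P_def by blast
    qed
    then obtain f where f: "\<And>n. P (f n)" "\<And>n. f (Suc n) \<subseteq> f n"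
        "\<And>n. 1 \<le> norm (\<mu> (f n - f (Suc n)))"
      by blast
    have dec: "f n \<subseteq> f m" if "m \<le> n" for m n
      using that f(2) by (rule lift_Suc_antimono_le[rotated])
    have "(\<lambda>n. \<mu> (f n - f (Suc n))) sums \<mu> (\<Union>n. f n - f (Suc n))"
    proof (rule sums_UN)
      show "f n - f (Suc n) \<in> sets borel" for n using f(1) by (auto simp: P_def)
      have "(f m - f (Suc m)) \<inter> (f n - f (Suc n)) = {}" if "m < n" for m n
        using dec[of "Suc m" n] that by auto
      then show "disjoint_family (\<lambda>n. f n - f (Suc n))"
        unfolding disjoint_family_on_def by (metis inf_commute nat_neq_iff)
    qed
    then have "(\<lambda>n. \<mu> (f n - f (Suc n))) \<longlonglongrightarrow> 0"
      by (intro summable_LIMSEQ_zero) (auto dest: sums_summable)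
    then have "\<forall>\<^sub>F n in sequentially. norm (\<mu> (f n - f (Suc n))) < 1"
      using order_tendstoD(2)[OF tendsto_norm_zero, of _ _ 1] by auto
    then show False using f(3) by (auto simp: eventually_sequentially) (meson leD order_refl)
  qed
qed

text \<open>The complement is the union of all open sets on whose Borel subsets \<mu> vanishes; by
  Lindelof countably many of them suffice.\<close>

lemma emeasure_support: "emeasure (total_variation \<mu>) (- measure_support \<mu>) = 0"
proof -
  define \<U> where "\<U> = {U. open U \<and> (\<forall>E\<in>sets borel. E \<subseteq> U \<longrightarrow> \<mu> E = 0)}"
  have eq: "- measure_support \<mu> = \<Union>\<U>"
    by (auto simp: measure_support_def \<U>_def)
  obtain \<V> where \<V>: "\<V> \<subseteq> \<U>" "countable \<V>" "\<Union>\<V> = \<Union>\<U>"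
    using Lindelof[of \<U>] by (auto simp: \<U>_def)
  have "U \<in> null_sets (total_variation \<mu>)" if "U \<in> \<V>" for U
  proof -
    have U: "U \<in> sets borel" "\<And>E. E \<in> sets borel \<Longrightarrow> E \<subseteq> U \<Longrightarrow> \<mu> E = 0"
      using that \<V>(1) by (auto simp: \<U>_def)
    have "variation U \<le> 0"
      unfolding variation_def
    proof (rule SUP_least, safe)
      fix E :: "nat \<Rightarrow> complex set" assume E: "range E \<subseteq> sets borel" "U = (\<Union>n. E n)"
      have "\<mu> (E n) = 0" for n using E by (intro U(2)) auto
      then show "(\<Sum>n. ennreal (norm (\<mu> (E n)))) \<le> 0" by simp
    qed
    then show ?thesis using U(1) by (simp add: null_sets_def emeasure_total_variation)
  qed
  then have "(\<Union>U\<in>\<V>. U) \<in> null_sets (total_variation \<mu>)"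
    using \<V>(2) by (intro null_sets_UN') auto
  then show ?thesis using \<V>(3) eq by (simp add: null_sets_def)
qed

end

section \<open>Integration against a complex measure\<close>

lemma tendsto_zero_ennrealI:
  fixes f :: "'i \<Rightarrow> ennreal"
  assumes "\<And>e::real. 0 < e \<Longrightarrow> \<forall>\<^sub>F i in F. f i < ennreal e"
  shows "(f \<longlongrightarrow> 0) F"
proof (rule order_tendstoI)
  fix y :: ennreal assume "0 < y"
  then obtain e :: real where e: "0 < ennreal e" "ennreal e < y"
    by (metis dense ennreal_cases less_top not_less_iff_gr_or_eq order.strict_trans)
  then have "\<forall>\<^sub>F i in F. f i < ennreal e" by (intro assms) simp
  then show "\<forall>\<^sub>F i in F. f i < y" by eventually_elim (use e in order)
qed simp

context complex_measure
begin

definition simple_cm_integral :: "(complex \<Rightarrow> 'b::complex_normed_vector) \<Rightarrow> 'b"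
  where "simple_cm_integral s = (\<Sum>y\<in>range s. \<mu> (s -` {y}) *\<^sub>C y)"

text \<open>g may identify values of h, so a level set of the composition is a finite union of level
  sets of h. With a pair of simple functions as h this yields additivity, with a sampling map it
  yields Riemann sums.\<close>

lemma simple_cm_integral_compose:
  assumes "simple_function borel h"
  shows "simple_cm_integral (\<lambda>x. g (h x)) = (\<Sum>w\<in>range h. \<mu> (h -` {w}) *\<^sub>C g w)"
proof -
  have fin: "finite (range h)" and meas: "h -` {w} \<in> sets borel" for w
    using assms simple_functionD(2)[OF assms, of "{w}"] by (auto simp: simple_function_def)
  have "\<mu> ((\<lambda>x. g (h x)) -` {y}) *\<^sub>C y = (\<Sum>w\<in>{w. w \<in> range h \<and> g w = y}. \<mu> (h -` {w}) *\<^sub>C g w)" for y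
  proof -
    have "(\<lambda>x. g (h x)) -` {y} = (\<Union>w\<in>{w. w \<in> range h \<and> g w = y}. h -` {w})" by auto
    moreover have "\<mu> \<dots> = (\<Sum>w\<in>{w. w \<in> range h \<and> g w = y}. \<mu> (h -` {w}))"
      using fin meas by (intro measure_UN) (auto simp: disjoint_family_on_def)
    ultimately show ?thesis by (simp add: scaleC_sum_left)
  qed
  then have "simple_cm_integral (\<lambda>x. g (h x))
      = (\<Sum>y\<in>range (\<lambda>x. g (h x)). \<Sum>w\<in>{w. w \<in> range h \<and> g w = y}. \<mu> (h -` {w}) *\<^sub>C g w)"
    by (simp add: simple_cm_integral_def)
  also have "\<dots> = (\<Sum>w\<in>range h. \<mu> (h -` {w}) *\<^sub>C g w)"
    using fin by (intro sum.group) (auto simp: image_image[symmetric, of g h])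
  finally show ?thesis .
qed

lemma simple_cm_integral_diff:
  assumes "simple_function borel s" "simple_function borel s'"
  shows "simple_cm_integral (\<lambda>x. s x - s' x) = simple_cm_integral s - simple_cm_integral s'"
proof -
  have h: "simple_function borel (\<lambda>x. (s x, s' x))" using assms by simp
  show ?thesis
    using simple_cm_integral_compose[OF h, of fst] simple_cm_integral_compose[OF h, of snd]
      simple_cm_integral_compose[OF h, of "\<lambda>(a, b). a - b"]
    by (simp add: case_prod_unfold scaleC_diff_right sum_subtractf)
qed

lemma norm_simple_cm_integral_le:
  assumes "simple_function borel s"
  shows "ennreal (norm (simple_cm_integral s)) \<le> (\<integral>\<^sup>+x. ennreal (norm (s x)) \<partial>total_variation \<mu>)"
proof -
  have fin: "finite (range s)" and meas: "s -` {y} \<in> sets borel" for y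
    using assms simple_functionD(2)[OF assms, of "{y}"] by (auto simp: simple_function_def)
  have "ennreal (norm (simple_cm_integral s)) \<le> ennreal (\<Sum>y\<in>range s. norm y * norm (\<mu> (s -` {y})))"
    unfolding simple_cm_integral_def
    by (intro ennreal_leI order_trans[OF norm_sum]) (simp add: norm_scaleC mult.commute)
  also have "\<dots> = (\<Sum>y\<in>range s. ennreal (norm y) * ennreal (norm (\<mu> (s -` {y}))))"
    by (simp add: ennreal_mult flip: sum_ennreal)
  also have "\<dots> \<le> (\<Sum>y\<in>range s. ennreal (norm y) * emeasure (total_variation \<mu>) (s -` {y}))"
    by (intro sum_mono mult_left_mono norm_le_emeasure meas) auto
  also have "\<dots> = (\<Sum>y\<in>range s. \<integral>\<^sup>+x. ennreal (norm y) * indicator (s -` {y}) x \<partial>total_variation \<mu>)"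
    by (intro sum.cong refl nn_integral_cmult_indicator[symmetric]) (use meas in simp)
  also have "\<dots> = (\<integral>\<^sup>+x. (\<Sum>y\<in>range s. ennreal (norm y) * indicator (s -` {y}) x) \<partial>total_variation \<mu>)"
    using meas by (intro nn_integral_sum[symmetric]) auto
  also have "\<dots> = (\<integral>\<^sup>+x. ennreal (norm (s x)) \<partial>total_variation \<mu>)"
  proof (intro nn_integral_cong)
    fix x
    have "(\<Sum>y\<in>range s. ennreal (norm y) * indicator (s -` {y}) x)
        = (\<Sum>y\<in>range s. if y = s x then ennreal (norm (s x)) else 0)"
      by (intro sum.cong) (auto simp: indicator_def)
    also have "\<dots> = ennreal (norm (s x))" using fin by simp
    finally show "(\<Sum>y\<in>range s. ennreal (norm y) * indicator (s -` {y}) x) = ennreal (norm (s x))" .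
  qed
  finally show ?thesis .
qed

text \<open>The integrand f is only an almost everywhere limit of simple functions, so |f - b| may
  fail to be measurable and its integral to be additive. It is replaced by \<open>g b\<close>, a
  measurable liminf that agrees with it almost everywhere.\<close>

lemma norm_diff_simple_le:
  assumes "has_cm_integral \<mu> f I" and s: "simple_function borel s"
  shows "ennreal (norm (I - simple_cm_integral s)) \<le> (\<integral>\<^sup>+x. ennreal (norm (f x - s x)) \<partial>total_variation \<mu>)"
proof -
  obtain a :: "nat \<Rightarrow> complex \<Rightarrow> 'a" where a: "\<And>n. simple_function borel (a n)"
    "AE x in total_variation \<mu>. (\<lambda>n. a n x) \<longlonglongrightarrow> f x"
    "(\<lambda>n. \<integral>\<^sup>+ x. ennreal (norm (f x - a n x)) \<partial>total_variation \<mu>) \<longlonglongrightarrow> 0"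
    "(\<lambda>n. simple_cm_integral (a n)) \<longlonglongrightarrow> I"
    using assms(1) unfolding has_cm_integral_def simple_cm_integral_def by blast
  define g where "g b x = liminf (\<lambda>m. ennreal (norm (a m x - b x)))" for b :: "complex \<Rightarrow> 'a" and x
  have meas_norm: "(\<lambda>x. ennreal (norm (b x - b' x))) \<in> borel_measurable borel"
    if "simple_function borel b" "simple_function borel b'" for b b' :: "complex \<Rightarrow> 'a"
    using borel_measurable_simple_function[OF simple_function_compose2[OF that, of "\<lambda>u v. ennreal (norm (u - v))"]]
    by simp
  have g_meas: "g b \<in> borel_measurable (total_variation \<mu>)" if "simple_function borel b" for b
    unfolding g_def[abs_def] using meas_norm[OF a(1) that] by measurable
  have g_eq: "AE x in total_variation \<mu>. ennreal (norm (f x - b x)) = g b x" for b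
    using a(2)
  proof eventually_elim
    case (elim x)
    then have "(\<lambda>m. ennreal (norm (a m x - b x))) \<longlonglongrightarrow> ennreal (norm (f x - b x))"
      by (intro tendsto_intros)
    then show ?case unfolding g_def by (metis lim_imp_Liminf sequentially_bot)
  qed
  have "ennreal (norm (simple_cm_integral (a n) - simple_cm_integral s)) \<le>
      (\<integral>\<^sup>+x. ennreal (norm (f x - a n x)) \<partial>total_variation \<mu>) +
      (\<integral>\<^sup>+x. ennreal (norm (f x - s x)) \<partial>total_variation \<mu>)" for n
  proof -
    have "ennreal (norm (simple_cm_integral (a n) - simple_cm_integral s))
        \<le> (\<integral>\<^sup>+x. ennreal (norm (a n x - s x)) \<partial>total_variation \<mu>)"
      using norm_simple_cm_integral_le[of "\<lambda>x. a n x - s x"] simple_cm_integral_diff[OF a(1) s]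
        simple_function_diff[OF a(1) s] by simp
    also have "\<dots> \<le> (\<integral>\<^sup>+x. g (a n) x + g s x \<partial>total_variation \<mu>)"
    proof (rule nn_integral_mono_AE)
      show "AE x in total_variation \<mu>. ennreal (norm (a n x - s x)) \<le> g (a n) x + g s x"
        using g_eq[of "a n"] g_eq[of s]
      proof eventually_elim
        case (elim x)
        have "norm (a n x - s x) \<le> norm (f x - a n x) + norm (f x - s x)"
          by (metis norm_minus_commute norm_triangle_ineq diff_add_cancel add_diff_eq)
        then have "ennreal (norm (a n x - s x)) \<le> ennreal (norm (f x - a n x)) + ennreal (norm (f x - s x))"
          by (simp flip: ennreal_plus)
        with elim show ?case by simp
      qed
    qed
    also have "\<dots> = (\<integral>\<^sup>+x. g (a n) x \<partial>total_variation \<mu>) + (\<integral>\<^sup>+x. g s x \<partial>total_variation \<mu>)"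
      using a(1) s by (intro nn_integral_add g_meas)
    also have "\<dots> = (\<integral>\<^sup>+x. ennreal (norm (f x - a n x)) \<partial>total_variation \<mu>) +
      (\<integral>\<^sup>+x. ennreal (norm (f x - s x)) \<partial>total_variation \<mu>)"
      using nn_integral_cong_AE[OF g_eq[of "a n"]] nn_integral_cong_AE[OF g_eq[of s]] by simp
    finally show ?thesis .
  qed
  moreover have "(\<lambda>n. ennreal (norm (simple_cm_integral (a n) - simple_cm_integral s)))
      \<longlonglongrightarrow> ennreal (norm (I - simple_cm_integral s))"
    by (intro tendsto_intros a(4))
  moreover have "(\<lambda>n. (\<integral>\<^sup>+x. ennreal (norm (f x - a n x)) \<partial>total_variation \<mu>) +
      (\<integral>\<^sup>+x. ennreal (norm (f x - s x)) \<partial>total_variation \<mu>))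
      \<longlonglongrightarrow> 0 + (\<integral>\<^sup>+x. ennreal (norm (f x - s x)) \<partial>total_variation \<mu>)"
    by (intro tendsto_intros a(3))
  ultimately show ?thesis
    by (intro LIMSEQ_le[of "\<lambda>n. ennreal (norm (simple_cm_integral (a n) - simple_cm_integral s))"]) auto
qed

lemma has_cm_integral_unique:
  assumes "has_cm_integral \<mu> f I" "has_cm_integral \<mu> f I'"
  shows "I = I'"
proof -
  obtain a :: "nat \<Rightarrow> complex \<Rightarrow> 'a" where a: "\<And>n. simple_function borel (a n)"
    "(\<lambda>n. \<integral>\<^sup>+ x. ennreal (norm (f x - a n x)) \<partial>total_variation \<mu>) \<longlonglongrightarrow> 0"
    "(\<lambda>n. simple_cm_integral (a n)) \<longlonglongrightarrow> I'"
    using assms(2) unfolding has_cm_integral_def simple_cm_integral_def by blast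
  have "(\<lambda>n. ennreal (norm (I - simple_cm_integral (a n)))) \<longlonglongrightarrow> 0"
    by (rule tendsto_sandwich[OF _ _ tendsto_const a(2)])
       (use norm_diff_simple_le[OF assms(1) a(1)] in auto)
  moreover have "(\<lambda>n. ennreal (norm (I - simple_cm_integral (a n)))) \<longlonglongrightarrow> ennreal (norm (I - I'))"
    by (intro tendsto_intros a(3))
  ultimately have "ennreal (norm (I - I')) = 0" by (metis LIMSEQ_unique)
  then show ?thesis by simp
qed

lemma cm_integral_eq: "has_cm_integral \<mu> f I \<Longrightarrow> cm_integral \<mu> f = I"
  unfolding cm_integral_def by (blast intro: the_equality has_cm_integral_unique)

end

text \<open>A grid of mesh 1 / (n + 1) is laid over the plane, and all points of K in one cell are
  sent to one chosen point of K in that cell. Both coordinates move by at most the mesh, whence the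
  2.\<close>

lemma exists_sample_maps:
  fixes K :: "complex set"
  assumes "compact K" "K \<noteq> {}"
  obtains c :: "nat \<Rightarrow> complex \<Rightarrow> complex" where
    "\<And>n. simple_function borel (c n)" "\<And>n z. c n z \<in> K"
    "\<And>n z. z \<in> K \<Longrightarrow> dist (c n z) z \<le> 2 / (real n + 1)"
proof -
  obtain k0 where k0: "k0 \<in> K" using assms by blast
  define q :: "nat \<Rightarrow> complex \<Rightarrow> int \<times> int"
    where "q n z = (\<lfloor>(real n + 1) * Re z\<rfloor>, \<lfloor>(real n + 1) * Im z\<rfloor>)" for n z
  \<comment> \<open>\<open>None\<close> marks the points outside K, all of which are sent to
    \<open>k0\<close>: samples must lie in K everywhere.\<close>
  define h where "h n z = (if z \<in> K then Some (q n z) else None)" for n z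
  define g where "g n p = (case p of None \<Rightarrow> k0 | Some r \<Rightarrow> SOME w. w \<in> K \<and> q n w = r)" for n p
  obtain B where B: "\<And>z. z \<in> K \<Longrightarrow> norm z \<le> B"
    using compact_imp_bounded[OF assms(1)] by (auto simp: bounded_iff)
  have h: "simple_function borel (h n)" for n
    unfolding simple_function_def
  proof (intro conjI ballI)
    define M where "M = \<lceil>(real n + 1) * B\<rceil>"
    have "q n z \<in> {-M-1..M} \<times> {-M-1..M}" if "z \<in> K" for z
    proof -
      have *: "- M - 1 \<le> \<lfloor>(real n + 1) * u\<rfloor> \<and> \<lfloor>(real n + 1) * u\<rfloor> \<le> M" if "\<bar>u\<bar> \<le> B" for u
      proof -
        have "\<bar>(real n + 1) * u\<bar> \<le> (real n + 1) * B"
          using that by (simp add: abs_mult mult_left_mono)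
        then show ?thesis unfolding M_def by linarith
      qed
      show ?thesis
        using *[of "Re z"] *[of "Im z"] B[OF that] abs_Re_le_cmod[of z] abs_Im_le_cmod[of z]
        by (auto simp: q_def)
    qed
    then have "h n ` space borel \<subseteq> insert None (Some ` ({-M-1..M} \<times> {-M-1..M}))"
      by (auto simp: h_def)
    then show "finite (h n ` space borel)"
      by (rule finite_subset) auto
  next
    fix y
    have K: "K \<in> sets borel" using assms(1) by (intro borel_closed compact_imp_closed)
    show "h n -` {y} \<inter> space borel \<in> sets borel"
    proof (cases y)
      case None
      then have "h n -` {y} \<inter> space borel = - K" by (auto simp: h_def)
      then show ?thesis using K by simp
    next
      case (Some r)
      then have "h n -` {y} \<inter> space borel = K \<inter> {z \<in> space borel. \<lfloor>(real n + 1) * Re z\<rfloor> = fst r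
          \<and> \<lfloor>(real n + 1) * Im z\<rfloor> = snd r}"
        by (auto simp: h_def q_def split: if_splits)
      also have "\<dots> \<in> sets borel" using K by measurable
      finally show ?thesis .
    qed
  qed
  have some: "(SOME w. w \<in> K \<and> q n w = q n z) \<in> K \<and> q n (SOME w. w \<in> K \<and> q n w = q n z) = q n z"
    if "z \<in> K" for n z
    using someI[of "\<lambda>w. w \<in> K \<and> q n w = q n z" z] that by simp
  show ?thesis
  proof
    show "simple_function borel (\<lambda>z. g n (h n z))" for n
      using h by (rule simple_function_compose1)
    show "g n (h n z) \<in> K" for n z
      using some k0 by (auto simp: g_def h_def)
    fix n z assume z: "z \<in> K"
    define w where "w = g n (h n z)"
    have "q n w = q n z" using some z by (simp add: w_def g_def h_def)
    then have fl: "\<lfloor>(real n + 1) * Re w\<rfloor> = \<lfloor>(real n + 1) * Re z\<rfloor>"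
      "\<lfloor>(real n + 1) * Im w\<rfloor> = \<lfloor>(real n + 1) * Im z\<rfloor>" by (auto simp: q_def)
    have aux: "\<bar>u - v\<bar> \<le> 1 / (real n + 1)"
      if "\<lfloor>(real n + 1) * u\<rfloor> = \<lfloor>(real n + 1) * v\<rfloor>" for u v
    proof -
      have "\<bar>(real n + 1) * (u - v)\<bar> \<le> 1" using that unfolding right_diff_distrib by linarith
      then show ?thesis by (simp add: abs_mult pos_le_divide_eq mult.commute)
    qed
    have "\<bar>Re (w - z)\<bar> \<le> 1 / (real n + 1)" "\<bar>Im (w - z)\<bar> \<le> 1 / (real n + 1)"
      using aux[OF fl(1)] aux[OF fl(2)] by simp_all
    then show "dist (g n (h n z)) z \<le> 2 / (real n + 1)"
      using cmod_le[of "w - z"] unfolding w_def dist_norm by linarith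
  qed
qed

text \<open>K may be any compact set of full variation rather than the support itself; this freedom
  serves later to make K nonempty and stable under conjugation.\<close>

locale compact_complex_measure = complex_measure +
  fixes K :: "complex set"
  assumes compact: "compact K" and null: "emeasure (total_variation \<mu>) (- K) = 0"
begin

definition mass :: real where "mass = measure (total_variation \<mu>) UNIV"

lemma mass_nonneg: "0 \<le> mass" by (simp add: mass_def)

lemma K_borel [simp]: "K \<in> sets borel" "- K \<in> sets borel"
  using compact by (auto intro!: borel_closed borel_comp compact_imp_closed)

lemma AE_K: "AE x in total_variation \<mu>. x \<in> K"
  by (rule AE_I[of _ _ "- K"]) (use null in auto)

lemma measure_Int: assumes "E \<in> sets borel" shows "\<mu> (E \<inter> K) = \<mu> E"
proof -
  have "emeasure (total_variation \<mu>) (E - K) \<le> emeasure (total_variation \<mu>) (- K)"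
    by (intro emeasure_mono) auto
  then have "emeasure (total_variation \<mu>) (E - K) = 0" using null by simp
  then have "\<mu> (E - K) = 0" using norm_le_emeasure[of "E - K"] sets.Diff[OF assms K_borel(1)] by simp
  moreover have "\<mu> (E \<inter> K \<union> (E - K)) = \<mu> (E \<inter> K) + \<mu> (E - K)"
    using assms by (intro measure_Un) auto
  ultimately show ?thesis by (simp add: Int_Diff_Un)
qed

lemma nn_integral_le:
  assumes "\<And>z. z \<in> K \<Longrightarrow> norm (g z) \<le> d"
  shows "(\<integral>\<^sup>+x. ennreal (norm (g x)) \<partial>total_variation \<mu>) \<le> ennreal (mass * d)"
proof -
  have "(\<integral>\<^sup>+x. ennreal (norm (g x)) \<partial>total_variation \<mu>) \<le> (\<integral>\<^sup>+x. ennreal d \<partial>total_variation \<mu>)"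
    using AE_K by (intro nn_integral_mono_AE) (auto elim!: eventually_mono intro!: ennreal_leI assms)
  also have "\<dots> = ennreal (mass * d)"
    by (simp add: total_variation.emeasure_eq_measure mass_def ennreal_mult'' mult.commute)
  finally show ?thesis .
qed

lemma norm_cm_integral_diff_le:
  assumes "has_cm_integral \<mu> f I" "simple_function borel s" "\<And>z. z \<in> K \<Longrightarrow> norm (f z - s z) \<le> d" "0 \<le> d"
  shows "norm (I - simple_cm_integral s) \<le> mass * d"
  using order_trans[OF norm_diff_simple_le[OF assms(1,2)] nn_integral_le[of "\<lambda>z. f z - s z" d]] assms(3,4)
  by (subst (asm) ennreal_le_iff) (auto simp: mass_nonneg)

lemma norm_cm_integral_le:
  assumes "has_cm_integral \<mu> f I" "\<And>z. z \<in> K \<Longrightarrow> norm (f z) \<le> d" "0 \<le> d"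
  shows "norm I \<le> mass * d"
  using norm_cm_integral_diff_le[OF assms(1), of "\<lambda>_. 0" d] assms(2,3)
  by (simp add: simple_cm_integral_def)

text \<open>Stated as a property, so that conjugated sampling maps qualify too and one sequence can
  serve operator-valued and scalar integrands at the same time.\<close>

definition sample_maps :: "(nat \<Rightarrow> complex \<Rightarrow> complex) \<Rightarrow> bool"
  where "sample_maps c \<longleftrightarrow> (\<forall>n. simple_function borel (c n)) \<and> (\<forall>n z. c n z \<in> K) \<and>
    (\<forall>e>0. \<forall>\<^sub>F n in sequentially. \<forall>z\<in>K. dist (c n z) z < e)"

definition riemann_sum :: "(complex \<Rightarrow> complex) \<Rightarrow> (complex \<Rightarrow> 'b::complex_normed_vector) \<Rightarrow> 'b"
  where "riemann_sum c f = (\<Sum>w\<in>range c. \<mu> (c -` {w}) *\<^sub>C f w)"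

lemma riemann_sum_eq:
  "simple_function borel c \<Longrightarrow> riemann_sum c f = simple_cm_integral (\<lambda>z. f (c z))"
  by (simp add: riemann_sum_def simple_cm_integral_compose)

lemma sample_maps_uniform:
  assumes c: "sample_maps c" and f: "continuous_on K f" and e: "0 < e"
  shows "\<forall>\<^sub>F n in sequentially. \<forall>z\<in>K. dist (f (c n z)) (f z) < e"
proof -
  have "uniformly_continuous_on K f" using f compact by (rule compact_uniformly_continuous)
  then obtain d where d: "0 < d" "\<And>x y. x \<in> K \<Longrightarrow> y \<in> K \<Longrightarrow> dist x y < d \<Longrightarrow> dist (f x) (f y) < e"
    using e unfolding uniformly_continuous_on_def by metis
  have "\<forall>\<^sub>F n in sequentially. \<forall>z\<in>K. dist (c n z) z < d"
    using c d(1) by (auto simp: sample_maps_def)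
  then show ?thesis
    by eventually_elim (use c d(2) in \<open>auto simp: sample_maps_def\<close>)
qed

text \<open>The simple functions \<open>f (c n z)\<close> converge to f uniformly on K, and K
  carries the finite variation, so their integrals form a Cauchy sequence; its limit is the Bochner
  integral.\<close>

lemma has_cm_integral_riemann_sum:
  fixes f :: "complex \<Rightarrow> 'b::{complex_normed_vector, banach}"
  assumes c: "sample_maps c" and f: "continuous_on K f"
  shows "\<exists>I. has_cm_integral \<mu> f I \<and> (\<lambda>n. riemann_sum (c n) f) \<longlonglongrightarrow> I"
proof -
  define s where "s n z = f (c n z)" for n z
  have simp_c: "simple_function borel (c n)" for n using c by (simp add: sample_maps_def)
  then have simp_s: "simple_function borel (s n)" for n
    unfolding s_def[abs_def] by (rule simple_function_compose1)
  have unif: "\<forall>\<^sub>F n in sequentially. \<forall>z\<in>K. norm (f z - s n z) < e" if "0 < e" for e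
    using sample_maps_uniform[OF c f that] by (simp add: s_def dist_norm norm_minus_commute)
  have "Cauchy (\<lambda>n. simple_cm_integral (s n))"
  proof (rule CauchyI)
    fix e :: real assume e: "0 < e"
    \<comment> \<open>The 1 added to \<open>mass\<close> avoids division by 0 for the zero
      measure.\<close>
    define d where "d = e / (2 * (mass + 1))"
    have d: "0 < d" using e mass_nonneg by (simp add: d_def)
    obtain N where N: "\<And>n z. n \<ge> N \<Longrightarrow> z \<in> K \<Longrightarrow> norm (f z - s n z) < d"
      using unif[OF d] by (auto simp: eventually_sequentially)
    have "norm (simple_cm_integral (s m) - simple_cm_integral (s n)) < e" if "m \<ge> N" "n \<ge> N" for m n
    proof -
      have "ennreal (norm (simple_cm_integral (s m) - simple_cm_integral (s n)))
          \<le> (\<integral>\<^sup>+x. ennreal (norm (s m x - s n x)) \<partial>total_variation \<mu>)"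
        using norm_simple_cm_integral_le[of "\<lambda>x. s m x - s n x"]
          simple_cm_integral_diff[OF simp_s simp_s] simple_function_diff[OF simp_s simp_s] by simp
      also have "\<dots> \<le> ennreal (mass * (2 * d))"
      proof (rule nn_integral_le)
        fix z assume z: "z \<in> K"
        have "norm (s m z - s n z) \<le> norm (f z - s m z) + norm (f z - s n z)"
          by (metis norm_minus_commute norm_triangle_ineq diff_add_cancel add_diff_eq)
        with N[OF that(1) z] N[OF that(2) z] show "norm (s m z - s n z) \<le> 2 * d" by simp
      qed
      finally have "norm (simple_cm_integral (s m) - simple_cm_integral (s n)) \<le> mass * (2 * d)"
        by (subst (asm) ennreal_le_iff) (use mass_nonneg d in auto)
      also have "\<dots> < (mass + 1) * (2 * d)" using d by simp
      also have "\<dots> = e" using mass_nonneg by (simp add: d_def field_simps)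
      finally show ?thesis .
    qed
    then show "\<exists>M. \<forall>m\<ge>M. \<forall>n\<ge>M. norm (simple_cm_integral (s m) - simple_cm_integral (s n)) < e"
      by blast
  qed
  then obtain I where I: "(\<lambda>n. simple_cm_integral (s n)) \<longlonglongrightarrow> I"
    using Cauchy_convergent convergent_def by blast
  have "has_cm_integral \<mu> f I"
    unfolding has_cm_integral_def
  proof (intro exI[of _ s] conjI allI)
    show "AE x in total_variation \<mu>. (\<lambda>n. s n x) \<longlonglongrightarrow> f x"
      using AE_K
    proof eventually_elim
      case (elim x)
      show ?case
      proof (rule tendstoI)
        fix e :: real assume "0 < e"
        from unif[OF this] show "\<forall>\<^sub>F n in sequentially. dist (s n x) (f x) < e"
          by eventually_elim (use elim in \<open>auto simp: dist_norm norm_minus_commute\<close>)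
      qed
    qed
    show "(\<lambda>n. \<integral>\<^sup>+ x. ennreal (norm (f x - s n x)) \<partial>total_variation \<mu>) \<longlonglongrightarrow> 0"
    proof (rule tendsto_zero_ennrealI)
      fix e :: real assume e: "0 < e"
      define d where "d = e / (mass + 1) / 2"
      have d: "0 < d" using e mass_nonneg by (simp add: d_def)
      have md: "mass * d < e"
      proof -
        have "mass * d < (mass + 1) * (2 * d)" using d mass_nonneg by (intro mult_strict_mono) auto
        also have "\<dots> = e" using mass_nonneg by (simp add: d_def field_simps)
        finally show ?thesis .
      qed
      from unif[OF d]
      show "\<forall>\<^sub>F n in sequentially. (\<integral>\<^sup>+ x. ennreal (norm (f x - s n x)) \<partial>total_variation \<mu>) < ennreal e"
      proof eventually_elim
        case (elim n)
        have "(\<integral>\<^sup>+ x. ennreal (norm (f x - s n x)) \<partial>total_variation \<mu>) \<le> ennreal (mass * d)"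
          using elim by (intro nn_integral_le) (auto intro: less_imp_le)
        also have "\<dots> < ennreal e" using md e by (simp add: ennreal_lessI)
        finally show ?case .
      qed
    qed
    show "(\<lambda>n. \<Sum>y\<in>range (s n). \<mu> (s n -` {y}) *\<^sub>C y) \<longlonglongrightarrow> I"
      using I by (simp add: simple_cm_integral_def)
  qed (rule simp_s)
  moreover have "(\<lambda>n. riemann_sum (c n) f) \<longlonglongrightarrow> I"
    using I by (simp add: riemann_sum_eq[OF simp_c] s_def[abs_def])
  ultimately show ?thesis by blast
qed

lemma riemann_sum_tendsto:
  fixes f :: "complex \<Rightarrow> 'b::{complex_normed_vector, banach}"
  assumes "sample_maps c" "continuous_on K f"
  shows "(\<lambda>n. riemann_sum (c n) f) \<longlonglongrightarrow> cm_integral \<mu> f"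
    and "has_cm_integral \<mu> f (cm_integral \<mu> f)"
  using has_cm_integral_riemann_sum[OF assms] by (auto simp: cm_integral_eq)

lemma sample_maps_exist:
  assumes "K \<noteq> {}" shows "\<exists>c. sample_maps c"
proof -
  obtain c :: "nat \<Rightarrow> complex \<Rightarrow> complex" where c: "\<And>n. simple_function borel (c n)" "\<And>n z. c n z \<in> K"
    "\<And>n z. z \<in> K \<Longrightarrow> dist (c n z) z \<le> 2 / (real n + 1)"
    using exists_sample_maps[OF compact assms] by blast
  have "\<forall>\<^sub>F n in sequentially. \<forall>z\<in>K. dist (c n z) z < e" if "0 < e" for e
  proof -
    have "(\<lambda>n. 2 / (real n + 1)) \<longlonglongrightarrow> 0"
      using tendsto_mult[OF tendsto_const[of 2] LIMSEQ_inverse_real_of_nat]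
      by (simp add: divide_inverse add.commute)
    then have "\<forall>\<^sub>F n in sequentially. 2 / (real n + 1) < e"
      using that by (rule order_tendstoD)
    then show ?thesis by eventually_elim (use c(3) in \<open>fastforce intro: le_less_trans\<close>)
  qed
  with c show ?thesis unfolding sample_maps_def by blast
qed

end

section \<open>The transform of a compactly supported measure\<close>

context compact_complex_measure
begin

text \<open>The transform F expressed through \<mu>; \<open>fourier_borel \<phi>\<close> is
  identified with it only in the final proof.\<close>

definition transform :: "complex \<Rightarrow> complex"
  where "transform z = cm_integral \<mu> (\<lambda>\<xi>. exp (- z * \<xi>))"

lemma has_transform:
  assumes "K \<noteq> {}"
  shows "has_cm_integral \<mu> (\<lambda>\<xi>. exp (- z * \<xi>)) (transform z)"
proof -
  obtain c where "sample_maps c" using sample_maps_exist[OF assms] by blast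
  then show ?thesis
    unfolding transform_def by (rule riemann_sum_tendsto(2)) (intro continuous_intros)
qed

lemma norm_transform_le:
  assumes "K \<noteq> {}" and "\<And>\<xi>. \<xi> \<in> K \<Longrightarrow> d \<le> Re (z * \<xi>)"
  shows "norm (transform z) \<le> mass * exp (- d)"
proof (rule norm_cm_integral_le[OF has_transform[OF assms(1)]])
  show "norm (exp (- z * \<xi>)) \<le> exp (- d)" if "\<xi> \<in> K" for \<xi>
    using assms(2)[OF that] by simp
qed simp

lemma transform_zero:
  assumes "K \<noteq> {}" shows "transform 0 = \<mu> UNIV"
proof -
  obtain c where c: "sample_maps c" using sample_maps_exist[OF assms] by blast
  have "riemann_sum (c n) (\<lambda>\<xi>. exp (- 0 * \<xi>)) = \<mu> UNIV" for n
  proof -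
    have s: "simple_function borel (c n)" using c by (simp add: sample_maps_def)
    have "riemann_sum (c n) (\<lambda>\<xi>. exp (- 0 * \<xi>)) = simple_cm_integral (\<lambda>_. 1)"
      using riemann_sum_eq[OF s, of "\<lambda>_. 1"] by simp
    also have "\<dots> = \<mu> UNIV" by (simp add: simple_cm_integral_def scaleC_complex_def)
    finally show ?thesis .
  qed
  moreover have "(\<lambda>n. riemann_sum (c n) (\<lambda>\<xi>. exp (- 0 * \<xi>))) \<longlonglongrightarrow> transform 0"
    unfolding transform_def by (intro riemann_sum_tendsto c continuous_intros)
  ultimately show ?thesis by (simp add: LIMSEQ_const_iff)
qed

text \<open>Riemann sums are finite exponential sums, hence entire; uniform continuity of the kernel
  on disc times K makes them converge locally uniformly.\<close>

lemma transform_holomorphic: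
  assumes "K \<noteq> {}" shows "transform holomorphic_on UNIV"
proof -
  obtain c where c: "sample_maps c" using sample_maps_exist[OF assms] by blast
  have s: "simple_function borel (c n)" for n using c by (simp add: sample_maps_def)
  define f where "f n z = riemann_sum (c n) (\<lambda>\<xi>. exp (- z * \<xi>))" for n z
  show ?thesis
  proof (rule holomorphic_uniform_sequence[of UNIV f])
    show "f n holomorphic_on UNIV" for n
      unfolding f_def riemann_sum_def scaleC_complex_def by (intro holomorphic_intros)
    fix x :: complex
    have "uniform_limit (cball x 1) f transform sequentially"
    proof (rule uniform_limitI)
      fix e :: real assume e: "0 < e"
      define d where "d = e / (mass + 1) / 2"
      have d: "0 < d" "mass * d < e"
      proof -
        show d: "0 < d" using e mass_nonneg by (simp add: d_def)
        have "mass * d < (mass + 1) * (2 * d)" using d mass_nonneg by (intro mult_strict_mono) auto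
        also have "\<dots> = e" using mass_nonneg by (simp add: d_def field_simps)
        finally show "mass * d < e" .
      qed
      have "uniformly_continuous_on (cball x 1 \<times> K) (\<lambda>(z, \<xi>). exp (- z * \<xi>))"
        using compact by (intro compact_uniformly_continuous compact_Times)
          (auto simp: case_prod_unfold intro!: continuous_intros)
      then obtain \<delta> where \<delta>: "0 < \<delta>" "\<And>p q. p \<in> cball x 1 \<times> K \<Longrightarrow> q \<in> cball x 1 \<times> K \<Longrightarrow> dist p q < \<delta> \<Longrightarrow>
          dist ((\<lambda>(z, \<xi>). exp (- z * \<xi>)) p) ((\<lambda>(z, \<xi>). exp (- z * \<xi>)) q) < d"
        using d(1) unfolding uniformly_continuous_on_def by metis
      have "\<forall>\<^sub>F n in sequentially. \<forall>\<xi>\<in>K. dist (c n \<xi>) \<xi> < \<delta>"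
        using c \<delta>(1) by (auto simp: sample_maps_def)
      then show "\<forall>\<^sub>F n in sequentially. \<forall>z\<in>cball x 1. dist (f n z) (transform z) < e"
      proof eventually_elim
        case (elim n)
        show ?case
        proof
          fix z assume z: "z \<in> cball x 1"
          have "norm (transform z - simple_cm_integral (\<lambda>\<xi>. exp (- z * c n \<xi>))) \<le> mass * d"
          proof (rule norm_cm_integral_diff_le[OF has_transform[OF assms]])
            show "simple_function borel (\<lambda>\<xi>. exp (- z * c n \<xi>))"
              using s by (rule simple_function_compose1)
            fix \<xi> assume \<xi>: "\<xi> \<in> K"
            have "c n \<xi> \<in> K" using c by (simp add: sample_maps_def)
            with \<delta>(2)[of "(z, \<xi>)" "(z, c n \<xi>)"] z \<xi> elim
            have "dist (exp (- z * \<xi>)) (exp (- z * c n \<xi>)) < d"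
              by (simp add: dist_Pair_Pair dist_commute)
            then show "norm (exp (- z * \<xi>) - exp (- z * c n \<xi>)) \<le> d" by (simp add: dist_norm)
          qed (use d in simp)
          moreover have "f n z = simple_cm_integral (\<lambda>\<xi>. exp (- z * c n \<xi>))"
            unfolding f_def using s by (rule riemann_sum_eq)
          ultimately show "dist (f n z) (transform z) < e"
            using d(2) by (simp add: dist_norm norm_minus_commute)
        qed
      qed
    qed
    then show "\<exists>d>0. cball x d \<subseteq> UNIV \<and> uniform_limit (cball x d) f transform sequentially"
      by (intro exI[of _ 1]) simp
  qed auto
qed

text \<open>Conjugating the sampling maps turns the Riemann sums at z into their conjugates at
  \<open>cnj z\<close>, so the transform itself commutes with conjugation.\<close>

lemma norm_transform_cnj:
  assumes K: "K \<noteq> {}" "cnj ` K = K" and sym: "\<And>E. E \<in> sets borel \<Longrightarrow> \<mu> (cnj ` E) = cnj (\<mu> E)"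
  shows "norm (transform (cnj z)) = norm (transform z)"
proof -
  obtain c where c: "sample_maps c" using sample_maps_exist[OF K(1)] by blast
  have s: "simple_function borel (c n)" for n using c by (simp add: sample_maps_def)
  define c' where "c' n z = cnj (c n (cnj z))" for n z
  have cnj_K: "cnj z \<in> K" if "z \<in> K" for z using K(2) that by blast
  have c': "sample_maps c'"
    unfolding sample_maps_def
  proof (intro conjI allI impI)
    fix n
    have fin: "finite (range (c n))" and meas: "c n -` {w} \<in> sets borel" for w
      using s[of n] simple_functionD(2)[OF s[of n], of "{w}"] by (auto simp: simple_function_def)
    have "simple_function borel (\<lambda>z. c n (cnj z))"
      unfolding simple_function_def
    proof (intro conjI ballI)
      show "finite ((\<lambda>z. c n (cnj z)) ` space borel)"
        using fin by (rule finite_subset[rotated]) auto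
      fix w
      have "(\<lambda>z. c n (cnj z)) -` {w} \<inter> space borel = cnj -` (c n -` {w}) \<inter> space borel" by auto
      also have "\<dots> \<in> sets borel"
        using meas by (intro measurable_sets[of cnj borel borel])
          (auto intro!: borel_measurable_continuous_onI continuous_intros)
      finally show "(\<lambda>z. c n (cnj z)) -` {w} \<inter> space borel \<in> sets borel" .
    qed
    then show "simple_function borel (c' n)"
      unfolding c'_def[abs_def] by (rule simple_function_compose1)
    show "c' n z \<in> K" for z using c by (auto simp: c'_def sample_maps_def intro: cnj_K)
  next
    fix e :: real assume "0 < e"
    then have "\<forall>\<^sub>F n in sequentially. \<forall>z\<in>K. dist (c n z) z < e" using c by (simp add: sample_maps_def)
    then show "\<forall>\<^sub>F n in sequentially. \<forall>z\<in>K. dist (c' n z) z < e"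
    proof eventually_elim
      case (elim n)
      have "dist (c' n z) z = dist (c n (cnj z)) (cnj z)" for z
        unfolding c'_def dist_norm by (metis complex_cnj_cnj complex_cnj_diff complex_mod_cnj)
      with elim cnj_K show ?case by simp
    qed
  qed
  have eq: "riemann_sum (c' n) (\<lambda>\<xi>. exp (- cnj z * \<xi>)) = cnj (riemann_sum (c n) (\<lambda>\<xi>. exp (- z * \<xi>)))" for n
  proof -
    have meas: "c n -` {w} \<in> sets borel" for w
      using simple_functionD(2)[OF s[of n], of "{w}"] by simp
    have "range (c' n) = cnj ` range (c n)"
    proof -
      have "range (c' n) = (\<lambda>z. cnj (c n z)) ` range cnj" by (simp add: c'_def[abs_def] image_image)
      also have "range cnj = UNIV" by (metis complex_cnj_cnj surjI)
      finally show ?thesis by (simp add: image_image)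
    qed
    then have "riemann_sum (c' n) (\<lambda>\<xi>. exp (- cnj z * \<xi>))
        = (\<Sum>w\<in>range (c n). \<mu> (c' n -` {cnj w}) * exp (- cnj z * cnj w))"
      by (simp add: riemann_sum_def scaleC_complex_def sum.reindex inj_on_def)
    also have "\<dots> = (\<Sum>w\<in>range (c n). cnj (\<mu> (c n -` {w}) * exp (- z * w)))"
    proof (rule sum.cong[OF refl])
      fix w
      have "c' n -` {cnj w} = cnj ` (c n -` {w})"
      proof (intro set_eqI iffI)
        fix x assume "x \<in> c' n -` {cnj w}"
        then have "cnj x \<in> c n -` {w}" by (simp add: c'_def)
        then show "x \<in> cnj ` (c n -` {w})" by (metis complex_cnj_cnj image_eqI)
      qed (auto simp: c'_def)
      then show "\<mu> (c' n -` {cnj w}) * exp (- cnj z * cnj w) = cnj (\<mu> (c n -` {w}) * exp (- z * w))"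
        using sym[OF meas[of w]] by (simp add: exp_cnj)
    qed
    finally show ?thesis by (simp add: riemann_sum_def scaleC_complex_def)
  qed
  have "(\<lambda>n. riemann_sum (c' n) (\<lambda>\<xi>. exp (- cnj z * \<xi>))) \<longlonglongrightarrow> transform (cnj z)"
    unfolding transform_def by (intro riemann_sum_tendsto c' continuous_intros)
  moreover have "(\<lambda>n. cnj (riemann_sum (c n) (\<lambda>\<xi>. exp (- z * \<xi>)))) \<longlonglongrightarrow> cnj (transform z)"
    unfolding transform_def by (intro tendsto_cnj riemann_sum_tendsto c continuous_intros)
  ultimately have "transform (cnj z) = cnj (transform z)"
    unfolding eq by (rule LIMSEQ_unique)
  then show ?thesis by simp
qed

end

section \<open>Maximum principle along rays\<close>

lemma sector_iff:
  assumes "0 < \<gamma>" "\<gamma> < pi / 2"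
  shows "z \<in> sector \<gamma> \<longleftrightarrow> 0 < Re z \<and> \<bar>Im z\<bar> < tan \<gamma> * Re z"
proof -
  have "\<bar>arctan x\<bar> < \<gamma> \<longleftrightarrow> \<bar>x\<bar> < tan \<gamma>" for x
  proof -
    have g: "arctan (tan \<gamma>) = \<gamma>" using assms by (intro arctan_tan) auto
    have "arctan x < \<gamma> \<longleftrightarrow> x < tan \<gamma>" by (subst g[symmetric]) (rule arctan_less_iff)
    moreover have "- \<gamma> < arctan x \<longleftrightarrow> - tan \<gamma> < x"
      by (subst g[symmetric], subst arctan_minus[symmetric]) (rule arctan_less_iff)
    ultimately show ?thesis by (auto simp: abs_less_iff)
  qed
  then show ?thesis
    by (auto simp: sector_def arg_conv_arctan abs_divide pos_divide_less_eq)
qed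

text \<open>The point is that X does not depend on w: if w has large real part, the parameter r
  found on its ray is small, small enough for the spectral hypothesis to apply at t = r.\<close>

lemma ray_sup_le:
  fixes F :: "complex \<Rightarrow> complex"
  assumes holo: "F holomorphic_on UNIV" and F0: "F 0 = 0" and sym: "\<And>z. norm (F (cnj z)) = norm (F z)"
    and decay: "\<And>z. k * \<bar>Im z\<bar> \<le> Re z \<Longrightarrow> norm (F z) \<le> V * exp (- \<delta> * Re z)"
    and k: "0 < k" and \<delta>: "0 < \<delta>" and nz: "0 < x1" "F (complex_of_real x1) \<noteq> 0"
  shows "\<exists>X>0. \<forall>w. 0 < Re w \<and> k * \<bar>Im w\<bar> \<le> Re w \<longrightarrow>
    (\<exists>r>0. r * Re w \<le> X \<and> (\<forall>x>0. norm (F (complex_of_real x)) \<le> norm (F (complex_of_real r * w))))"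
proof -
  have cont: "continuous_on S F" for S
    using holo by (intro holomorphic_on_imp_continuous_on) (rule holomorphic_on_subset, auto)
  have V: "0 \<le> V" using decay[of 0] F0 by simp
  have "((\<lambda>x. V * exp (- \<delta> * x)) \<longlongrightarrow> V * 0) at_top"
    using \<delta> by (intro tendsto_intros filterlim_compose[OF exp_at_bot]
        filterlim_tendsto_neg_mult_at_bot[OF tendsto_const _ filterlim_ident]) simp
  then have "\<forall>\<^sub>F x in at_top. V * exp (- \<delta> * x) < norm (F (complex_of_real x1))"
    using nz(2) by (intro order_tendstoD) auto
  then obtain X0 where X0: "\<And>x. X0 \<le> x \<Longrightarrow> V * exp (- \<delta> * x) < norm (F (complex_of_real x1))"
    by (auto simp: eventually_at_top_linorder)
  \<comment> \<open>From X on the decay bound stays below |F(x1)|. Hence the supremum M over the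
    positive axis is attained on [0, X], and the vertical side of the triangle is harmless.\<close>
  define X where "X = max X0 x1"
  have X: "0 < X" "x1 \<le> X" "\<And>x. X \<le> x \<Longrightarrow> V * exp (- \<delta> * x) < norm (F (complex_of_real x1))"
    using nz(1) X0 by (auto simp: X_def)
  obtain x0 where x0: "x0 \<in> {0..X}" "\<And>y. y \<in> {0..X} \<Longrightarrow> norm (F (of_real y)) \<le> norm (F (of_real x0))"
  proof -
    have "continuous_on {0..X} (\<lambda>x. norm (F (complex_of_real x)))"
      by (intro continuous_intros continuous_on_compose2[OF cont[of UNIV]]) auto
    from continuous_attains_sup[OF _ _ this] X(1) that show ?thesis by auto
  qed
  define M where "M = norm (F (complex_of_real x0))"
  have M1: "norm (F (complex_of_real x1)) \<le> M" using x0(2)[of x1] X(2) nz(1) by (simp add: M_def)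
  have M0: "0 < M" using M1 nz(2) by (metis less_le_trans zero_less_norm_iff)
  have le_M: "norm (F (complex_of_real x)) \<le> M" if "0 < x" for x
  proof (cases "x \<le> X")
    case True
    then show ?thesis using x0(2)[of x] that by (simp add: M_def)
  next
    case False
    then show ?thesis using decay[of "of_real x"] X(3)[of x] M1 that by simp
  qed
  show ?thesis
  proof (rule exI[of _ X], intro conjI allI impI X(1))
    fix w :: complex assume "0 < Re w \<and> k * \<bar>Im w\<bar> \<le> Re w"
    then have w: "0 < Re w" "k * \<bar>Im w\<bar> \<le> Re w" by simp_all
    show "\<exists>r>0. r * Re w \<le> X \<and> (\<forall>x>0. norm (F (complex_of_real x)) \<le> norm (F (complex_of_real r * w)))"
    proof (rule ccontr)
      assume neg: "\<not> ?thesis"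
      \<comment> \<open>If the claim fails, |F| < M along the part of the ray that bounds the
        triangle; the maximum principle then contradicts |F(x0)| = M.\<close>
      have small: "norm (F (complex_of_real r * w)) < M" if "0 < r" "r * Re w \<le> X" for r
        using neg that le_M by (meson less_le_trans not_le)
      define m where "m = \<bar>Im w\<bar> / Re w"
      have m: "0 \<le> m" "k * m \<le> 1" "\<bar>Im w\<bar> = m * Re w"
        using w by (auto simp: m_def field_simps)
      \<comment> \<open>For real w the slope m is 0 and \<Delta> degenerates to a segment without
        interior; the frontier estimate covers this case as well.\<close>
      define \<Delta> where "\<Delta> = {z. 0 \<le> Re z \<and> Re z \<le> X \<and> \<bar>Im z\<bar> \<le> m * Re z}"
      have closed: "closed \<Delta>"
        unfolding \<Delta>_def by (intro closed_Collect_conj closed_Collect_le continuous_intros)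
      have bdd: "bounded \<Delta>"
        unfolding bounded_iff
      proof (intro exI ballI)
        fix z assume z: "z \<in> \<Delta>"
        then have "m * Re z \<le> m * X" using m(1) by (intro mult_left_mono) (auto simp: \<Delta>_def)
        with z cmod_le[of z] show "norm z \<le> X + m * X" by (auto simp: \<Delta>_def)
      qed
      have "open {z. Re z < X \<and> \<bar>Im z\<bar> < m * Re z}"
        by (intro open_Collect_conj open_Collect_less continuous_intros)
      moreover have "0 \<le> Re z" if "\<bar>Im z\<bar> < m * Re z" for z
      proof -
        have "0 < m * Re z" using that abs_ge_zero[of "Im z"] by linarith
        with m(1) show ?thesis by (simp add: zero_less_mult_iff)
      qed
      ultimately have int: "{z. Re z < X \<and> \<bar>Im z\<bar> < m * Re z} \<subseteq> interior \<Delta>"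
        by (intro interior_maximal) (auto simp: \<Delta>_def)
      have front: "norm (F z) < M" if z: "z \<in> frontier \<Delta>" for z
      proof -
        have z\<Delta>: "z \<in> \<Delta>" using z closed by (auto simp: frontier_def)
        then have z': "0 \<le> Re z" "Re z \<le> X" "\<bar>Im z\<bar> \<le> m * Re z" by (auto simp: \<Delta>_def)
        have "\<not> (Re z < X \<and> \<bar>Im z\<bar> < m * Re z)" using z int by (auto simp: frontier_def)
        with z' consider "Re z = X" | "\<bar>Im z\<bar> = m * Re z" by force
        then show ?thesis
        proof cases
          case 1
          have "k * \<bar>Im z\<bar> \<le> k * (m * Re z)" using z'(3) k by simp
          also have "\<dots> = (k * m) * Re z" by simp
          also have "\<dots> \<le> 1 * Re z" using m(2) z'(1) by (rule mult_right_mono)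
          finally show ?thesis using decay[of z] X(3)[of "Re z"] M1 1 by simp
        next
          case 2
          show ?thesis
          proof (cases "Re z = 0")
            case True
            \<comment> \<open>At the apex the bound comes from F 0 = 0, since r must be positive on
              the ray.\<close>
            with 2 have "z = 0" by (simp add: complex_eq_iff)
            with F0 M0 show ?thesis by simp
          next
            case False
            define r where "r = Re z / Re w"
            have r: "0 < r" "r * Re w = Re z" using False z'(1) w(1) by (auto simp: r_def)
            have "\<bar>Im z\<bar> = \<bar>r * Im w\<bar>"
              using 2 r m(3) by (simp add: abs_mult mult.left_commute)
            then have "z = of_real r * w \<or> z = cnj (of_real r * w)"
              using r(2) by (auto simp: complex_eq_iff abs_eq_iff)
            then have "norm (F z) = norm (F (of_real r * w))" using sym by metis
            with small[OF r(1)] r(2) z'(2) show ?thesis by simp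
          qed
        qed
      qed
      \<comment> \<open>Compactness of the frontier turns the strict pointwise bounds into one bound
        B < M, as the maximum principle requires.\<close>
      obtain B where B: "B < M" "\<And>z. z \<in> frontier \<Delta> \<Longrightarrow> norm (F z) \<le> B"
      proof (cases "frontier \<Delta> = {}")
        case True
        with M0 that[of 0] show ?thesis by simp
      next
        case False
        have "continuous_on (frontier \<Delta>) (\<lambda>z. norm (F z))" by (intro continuous_intros cont)
        from continuous_attains_sup[OF compact_frontier_bounded[OF bdd] False this] front that
        show ?thesis by blast
      qed
      have hol_int: "F holomorphic_on interior \<Delta>" using holo by (rule holomorphic_on_subset) simp
      have mem: "complex_of_real x0 \<in> \<Delta>" using x0(1) m(1) by (auto simp: \<Delta>_def)
      from B(2) mem have "norm (F (complex_of_real x0)) \<le> B"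
        by (rule maximum_modulus_frontier[OF hol_int cont bdd])
      with B(1) show False by (simp add: M_def)
    qed
  qed
qed

section \<open>Spectral radius without contour integrals\<close>

class complex_banach_algebra_1 = complex_normed_vector + real_normed_algebra_1 + banach +
  assumes mult_scaleC_left: "(c *\<^sub>C x) * y = c *\<^sub>C (x * y)"
    and mult_scaleC_right: "x * (c *\<^sub>C y) = c *\<^sub>C (x * y)"

lemma scaleC_power:
  "(c *\<^sub>C (x::'a::complex_banach_algebra_1)) ^ n = c ^ n *\<^sub>C x ^ n"
  by (induction n) (auto simp: mult_scaleC_left mult_scaleC_right scaleC_scaleC mult.commute)

definition is_unit_elem :: "'a::monoid_mult \<Rightarrow> bool"
  where "is_unit_elem x \<longleftrightarrow> (\<exists>y. x * y = 1 \<and> y * x = 1)"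

lemma geometric_sum_mult:
  fixes x :: "'a::ring_1"
  shows "(1 - x) * (\<Sum>i<n. x ^ i) = 1 - x ^ n" (is ?l) "(\<Sum>i<n. x ^ i) * (1 - x) = 1 - x ^ n" (is ?r)
proof -
  show ?l
  proof (induction n)
    case (Suc n)
    have "(1 - x) * (\<Sum>i<Suc n. x ^ i) = (1 - x) * (\<Sum>i<n. x ^ i) + (1 - x) * x ^ n"
      by (simp add: distrib_left)
    also have "\<dots> = 1 - x ^ Suc n" unfolding Suc by (simp add: left_diff_distrib)
    finally show ?case .
  qed simp
  show ?r
  proof (induction n)
    case (Suc n)
    have "(\<Sum>i<Suc n. x ^ i) * (1 - x) = (\<Sum>i<n. x ^ i) * (1 - x) + x ^ n * (1 - x)"
      by (simp add: distrib_right)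
    also have "\<dots> = 1 - x ^ Suc n" unfolding Suc by (simp add: right_diff_distrib power_commutes)
    finally show ?case .
  qed simp
qed

lemma is_unit_elem_one_minus:
  fixes x :: "'a::{real_normed_algebra_1, banach}"
  assumes "norm x < 1"
  shows "is_unit_elem (1 - x)"
proof -
  have sm: "summable (\<lambda>n. x ^ n)" by (rule complete_algebra_summable_geometric[OF assms])
  then have S: "(\<lambda>n. \<Sum>i<n. x ^ i) \<longlonglongrightarrow> (\<Sum>i. x ^ i)" by (rule summable_LIMSEQ)
  have 1: "(\<lambda>n. 1 - x ^ n) \<longlonglongrightarrow> 1 - 0"
    using sm by (intro tendsto_intros summable_LIMSEQ_zero)
  have "(1 - x) * (\<Sum>i. x ^ i) = 1"
    using LIMSEQ_unique[OF tendsto_mult[OF tendsto_const[of "1 - x"] S]] 1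
    by (simp add: geometric_sum_mult)
  moreover have "(\<Sum>i. x ^ i) * (1 - x) = 1"
    using LIMSEQ_unique[OF tendsto_mult[OF S tendsto_const[of "1 - x"]]] 1
    by (simp add: geometric_sum_mult)
  ultimately show ?thesis unfolding is_unit_elem_def by blast
qed

lemma sum_roots_of_unity:
  assumes "0 < n" "j < n"
  shows "(\<Sum>k<n. exp (2 * of_real pi * \<i> * of_nat k / of_nat n) ^ j) = (if j = 0 then of_nat n else 0)"
proof (cases "j = 0")
  case False
  define w where "w = exp (2 * of_real pi * \<i> * of_nat j / of_nat n)"
  have w1: "w \<noteq> 1"
    using complex_root_unity_eq_1[of n j] assms False by (auto simp: w_def dvd_imp_le)
  have wn: "w ^ n = 1"
    using complex_root_unity[of n j] assms by (simp add: w_def)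
  have "exp (2 * of_real pi * \<i> * of_nat k / of_nat n) ^ j = w ^ k" for k
    by (simp add: w_def mult_ac flip: exp_of_nat_mult)
  then have "(\<Sum>k<n. exp (2 * of_real pi * \<i> * of_nat k / of_nat n) ^ j) = (\<Sum>k<n. w ^ k)" by simp
  also have "\<dots> = 0" using geometric_sum[OF w1, of n] wn by simp
  finally show ?thesis using False by simp
qed simp

locale comm_subalgebra =
  fixes C :: "'a::complex_banach_algebra_1 set"
  assumes one: "1 \<in> C"
    and add: "x \<in> C \<Longrightarrow> y \<in> C \<Longrightarrow> x + y \<in> C"
    and mult: "x \<in> C \<Longrightarrow> y \<in> C \<Longrightarrow> x * y \<in> C"
    and scaleC: "x \<in> C \<Longrightarrow> c *\<^sub>C x \<in> C"
    and commute: "x \<in> C \<Longrightarrow> y \<in> C \<Longrightarrow> x * y = y * x"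
begin

lemma zero: "0 \<in> C"
  using add[OF one scaleC[OF one, of "-1"]] by (simp add: scaleC_minus_one)

lemma diff: "x \<in> C \<Longrightarrow> y \<in> C \<Longrightarrow> x - y \<in> C"
  using add[of x "(-1) *\<^sub>C y"] scaleC[of y "-1"] by (simp add: scaleC_minus_one)

lemma power: "x \<in> C \<Longrightarrow> x ^ n \<in> C"
  by (induction n) (auto intro: one mult)

lemma sum: "(\<And>i. i \<in> I \<Longrightarrow> f i \<in> C) \<Longrightarrow> sum f I \<in> C"
  by (induction I rule: infinite_finite_induct) (auto intro: zero add)

lemmas closed_rules = one zero add diff mult scaleC power sum

end

text \<open>p will be the norm, for the spectral radius, and the distance from an ideal, for
  Gelfand--Mazur; working modulo the null space of p avoids forming a quotient algebra.\<close>

locale algebra_seminorm = comm_subalgebra C for C :: "'a::complex_banach_algebra_1 set" +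
  fixes p :: "'a \<Rightarrow> real"
  assumes p_nonneg: "0 \<le> p x"
    and p_add: "x \<in> C \<Longrightarrow> y \<in> C \<Longrightarrow> p (x + y) \<le> p x + p y"
    and p_scaleC: "x \<in> C \<Longrightarrow> p (c *\<^sub>C x) = norm c * p x"
    and p_mult: "x \<in> C \<Longrightarrow> y \<in> C \<Longrightarrow> p (x * y) \<le> p x * p y"
begin

lemma p_zero: "p 0 = 0"
  using p_scaleC[OF zero, of 0] by (simp only: scaleC_zero_left norm_zero mult_zero_left)

lemma p_diff: "x \<in> C \<Longrightarrow> y \<in> C \<Longrightarrow> p (x - y) \<le> p x + p y"
  using p_add[of x "(-1) *\<^sub>C y"] scaleC[of y "-1"] p_scaleC[of y "-1"] by (simp add: scaleC_minus_one)

lemma p_diff_commute: "x \<in> C \<Longrightarrow> y \<in> C \<Longrightarrow> p (x - y) = p (y - x)"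
  using p_scaleC[OF diff, of x y "-1"] by (simp add: scaleC_minus_one)

lemma p_triangle: "x \<in> C \<Longrightarrow> y \<in> C \<Longrightarrow> p x \<le> p (x - y) + p y"
  using p_add[of "x - y" y] diff by simp

lemma p_cong: "x \<in> C \<Longrightarrow> y \<in> C \<Longrightarrow> p (x - y) = 0 \<Longrightarrow> p x = p y"
  using p_triangle[of x y] p_triangle[of y x] p_diff_commute[of x y] by simp

lemma p_mult_zero: "x \<in> C \<Longrightarrow> y \<in> C \<Longrightarrow> p x = 0 \<Longrightarrow> p (x * y) = 0"
  using p_mult[of x y] p_nonneg[of "x * y"] by simp

lemma p_add_zero: "x \<in> C \<Longrightarrow> y \<in> C \<Longrightarrow> p x = 0 \<Longrightarrow> p y = 0 \<Longrightarrow> p (x + y) = 0"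
  using p_add[of x y] p_nonneg[of "x + y"] by simp

lemma p_diff_zero: "x \<in> C \<Longrightarrow> y \<in> C \<Longrightarrow> p x = 0 \<Longrightarrow> p y = 0 \<Longrightarrow> p (x - y) = 0"
  using p_diff[of x y] p_nonneg[of "x - y"] by simp

lemma p_sum: "(\<And>i. i \<in> I \<Longrightarrow> f i \<in> C) \<Longrightarrow> p (sum f I) \<le> (\<Sum>i\<in>I. p (f i))"
proof (induction I rule: infinite_finite_induct)
  case (insert i I)
  have "p (f i + sum f I) \<le> p (f i) + p (sum f I)"
    using insert.prems by (intro p_add sum) auto
  with insert show ?case by fastforce
qed (auto simp: p_zero)

text \<open>
  If every \<open>1 - z a\<close> with \<open>|z| \<le> R\<close> is invertible modulo the null space of \<open>p\<close>, then the mean of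
  \<open>(1 - z a)\<^sup>-\<^sup>1\<close> over the \<open>n\<close> vertices of a regular polygon of radius \<open>r\<close> is \<open>(1 - r\<^sup>n a\<^sup>n)\<^sup>-\<^sup>1\<close>. These means
  are Lipschitz in \<open>r\<close> uniformly in \<open>n\<close>, so \<open>r\<^sup>n a\<^sup>n \<rightarrow> 0\<close> propagates from \<open>0\<close> up to \<open>R\<close> by steps of
  fixed length. This replaces the Cauchy integral formula (and hence the Hahn-Banach theorem).
\<close>

lemma power_tendsto_zero:
  assumes a: "a \<in> C" and R: "0 \<le> r" "r < R"
    and inv: "\<And>z. norm z \<le> R \<Longrightarrow> \<exists>g\<in>C. p (g * (1 - z *\<^sub>C a) - 1) = 0"
  shows "(\<lambda>n. p ((complex_of_real r *\<^sub>C a) ^ n)) \<longlonglongrightarrow> 0"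
proof -
  obtain G where G: "\<And>z. norm z \<le> R \<Longrightarrow> G z \<in> C" 
    and G_inv: "\<And>z. norm z \<le> R \<Longrightarrow> p (G z * (1 - z *\<^sub>C a) - 1) = 0"
    using inv by metis
  have R0: "0 < R" using R by simp
  note cl = closed_rules a
  \<comment> \<open>The resolvent identity modulo the null space of p: G z - G w differs from (z -
    w) G z a G w by multiples of the two defects of inversion.\<close>
  have resolvent: "p (G z - G w) \<le> norm (z - w) * p a * p (G z) * p (G w)"
    if z: "norm z \<le> R" and w: "norm w \<le> R" for z w
  proof -
    define u where "u = 1 - z *\<^sub>C a"
    define v where "v = 1 - w *\<^sub>C a"
    have mem: "u \<in> C" "v \<in> C" "G z \<in> C" "G w \<in> C"
      unfolding u_def v_def by (auto intro!: cl G z w)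
    have vu: "v - u = (z - w) *\<^sub>C a"
      using scaleC_add_left[of "z - w" w a] by (simp add: u_def v_def algebra_simps)
    define t where "t = G z * ((z - w) *\<^sub>C a) * G w"
    have t: "t \<in> C" unfolding t_def by (intro cl mem)
    have "G z - G w - t = G w * (G z * u - 1) - G z * (G w * v - 1)"
      unfolding t_def vu[symmetric]
      using commute[OF mem(3,4)] commute[OF mem(1,4)] commute[OF mem(2,4)]
      by (simp add: algebra_simps) (metis mult.assoc)
    moreover have "p (G w * (G z * u - 1)) = 0"
      using p_mult_zero[of "G z * u - 1" "G w"] G_inv[OF z] commute[of "G w" "G z * u - 1"]
      by (simp add: u_def[symmetric] mem cl)
    moreover have "p (G z * (G w * v - 1)) = 0"
      using p_mult_zero[of "G w * v - 1" "G z"] G_inv[OF w] commute[of "G z" "G w * v - 1"]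
      by (simp add: v_def[symmetric] mem cl)
    ultimately have "p (G z - G w - t) = 0"
      by (simp add: p_diff_zero mem cl)
    then have "p (G z - G w) = p t" using p_cong[of "G z - G w" t] mem t by (simp add: cl)
    also have "\<dots> \<le> (p (G z) * (norm (z - w) * p a)) * p (G w)"
    proof -
      have "p t \<le> p (G z * ((z - w) *\<^sub>C a)) * p (G w)"
        unfolding t_def by (intro p_mult cl mem)
      also have "p (G z * ((z - w) *\<^sub>C a)) \<le> p (G z) * p ((z - w) *\<^sub>C a)"
        by (intro p_mult cl mem)
      finally show ?thesis by (simp add: p_scaleC a p_nonneg mult_right_mono)
    qed
    finally show ?thesis by (simp add: mult_ac)
  qed
  \<comment> \<open>G is an arbitrary choice of inverses, so boundedness is proved by compactness:
    near an accumulation point w the resolvent estimate gives p (G y) \<le> p (G y) / 2 + p (G w),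
    hence p (G y) \<le> 2 p (G w).\<close>
  have "\<exists>K. \<forall>z\<in>cball 0 R. p (G z) \<le> K"
  proof (rule ccontr)
    assume neg: "\<not> ?thesis"
    have "\<exists>z\<in>cball 0 R. real n < p (G z)" for n using neg by (meson not_le)
    then obtain z where z: "\<And>n. z n \<in> cball 0 R" "\<And>n::nat. real n < p (G (z n))" by metis
    obtain w s where w: "w \<in> cball 0 R" "strict_mono s" "(z \<circ> s) \<longlonglongrightarrow> w"
      using compact_cball[of "0::complex" R] z(1) unfolding compact_def by meson
    \<comment> \<open>Within distance d the factor |y - w| p a p (G w) is at most 1/2; the added 1
      keeps the denominator positive.\<close>
    define d where "d = 1 / (2 * p a * p (G w) + 1)"
    have d: "0 < d" using p_nonneg[of a] p_nonneg[of "G w"] by (simp add: d_def add_nonneg_pos)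
    have "\<forall>\<^sub>F n in sequentially. dist ((z \<circ> s) n) w < d"
      using w(3) d by (rule tendstoD)
    moreover have "\<forall>\<^sub>F n in sequentially. 2 * p (G w) \<le> real n"
      by (rule filterlim_at_top[THEN iffD1, OF filterlim_real_sequentially, rule_format])
    ultimately have "\<forall>\<^sub>F n in sequentially. False"
    proof eventually_elim
      case (elim n)
      define y where "y = z (s n)"
      have yR: "norm y \<le> R" "norm w \<le> R" using z(1)[of "s n"] w(1) by (auto simp: y_def)
      have "norm (y - w) * (2 * p a * p (G w) + 1) < 1"
        using elim(1) d by (simp add: y_def d_def dist_norm field_simps)
      then have "norm (y - w) * (2 * p a * p (G w)) + norm (y - w) < 1"
        by (simp add: distrib_left)
      then have "norm (y - w) * (2 * p a * p (G w)) \<le> 1"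
        using norm_ge_zero[of "y - w"] by linarith
      then have "norm (y - w) * p a * p (G w) \<le> 1 / 2" by (simp add: mult_ac)
      then have "norm (y - w) * p a * p (G w) * p (G y) \<le> 1 / 2 * p (G y)"
        using p_nonneg by (rule mult_right_mono)
      then have "p (G y - G w) \<le> p (G y) / 2"
        using resolvent[OF yR] by (simp add: mult_ac)
      then have "p (G y) \<le> 2 * p (G w)"
        using p_triangle[OF G[OF yR(1)] G[OF yR(2)]] by simp
      moreover have "real n \<le> real (s n)" using w(2) by (simp add: seq_suble)
      ultimately show False using z(2)[of "s n"] elim(2) by (simp add: y_def)
    qed
    then show False by simp
  qed
  then obtain K where K: "\<And>z. norm z \<le> R \<Longrightarrow> p (G z) \<le> K" by (metis mem_cball_0)
  have K0: "0 \<le> K" using K[of 0] R0 p_nonneg[of "G 0"] by simp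
  define L where "L = p a * K * K"
  have L0: "0 \<le> L" by (simp add: L_def p_nonneg K0)
  have Lip: "p (G z - G w) \<le> L * norm (z - w)" if z: "norm z \<le> R" and w: "norm w \<le> R" for z w
  proof -
    have "p (G z - G w) \<le> (norm (z - w) * p a) * (p (G z) * p (G w))"
      using resolvent[OF that] by (simp add: mult_ac)
    also have "\<dots> \<le> (norm (z - w) * p a) * (K * K)"
      by (intro mult_left_mono mult_mono K z w) (auto simp: p_nonneg K0)
    finally show ?thesis by (simp add: L_def mult_ac)
  qed
  define \<omega> where "\<omega> n k = exp (2 * of_real pi * \<i> * of_nat k / of_nat n)" for n k :: nat
  have norm_\<omega>: "norm (of_real r * \<omega> n k) = \<bar>r\<bar>" for r n k
  proof -
    have "\<omega> n k = exp (\<i> * of_real (2 * pi * k / n))" by (simp add: \<omega>_def mult_ac)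
    then show ?thesis by (simp add: norm_mult)
  qed
  have \<omega>_pow: "\<omega> n k ^ n = 1" if "0 < n" for n k
    using complex_root_unity[of n k] that by (simp add: \<omega>_def)
  define H where "H n r = (1 / of_nat n) *\<^sub>C (\<Sum>k<n. G (of_real r * \<omega> n k))" for n and r :: real
  have HC: "H n r \<in> C" if "0 \<le> r" "r \<le> R" for n r
    unfolding H_def using that by (intro cl G) (simp add: norm_\<omega>)
  have mean: "p ((1 / of_nat n) *\<^sub>C (\<Sum>k<n. f k)) \<le> c"
    if f: "\<And>k. f k \<in> C" "\<And>k. p (f k) \<le> c" and n: "0 < n" for n f c
  proof -
    have "p ((1 / of_nat n) *\<^sub>C (\<Sum>k<n. f k)) = 1 / of_nat n * p (\<Sum>k<n. f k)"
      using f(1) by (subst p_scaleC) (auto intro!: sum simp: norm_divide)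
    also have "\<dots> \<le> 1 / of_nat n * (\<Sum>k<n. p (f k))"
      using f(1) by (intro mult_left_mono p_sum) auto
    also have "\<dots> \<le> 1 / of_nat n * (\<Sum>k<n. c)"
      by (intro mult_left_mono sum_mono f) auto
    also have "\<dots> = c" using n by simp
    finally show ?thesis .
  qed
  \<comment> \<open>At each vertex z, 1 - (r a)^n is (1 - z a) times a finite geometric sum in z a,
    because z^n = r^n. In the mean over the vertices only the term of exponent 0 of that sum
    survives.\<close>
  have H_inv: "p (H n r * (1 - (of_real r *\<^sub>C a) ^ n) - 1) = 0" if n: "0 < n" and r: "0 \<le> r" "r \<le> R" for n r
  proof -
    define z where "z k = of_real r * \<omega> n k" for k
    define D where "D k = G (z k) * (1 - (of_real r *\<^sub>C a) ^ n) - (\<Sum>j<n. (z k *\<^sub>C a) ^ j)" for k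
    have zR: "norm (z k) \<le> R" for k using r by (simp add: z_def norm_\<omega>)
    have DC: "D k \<in> C" for k unfolding D_def by (intro cl G zR)
    have D0: "p (D k) \<le> 0" for k
    proof -
      have "(of_real r *\<^sub>C a) ^ n = (z k *\<^sub>C a) ^ n"
        by (simp add: z_def scaleC_power power_mult_distrib \<omega>_pow[OF n])
      then have eq: "1 - (of_real r *\<^sub>C a) ^ n = (1 - z k *\<^sub>C a) * (\<Sum>j<n. (z k *\<^sub>C a) ^ j)"
        by (simp add: geometric_sum_mult)
      have "D k = (G (z k) * (1 - z k *\<^sub>C a) - 1) * (\<Sum>j<n. (z k *\<^sub>C a) ^ j)"
        unfolding D_def eq by (simp only: left_diff_distrib mult.assoc mult_1_left)
      moreover have "p \<dots> = 0"
        by (intro p_mult_zero cl G zR G_inv)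
      ultimately show ?thesis by simp
    qed
    have "(\<Sum>k<n. \<Sum>j<n. (z k *\<^sub>C a) ^ j) = (\<Sum>j<n. \<Sum>k<n. (\<omega> n k) ^ j *\<^sub>C (of_real r *\<^sub>C a) ^ j)"
      by (subst sum.swap) (simp add: z_def scaleC_power power_mult_distrib scaleC_scaleC mult.commute)
    also have "\<dots> = (\<Sum>j<n. (if j = 0 then of_nat n else 0) *\<^sub>C (of_real r *\<^sub>C a) ^ j)"
      unfolding scaleC_sum_left[symmetric]
      using sum_roots_of_unity[OF n] by (intro sum.cong) (auto simp: \<omega>_def)
    also have "\<dots> = (\<Sum>j<n. if j = 0 then of_nat n *\<^sub>C 1 else 0)"
      using scaleC_of_real[of 0] by (intro sum.cong) auto
    also have "\<dots> = of_nat n *\<^sub>C 1" using n by simp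
    finally have "(\<Sum>k<n. D k) = (\<Sum>k<n. G (z k)) * (1 - (of_real r *\<^sub>C a) ^ n) - of_nat n *\<^sub>C 1"
      by (simp add: D_def sum_subtractf sum_distrib_right)
    then have "(1 / of_nat n) *\<^sub>C (\<Sum>k<n. D k) =
        H n r * (1 - (of_real r *\<^sub>C a) ^ n) - (1 / of_nat n * of_nat n) *\<^sub>C 1"
      by (simp add: H_def z_def[symmetric] mult_scaleC_left scaleC_scaleC scaleC_diff_right)
    then have "p (H n r * (1 - (of_real r *\<^sub>C a) ^ n) - 1) = p ((1 / of_nat n) *\<^sub>C (\<Sum>k<n. D k))"
      using n by simp
    also have "\<dots> \<le> 0" by (intro mean DC D0 n)
    finally show ?thesis using p_nonneg by (simp add: order_antisym)
  qed
  have H_Lip: "p (H n r - H n s) \<le> L * \<bar>r - s\<bar>" if n: "0 < n" and r: "0 \<le> r" "r \<le> R" and s: "0 \<le> s" "s \<le> R" for n r s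
  proof -
    have "H n r - H n s = (1 / of_nat n) *\<^sub>C (\<Sum>k<n. G (of_real r * \<omega> n k) - G (of_real s * \<omega> n k))"
      by (simp add: H_def sum_subtractf scaleC_diff_right)
    moreover have "p \<dots> \<le> L * \<bar>r - s\<bar>"
    proof (rule mean)
      fix k
      have R: "norm (of_real r * \<omega> n k) \<le> R" "norm (of_real s * \<omega> n k) \<le> R"
        using r s by (simp_all add: norm_\<omega>)
      then show "G (of_real r * \<omega> n k) - G (of_real s * \<omega> n k) \<in> C" by (intro diff G)
      have "norm (of_real r * \<omega> n k - of_real s * \<omega> n k) = \<bar>r - s\<bar>"
        using norm_\<omega>[of "r - s" n k] by (simp add: left_diff_distrib)
      then show "p (G (of_real r * \<omega> n k) - G (of_real s * \<omega> n k)) \<le> L * \<bar>r - s\<bar>"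
        using Lip[OF R] by simp
    qed (rule n)
    ultimately show ?thesis by simp
  qed
  define P where "P r n = (complex_of_real r *\<^sub>C a) ^ n" for r n
  have PC: "P r n \<in> C" for r n unfolding P_def by (intro cl)
  \<comment> \<open>The step length depends on the Lipschitz constant alone: moving r by h changes
    each mean by at most 1/4.\<close>
  define h where "h = 1 / (4 * L + 4)"
  have h: "0 < h" "L * h \<le> 1 / 4" using L0 by (auto simp: h_def field_simps)
  \<comment> \<open>If (r a)^n tends to 0, then H n r is eventually within 1/4 of 1, and H n s
    within 1/2 of 1 for s up to r + h. This bounds 1 - (s a)^n, hence (s a)^n, and for t < s the
    factor (t / s)^n supplies the decay.\<close>
  have step: "(\<lambda>n. p (P t n)) \<longlonglongrightarrow> 0"
    if r: "0 \<le> r" "(\<lambda>n. p (P r n)) \<longlonglongrightarrow> 0" and t: "r \<le> t" "t < r + h" "t < R" for r t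
  proof -
    define s where "s = min R (r + h)"
    have s: "t < s" "0 \<le> s" "s \<le> R" "\<bar>s - r\<bar> \<le> h" "0 < s"
      using r(1) t h(1) by (auto simp: s_def)
    have rR: "r \<le> R" using t by simp
    have "(\<lambda>n. K * p (P r n)) \<longlonglongrightarrow> 0" using tendsto_mult[OF tendsto_const[of K] r(2)] by simp
    then have "\<forall>\<^sub>F n in sequentially. K * p (P r n) < 1 / 4"
      by (rule order_tendstoD) simp
    moreover have "\<forall>\<^sub>F n in sequentially. 0 < n" by (rule eventually_gt_at_top)
    ultimately have bdd: "\<forall>\<^sub>F n in sequentially. p (P s n) \<le> 3 * p 1"
    proof eventually_elim
      case (elim n)
      note mem = HC[OF r(1) rR, of n] HC[OF s(2,3), of n] PC one
      have HK: "p (H n r) \<le> K"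
        unfolding H_def using r(1) rR elim(2) by (intro mean G K) (auto simp: norm_\<omega>)
      have eq: "H n r - 1 = (H n r * (1 - P r n) - 1) + H n r * P r n" by (simp add: algebra_simps)
      have "p (H n r - 1) \<le> p (H n r * (1 - P r n) - 1) + p (H n r * P r n)"
        by (subst eq) (intro p_add cl mem)
      moreover have "p (H n r * (1 - P r n) - 1) = 0"
        using H_inv[OF elim(2) r(1) rR] by (simp only: P_def)
      moreover have "p (H n r * P r n) \<le> p (H n r) * p (P r n)" by (intro p_mult mem)
      moreover have "p (H n r) * p (P r n) \<le> K * p (P r n)" using HK p_nonneg by (rule mult_right_mono)
      ultimately have "p (H n r - 1) \<le> 1 / 4" using elim(1) by linarith
      moreover have "p (H n s - H n r) \<le> 1 / 4"
        using H_Lip[OF elim(2) s(2,3) r(1) rR] mult_left_mono[OF s(4) L0] h(2) by linarith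
      moreover have "p (H n s - 1) \<le> p (H n s - H n r) + p (H n r - 1)"
        using p_add[of "H n s - H n r" "H n r - 1"] mem by (simp add: cl)
      ultimately have half: "p (H n s - 1) \<le> 1 / 2" by simp
      define u where "u = 1 - P s n"
      have u: "u \<in> C" unfolding u_def by (intro cl mem)
      have eq: "u = (u * H n s - 1) + 1 - u * (H n s - 1)" by (simp add: algebra_simps)
      have "p u \<le> p ((u * H n s - 1) + 1) + p (u * (H n s - 1))"
        by (subst eq) (intro p_diff cl mem u)
      moreover have "p ((u * H n s - 1) + 1) \<le> p (u * H n s - 1) + p 1"
        by (intro p_add cl mem u)
      moreover have "p (u * H n s - 1) = 0"
        using H_inv[OF elim(2) s(2,3)] commute[OF u mem(2)] by (simp only: u_def P_def)
      moreover have "p (u * (H n s - 1)) \<le> p u * (1 / 2)"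
        using p_mult[OF u diff[OF mem(2) one]] mult_left_mono[OF half p_nonneg[of u]] by linarith
      ultimately have "p u \<le> 2 * p 1" by linarith
      moreover have "p (P s n) \<le> p 1 + p u"
        using p_diff[OF one u] by (simp add: u_def)
      ultimately show ?case by simp
    qed
    have "(\<lambda>n. (t / s) ^ n) \<longlonglongrightarrow> 0"
      using s r(1) t(1) by (intro LIMSEQ_power_zero) (simp add: field_simps)
    then have lim: "(\<lambda>n. (t / s) ^ n * (3 * p 1)) \<longlonglongrightarrow> 0"
      using tendsto_mult[OF _ tendsto_const[of "3 * p 1"]] by fastforce
    have le: "\<forall>\<^sub>F n in sequentially. p (P t n) \<le> (t / s) ^ n * (3 * p 1)"
      using bdd
    proof eventually_elim
      case (elim n)
      have "P t n = of_real ((t / s) ^ n) *\<^sub>C P s n"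
        using s(5) by (simp add: P_def scaleC_power scaleC_scaleC power_divide)
      then have "p (P t n) = (t / s) ^ n * p (P s n)"
        using s r(1) t(1) by (simp add: p_scaleC PC norm_power norm_divide)
      also have "\<dots> \<le> (t / s) ^ n * (3 * p 1)"
        using elim s r(1) t(1) by (intro mult_left_mono) auto
      finally show ?case .
    qed
    show ?thesis
      by (rule tendsto_sandwich[OF _ le tendsto_const lim]) (simp add: p_nonneg)
  qed
  have base: "(\<lambda>n. p (P 0 n)) \<longlonglongrightarrow> 0"
  proof (rule tendsto_eventually)
    have "p (P 0 n) = 0" if "0 < n" for n
      using that scaleC_of_real[of 0 a] by (simp add: P_def p_zero power_0_left)
    then show "\<forall>\<^sub>F n in sequentially. p (P 0 n) = 0"
      by (rule eventually_mono[OF eventually_gt_at_top[of 0]])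
  qed
  have "0 \<le> t \<Longrightarrow> t < R \<Longrightarrow> t \<le> real k * (h / 2) \<Longrightarrow> (\<lambda>n. p (P t n)) \<longlonglongrightarrow> 0" for k t
  proof (induction k arbitrary: t)
    case 0
    with base show ?case by simp
  next
    case (Suc k)
    \<comment> \<open>Half of h is used since \<open>step\<close> requires t < r + h
      strictly.\<close>
    define r where "r = max 0 (t - h / 2)"
    have "(\<lambda>n. p (P r n)) \<longlonglongrightarrow> 0"
      using Suc.prems h(1) by (intro Suc.IH) (auto simp: r_def max_def algebra_simps)
    then show ?case
      by (rule step[rotated]) (use Suc.prems h(1) in \<open>auto simp: r_def\<close>)
  qed
  moreover obtain k :: nat where "r / (h / 2) \<le> real k" using real_arch_simple by blast
  then have "r \<le> real k * (h / 2)" using h(1) by (simp add: field_simps)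
  ultimately show ?thesis using R unfolding P_def by blast
qed

end

section \<open>Characters\<close>

text \<open>Continuity is automatic on inverse-closed algebras, by
  \<open>norm_character_le\<close>.\<close>

definition character_on :: "'a::complex_banach_algebra_1 set \<Rightarrow> ('a \<Rightarrow> complex) \<Rightarrow> bool"
  where "character_on C \<psi> \<longleftrightarrow> \<psi> 1 = 1 \<and>
    (\<forall>x\<in>C. \<forall>y\<in>C. \<psi> (x + y) = \<psi> x + \<psi> y \<and> \<psi> (x * y) = \<psi> x * \<psi> y) \<and>
    (\<forall>c. \<forall>x\<in>C. \<psi> (c *\<^sub>C x) = c * \<psi> x)"

text \<open>Invertibility in C and in the ambient algebra coincide, so characters of C detect
  non-invertibility in the ambient algebra.\<close>

locale inverse_closed_subalgebra = comm_subalgebra +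
  assumes inverse: "x \<in> C \<Longrightarrow> x * y = 1 \<Longrightarrow> y * x = 1 \<Longrightarrow> y \<in> C"
begin

text \<open>Scalar multiples come from multiplication by \<open>c *\<^sub>C 1\<close>, which lies in
  C.\<close>

definition ideal :: "'a set \<Rightarrow> bool"
  where "ideal M \<longleftrightarrow> M \<subseteq> C \<and> 0 \<in> M \<and> (\<forall>x\<in>M. \<forall>y\<in>M. x + y \<in> M) \<and> (\<forall>x\<in>C. \<forall>y\<in>M. x * y \<in> M)"

lemma ideal_scaleC: "ideal M \<Longrightarrow> x \<in> M \<Longrightarrow> c *\<^sub>C x \<in> M"
  using mult_scaleC_left[of c 1 x] scaleC[OF one, of c] unfolding ideal_def by (metis mult_1)

lemma ideal_diff: "ideal M \<Longrightarrow> x \<in> M \<Longrightarrow> y \<in> M \<Longrightarrow> x - y \<in> M"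
  using ideal_scaleC[of M y "-1"] unfolding ideal_def
  by (metis ab_group_add_class.ab_diff_conv_add_uminus scaleC_minus_one)

lemma ideal_mult_right: "ideal M \<Longrightarrow> x \<in> M \<Longrightarrow> y \<in> C \<Longrightarrow> x * y \<in> M"
  using commute[of x y] unfolding ideal_def by auto

lemma proper_ideal_not_unit:
  assumes "ideal M" "1 \<notin> M" "x \<in> M"
  shows "\<not> is_unit_elem x"
  using assms inverse[of x] unfolding ideal_def is_unit_elem_def by (metis subsetD)

lemma ideal_sum_principal:
  assumes M: "ideal M" and c: "c \<in> C"
  shows "ideal {m + g * c | m g. m \<in> M \<and> g \<in> C}" (is "ideal ?J")
  unfolding ideal_def
proof (intro conjI ballI subsetI)
  show "x \<in> C" if "x \<in> ?J" for x
    using that M c unfolding ideal_def by (auto intro!: add mult)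
  show "0 \<in> ?J"
    using M zero unfolding ideal_def by (auto intro!: exI[of _ 0])
  show "x + y \<in> ?J" if xy: "x \<in> ?J" "y \<in> ?J" for x y
  proof -
    obtain m g m' g' where "x = m + g * c" "y = m' + g' * c" "m \<in> M" "g \<in> C" "m' \<in> M" "g' \<in> C"
      using xy by blast
    then have "x + y = (m + m') + (g + g') * c \<and> m + m' \<in> M \<and> g + g' \<in> C"
      using M add unfolding ideal_def by (auto simp: algebra_simps)
    then show ?thesis by blast
  qed
  show "x * y \<in> ?J" if xy: "x \<in> C" "y \<in> ?J" for x y
  proof -
    obtain m g where "y = m + g * c" "m \<in> M" "g \<in> C"
      using xy by blast
    then have "x * y = x * m + (x * g) * c \<and> x * m \<in> M \<and> x * g \<in> C"
      using M mult xy(1) unfolding ideal_def by (auto simp: algebra_simps)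
    then show ?thesis by blast
  qed
qed

lemma exists_maximal_ideal:
  assumes "ideal I" "1 \<notin> I"
  shows "\<exists>M. ideal M \<and> 1 \<notin> M \<and> I \<subseteq> M \<and> (\<forall>J. ideal J \<longrightarrow> 1 \<notin> J \<longrightarrow> M \<subseteq> J \<longrightarrow> J = M)"
proof -
  define \<A> where "\<A> = {J. ideal J \<and> 1 \<notin> J \<and> I \<subseteq> J}"
  have "\<exists>M\<in>\<A>. \<forall>J\<in>\<A>. M \<subseteq> J \<longrightarrow> J = M"
  proof (rule subset_Zorn_nonempty)
    show "\<A> \<noteq> {}" using assms by (auto simp: \<A>_def)
    fix \<C> assume ne: "\<C> \<noteq> {}" and chain: "subset.chain \<A> \<C>"
    have sub: "\<C> \<subseteq> \<A>" and lin: "\<And>X Y. X \<in> \<C> \<Longrightarrow> Y \<in> \<C> \<Longrightarrow> X \<subseteq> Y \<or> Y \<subseteq> X"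
      using chain by (auto simp: subset.chain_def subset_chain_def)
    have id: "ideal X" "1 \<notin> X" "I \<subseteq> X" if "X \<in> \<C>" for X using that sub by (auto simp: \<A>_def)
    have "ideal (\<Union>\<C>)"
      unfolding ideal_def
    proof (intro conjI ballI)
      show "\<Union>\<C> \<subseteq> C" "0 \<in> \<Union>\<C>" using id(1) ne unfolding ideal_def by blast+
      show "x + y \<in> \<Union>\<C>" if "x \<in> \<Union>\<C>" "y \<in> \<Union>\<C>" for x y
      proof -
        from that obtain X Y where XY: "x \<in> X" "X \<in> \<C>" "y \<in> Y" "Y \<in> \<C>" by blast
        then have "X \<union> Y \<in> \<C>" using lin[of X Y] by (auto simp: Un_absorb1 Un_absorb2)
        with XY id(1)[of "X \<union> Y"] show ?thesis unfolding ideal_def by blast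
      qed
      show "x * y \<in> \<Union>\<C>" if "x \<in> C" "y \<in> \<Union>\<C>" for x y
        using that id(1) unfolding ideal_def by blast
    qed
    then show "\<Union>\<C> \<in> \<A>" unfolding \<A>_def using id(2,3) ne by blast
  qed
  then obtain M where M: "M \<in> \<A>" "\<And>J. J \<in> \<A> \<Longrightarrow> M \<subseteq> J \<Longrightarrow> J = M" by blast
  show ?thesis
  proof (intro exI[of _ M] conjI allI impI)
    show "ideal M" "1 \<notin> M" "I \<subseteq> M" using M(1) by (simp_all add: \<A>_def)
    fix J assume "ideal J" "1 \<notin> J" "M \<subseteq> J"
    with M(1) show "J = M" by (intro M(2)) (auto simp: \<A>_def)
  qed
qed

lemma ideal_infdist_seq:
  assumes "ideal M"
  shows "\<exists>m. (\<forall>k::nat. m k \<in> M) \<and> (\<lambda>k. norm (x - m k)) \<longlonglongrightarrow> infdist x M"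
proof -
  have ne: "M \<noteq> {}" using assms by (auto simp: ideal_def)
  have "\<exists>m\<in>M. norm (x - m) < infdist x M + 1 / real (Suc k)" for k
  proof -
    have "(INF m\<in>M. dist x m) < infdist x M + 1 / real (Suc k)"
      using ne by (simp add: infdist_notempty)
    then show ?thesis using ne by (subst (asm) cINF_less_iff) (auto simp: dist_norm intro!: bdd_belowI2[where m = 0])
  qed
  then obtain m where m: "\<And>k. m k \<in> M" "\<And>k. norm (x - m k) < infdist x M + 1 / real (Suc k)"
    by metis
  have "(\<lambda>k. infdist x M + 1 / real (Suc k)) \<longlonglongrightarrow> infdist x M + 0"
    using LIMSEQ_inverse_real_of_nat by (intro tendsto_intros) (simp add: inverse_eq_divide)
  then have lim: "(\<lambda>k. infdist x M + 1 / real (Suc k)) \<longlonglongrightarrow> infdist x M" by simp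
  have "(\<lambda>k. norm (x - m k)) \<longlonglongrightarrow> infdist x M"
  proof (rule tendsto_sandwich[OF _ _ tendsto_const lim])
    show "\<forall>\<^sub>F k in sequentially. infdist x M \<le> norm (x - m k)"
      using infdist_le[OF m(1), of x] by (simp add: dist_norm)
    show "\<forall>\<^sub>F k in sequentially. norm (x - m k) \<le> infdist x M + 1 / real (Suc k)"
      using m(2) by (intro always_eventually allI less_imp_le)
  qed
  with m(1) show ?thesis by blast
qed

text \<open>This is the quotient seminorm modulo M. It is submultiplicative because (x - m) (y - n)
  is x y minus an element of M.\<close>

lemma ideal_seminorm:
  assumes M: "ideal M"
  shows "algebra_seminorm C (\<lambda>x. infdist x M)"
proof
  fix x y c
  show "0 \<le> infdist x M" by (rule infdist_nonneg)
  obtain m where m: "\<And>k::nat. m k \<in> M" "(\<lambda>k. norm (x - m k)) \<longlonglongrightarrow> infdist x M"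
    using ideal_infdist_seq[OF M] by blast
  obtain n where n: "\<And>k::nat. n k \<in> M" "(\<lambda>k. norm (y - n k)) \<longlonglongrightarrow> infdist y M"
    using ideal_infdist_seq[OF M] by blast
  show "infdist (x + y) M \<le> infdist x M + infdist y M"
  proof (rule LIMSEQ_le_const[OF tendsto_add[OF m(2) n(2)]], intro exI allI impI)
    fix k
    have "infdist (x + y) M \<le> dist (x + y) (m k + n k)"
      using M m(1) n(1) by (intro infdist_le) (auto simp: ideal_def)
    also have "\<dots> \<le> norm (x - m k) + norm (y - n k)"
      by (simp add: dist_norm add_diff_add norm_triangle_ineq)
    finally show "infdist (x + y) M \<le> norm (x - m k) + norm (y - n k)" .
  qed
  have le: "infdist (c *\<^sub>C x) M \<le> norm c * infdist x M" for c x
  proof -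
    obtain m where m: "\<And>k::nat. m k \<in> M" "(\<lambda>k. norm (x - m k)) \<longlonglongrightarrow> infdist x M"
      using ideal_infdist_seq[OF M] by blast
    show ?thesis
    proof (rule LIMSEQ_le_const[OF tendsto_mult[OF tendsto_const m(2)]], intro exI allI impI)
      fix k
      have "infdist (c *\<^sub>C x) M \<le> dist (c *\<^sub>C x) (c *\<^sub>C m k)"
        using M m(1) by (intro infdist_le ideal_scaleC) auto
      then show "infdist (c *\<^sub>C x) M \<le> norm c * norm (x - m k)"
        by (simp add: dist_norm norm_scaleC flip: scaleC_diff_right)
    qed
  qed
  show "infdist (c *\<^sub>C x) M = norm c * infdist x M"
  proof (cases "c = 0")
    case True
    have "infdist 0 M \<le> dist 0 (0::'a)" using M by (intro infdist_le) (auto simp: ideal_def)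
    with True show ?thesis using infdist_nonneg[of 0 M] by simp
  next
    case False
    have "infdist x M \<le> norm (inverse c) * infdist (c *\<^sub>C x) M"
      using le[of "inverse c" "c *\<^sub>C x"] False by (simp add: scaleC_scaleC)
    then have "norm c * infdist x M \<le> infdist (c *\<^sub>C x) M"
      using False by (simp add: norm_inverse norm_divide field_simps)
    with le[of c x] show ?thesis by simp
  qed
  assume xy: "x \<in> C" "y \<in> C"
  show "infdist (x * y) M \<le> infdist x M * infdist y M"
  proof (rule LIMSEQ_le_const[OF tendsto_mult[OF m(2) n(2)]], intro exI allI impI)
    fix k
    have mk: "m k \<in> C" using M m(1) by (auto simp: ideal_def)
    have "x * n k + (m k * y - m k * n k) \<in> M"
      using M xy mk m(1)[of k] n(1)[of k]
        ideal_diff[OF M ideal_mult_right[OF M m(1) xy(2)], of "m k * n k" k] by (auto simp: ideal_def)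
    then have "infdist (x * y) M \<le> dist (x * y) (x * n k + (m k * y - m k * n k))"
      by (rule infdist_le)
    also have "\<dots> = norm ((x - m k) * (y - n k))" by (simp add: dist_norm algebra_simps)
    also have "\<dots> \<le> norm (x - m k) * norm (y - n k)" by (rule norm_mult_ineq)
    finally show "infdist (x * y) M \<le> norm (x - m k) * norm (y - n k)" .
  qed
qed

text \<open>The open unit ball around 1 consists of units and so misses a proper ideal; the quotient
  seminorm therefore does not vanish at 1.\<close>

lemma infdist_one_ideal:
  assumes M: "ideal M" "1 \<notin> M"
  shows "1 \<le> infdist 1 M"
proof -
  have "1 \<le> dist 1 m" if "m \<in> M" for m
    using is_unit_elem_one_minus[of "1 - m"] proper_ideal_not_unit[OF M that]
    by (auto simp: dist_norm not_less[symmetric])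
  then show ?thesis
    using M(1) by (subst infdist_notempty) (auto simp: ideal_def intro!: cINF_greatest)
qed

text \<open>
  Gelfand--Mazur: if no \<open>c - z\<close> lay in \<open>M\<close>, then modulo \<open>M\<close> the inverse \<open>d\<close> of \<open>c\<close> would satisfy
  \<open>r\<^sup>n d\<^sup>n \<rightarrow> 0\<close> for every \<open>r\<close>, contradicting \<open>c\<^sup>n d\<^sup>n = 1\<close>.
\<close>

lemma maximal_ideal_scalar:
  assumes M: "ideal M" "1 \<notin> M" and max: "\<And>J. ideal J \<Longrightarrow> 1 \<notin> J \<Longrightarrow> M \<subseteq> J \<Longrightarrow> J = M" and c: "c \<in> C"
  shows "\<exists>z. c - z *\<^sub>C 1 \<in> M"
proof (rule ccontr)
  assume neg: "\<nexists>z. c - z *\<^sub>C 1 \<in> M"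
  interpret algebra_seminorm C "\<lambda>x. infdist x M" by (rule ideal_seminorm[OF M(1)])
  note cl = closed_rules c
  have inM: "infdist x M = 0" if "x \<in> M" for x using that by simp
  \<comment> \<open>By maximality, M and c - z together generate an ideal containing 1.\<close>
  have inv: "\<exists>g\<in>C. g * (c - z *\<^sub>C 1) - 1 \<in> M" for z
  proof -
    define d where "d = c - z *\<^sub>C 1"
    have d: "d \<in> C" "d \<notin> M" using neg unfolding d_def by (auto intro: cl)
    define J where "J = {m + g * d | m g. m \<in> M \<and> g \<in> C}"
    have "ideal J" unfolding J_def by (rule ideal_sum_principal[OF M(1) d(1)])
    moreover have "M \<subseteq> J"
      using zero unfolding J_def by (intro subsetI CollectI) (metis add_0_right mult_zero_left)
    moreover have "d \<in> J"
      using M(1) one unfolding J_def ideal_def by (intro CollectI) (metis add_0_left mult_1_left)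
    ultimately have "1 \<in> J" using max[of J] d(2) by blast
    then obtain m g where mg: "1 = m + g * d" "m \<in> M" "g \<in> C" unfolding J_def by blast
    then have "g * d - 1 = (-1) *\<^sub>C m" by (simp add: scaleC_minus_one algebra_simps)
    then show ?thesis using ideal_scaleC[OF M(1) mg(2)] mg(3) unfolding d_def by metis
  qed
  obtain d where d: "d \<in> C" "d * c - 1 \<in> M" using inv[of 0] by auto
  \<comment> \<open>Since d c is 1 modulo M, 1 - z d is congruent to d (c - z), which is inverted by
    g c.\<close>
  have inv_d: "\<exists>g\<in>C. infdist (g * (1 - z *\<^sub>C d) - 1) M = 0" for z
  proof -
    obtain g where g: "g \<in> C" "g * (c - z *\<^sub>C 1) - 1 \<in> M" using inv[of z] by blast
    have "(g * c) * (1 - z *\<^sub>C d) - 1 = (g * (c - z *\<^sub>C 1) - 1) - (z *\<^sub>C g) * (d * c - 1)"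
      using commute[OF c d(1)]
      by (simp add: right_diff_distrib left_diff_distrib mult_scaleC_left mult_scaleC_right mult.assoc)
    moreover have "(z *\<^sub>C g) * (d * c - 1) \<in> M"
      using M(1) d(2) scaleC[OF g(1)] unfolding ideal_def by blast
    ultimately have "(g * c) * (1 - z *\<^sub>C d) - 1 \<in> M" using ideal_diff[OF M(1) g(2)] by metis
    then show ?thesis using inM mult[OF g(1) c] by blast
  qed
  \<comment> \<open>r dominates the seminorm of c, so c^n d^n = 1 modulo M keeps r^n times the
    seminorm of d^n at least 1.\<close>
  define r where "r = infdist c M + 1"
  have r: "0 < r" "infdist c M \<le> r" using infdist_nonneg[of c M] by (auto simp: r_def)
  have "(\<lambda>n. infdist ((complex_of_real r *\<^sub>C d) ^ n) M) \<longlonglongrightarrow> 0"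
    using r inv_d by (intro power_tendsto_zero[OF d(1), of r "r + 1"]) auto
  moreover have "1 \<le> infdist ((complex_of_real r *\<^sub>C d) ^ n) M" for n
  proof -
    have "infdist (c ^ n * d ^ n - 1) M = 0"
    proof (induction n)
      case 0
      show ?case using M(1) by (simp add: ideal_def)
    next
      case (Suc n)
      have "c ^ Suc n * d ^ Suc n = c ^ n * ((c * d) * d ^ n)"
        by (simp only: power_Suc2[of c n] power_Suc[of d n] mult.assoc)
      also have "(c * d) * d ^ n = d ^ n * (d * c)"
        using commute[OF mult[OF c d(1)] power[OF d(1)]] commute[OF c d(1)] by simp
      finally have "c ^ Suc n * d ^ Suc n = (c ^ n * d ^ n) * (d * c)"
        by (simp only: mult.assoc)
      then have "c ^ Suc n * d ^ Suc n - 1 = (c ^ n * d ^ n - 1) * (d * c) + (d * c - 1)"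
        by (simp add: algebra_simps)
      also have "infdist \<dots> M = 0"
        using inM[OF d(2)] Suc by (intro p_add_zero p_mult_zero cl d)
      finally show ?case .
    qed
    then have "infdist 1 M = infdist (c ^ n * d ^ n) M"
      using p_cong[of "c ^ n * d ^ n" 1] d(1) cl by simp
    also have "\<dots> \<le> infdist (c ^ n) M * infdist (d ^ n) M" by (intro p_mult cl d)
    also have "infdist (c ^ n) M \<le> infdist 1 M * infdist c M ^ n"
    proof (induction n)
      case (Suc n)
      have "infdist (c ^ Suc n) M \<le> infdist c M * infdist (c ^ n) M"
        unfolding power_Suc by (intro p_mult cl)
      also have "\<dots> \<le> infdist c M * (infdist 1 M * infdist c M ^ n)"
        by (intro mult_left_mono Suc infdist_nonneg)
      finally show ?case by (simp add: mult_ac)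
    qed simp
    also have "infdist 1 M * infdist c M ^ n \<le> infdist 1 M * r ^ n"
      using r infdist_nonneg by (intro mult_left_mono power_mono) auto
    finally have "infdist 1 M \<le> infdist 1 M * (r ^ n * infdist (d ^ n) M)"
      using infdist_nonneg[of "d ^ n" M] by (simp add: mult_right_mono mult.assoc)
    moreover have "infdist ((complex_of_real r *\<^sub>C d) ^ n) M = r ^ n * infdist (d ^ n) M"
      using r power[OF d(1)] by (simp add: scaleC_power p_scaleC norm_power)
    ultimately show ?thesis using infdist_one_ideal[OF M] by (simp add: mult_le_cancel_left1)
  qed
  ultimately have "1 \<le> (0::real)" by (intro LIMSEQ_le_const) auto
  then show False by simp
qed

text \<open>The multiples of c - z form a proper ideal because C is commutative. Modulo a maximal
  ideal above it each x is congruent to exactly one scalar, which is the value of the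
  character.\<close>

lemma exists_character:
  assumes c: "c \<in> C" and noninv: "\<not> is_unit_elem (c - z *\<^sub>C 1)"
  shows "\<exists>\<psi>. character_on C \<psi> \<and> \<psi> c = z"
proof -
  define I where "I = {m + g * (c - z *\<^sub>C 1) | m g. m \<in> {0} \<and> g \<in> C}"
  have dC: "c - z *\<^sub>C 1 \<in> C" by (intro closed_rules c)
  have I: "ideal I"
    unfolding I_def using dC zero by (intro ideal_sum_principal) (auto simp: ideal_def)
  have "1 \<notin> I"
    using noninv commute[OF _ dC] unfolding I_def is_unit_elem_def by auto
  with I obtain M where M: "ideal M" "1 \<notin> M" "I \<subseteq> M"
    "\<And>J. ideal J \<Longrightarrow> 1 \<notin> J \<Longrightarrow> M \<subseteq> J \<Longrightarrow> J = M"
    using exists_maximal_ideal by meson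
  have scalar_unique: "a = b" if "x - a *\<^sub>C 1 \<in> M" "x - b *\<^sub>C 1 \<in> M" for x a b
  proof (rule ccontr)
    assume "a \<noteq> b"
    have "(a - b) *\<^sub>C 1 \<in> M"
      using ideal_diff[OF M(1) that(2,1)] by (simp add: scaleC_diff_left)
    from ideal_scaleC[OF M(1) this, of "inverse (a - b)"] \<open>a \<noteq> b\<close> M(2) show False
      by (simp add: scaleC_scaleC)
  qed
  define \<psi> where "\<psi> x = (THE a. x - a *\<^sub>C 1 \<in> M)" for x
  have \<psi>_eq: "\<psi> x = a" if "x - a *\<^sub>C 1 \<in> M" for x a
    unfolding \<psi>_def using that scalar_unique by blast
  have \<psi>_in: "x - \<psi> x *\<^sub>C 1 \<in> M" if "x \<in> C" for x
    using maximal_ideal_scalar[OF M(1,2,4) that] \<psi>_eq by metis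
  have M_add: "x \<in> M \<Longrightarrow> y \<in> M \<Longrightarrow> x + y \<in> M" and M_zero: "0 \<in> M"
    and M_mult: "x \<in> C \<Longrightarrow> y \<in> M \<Longrightarrow> x * y \<in> M" for x y
    using M(1) unfolding ideal_def by auto
  have "character_on C \<psi>"
    unfolding character_on_def
  proof (intro conjI ballI allI)
    show "\<psi> 1 = 1" by (rule \<psi>_eq) (simp add: M_zero)
    fix x assume x: "x \<in> C"
    show "\<psi> (a *\<^sub>C x) = a * \<psi> x" for a
    proof (rule \<psi>_eq)
      have "a *\<^sub>C (x - \<psi> x *\<^sub>C 1) \<in> M" by (intro ideal_scaleC M \<psi>_in x)
      then show "a *\<^sub>C x - (a * \<psi> x) *\<^sub>C 1 \<in> M" by (simp add: scaleC_diff_right scaleC_scaleC)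
    qed
    fix y assume y: "y \<in> C"
    show "\<psi> (x + y) = \<psi> x + \<psi> y"
      using M_add[OF \<psi>_in[OF x] \<psi>_in[OF y]]
      by (intro \<psi>_eq) (simp add: scaleC_add_left algebra_simps)
    show "\<psi> (x * y) = \<psi> x * \<psi> y"
    proof (rule \<psi>_eq)
      have "x * (y - \<psi> y *\<^sub>C 1) + \<psi> y *\<^sub>C (x - \<psi> x *\<^sub>C 1) \<in> M"
        by (intro M_add M_mult ideal_scaleC M \<psi>_in x y)
      then show "x * y - (\<psi> x * \<psi> y) *\<^sub>C 1 \<in> M"
        by (simp add: scaleC_diff_right scaleC_scaleC right_diff_distrib mult_scaleC_right mult.commute)
    qed
  qed
  moreover have "\<psi> c = z"
  proof (rule \<psi>_eq)
    have "c - z *\<^sub>C 1 \<in> I" 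
      unfolding I_def using one by (intro CollectI) (metis add_0_left mult_1_left singletonI)
    with M(3) show "c - z *\<^sub>C 1 \<in> M" by blast
  qed
  ultimately show ?thesis by blast
qed

text \<open>An inverse of x - \<psi> x would lie in C, and applying \<psi> to the product would give
  0 = 1.\<close>

lemma character_not_unit:
  assumes \<psi>: "character_on C \<psi>" and x: "x \<in> C"
  shows "\<not> is_unit_elem (x - \<psi> x *\<^sub>C 1)"
proof
  assume "is_unit_elem (x - \<psi> x *\<^sub>C 1)"
  then obtain y where y: "(x - \<psi> x *\<^sub>C 1) * y = 1" "y * (x - \<psi> x *\<^sub>C 1) = 1"
    unfolding is_unit_elem_def by blast
  have d: "x - \<psi> x *\<^sub>C 1 \<in> C" "(- \<psi> x) *\<^sub>C 1 \<in> C" by (intro closed_rules x)+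
  have yC: "y \<in> C" using inverse[OF d(1) y] .
  have "\<psi> (x - \<psi> x *\<^sub>C 1) = \<psi> (x + (- \<psi> x) *\<^sub>C 1)" by simp
  also have "\<dots> = \<psi> x + \<psi> ((- \<psi> x) *\<^sub>C 1)"
    using \<psi> x d(2) unfolding character_on_def by blast
  also have "\<psi> ((- \<psi> x) *\<^sub>C 1) = - \<psi> x * \<psi> 1"
    using \<psi> one unfolding character_on_def by blast
  also have "\<psi> x + - \<psi> x * \<psi> 1 = 0"
    using \<psi> by (simp add: character_on_def)
  finally have "\<psi> (x - \<psi> x *\<^sub>C 1) = 0" .
  moreover have "\<psi> ((x - \<psi> x *\<^sub>C 1) * y) = \<psi> (x - \<psi> x *\<^sub>C 1) * \<psi> y"
    using \<psi> d yC unfolding character_on_def by blast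
  ultimately show False using y(1) \<psi> by (simp add: character_on_def)
qed

text \<open>Otherwise x / \<psi> x has norm below 1, and the Neumann series inverts x - \<psi>
  x.\<close>

lemma norm_character_le:
  assumes \<psi>: "character_on C \<psi>" and x: "x \<in> C"
  shows "norm (\<psi> x) \<le> norm x"
proof (rule ccontr)
  assume neg: "\<not> norm (\<psi> x) \<le> norm x"
  then have nz: "\<psi> x \<noteq> 0" by auto
  have "norm (inverse (\<psi> x) *\<^sub>C x) < 1"
    using neg nz by (simp add: norm_scaleC norm_inverse norm_divide field_simps)
  then obtain y where y: "(1 - inverse (\<psi> x) *\<^sub>C x) * y = 1" "y * (1 - inverse (\<psi> x) *\<^sub>C x) = 1"
    using is_unit_elem_one_minus unfolding is_unit_elem_def by blast
  have eq: "x - \<psi> x *\<^sub>C 1 = (- \<psi> x) *\<^sub>C (1 - inverse (\<psi> x) *\<^sub>C x)"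
    using nz scaleC_diff_left[of 0 "\<psi> x" 1]
    by (simp add: scaleC_diff_right scaleC_scaleC scaleC_minus_one)
  have "is_unit_elem (x - \<psi> x *\<^sub>C 1)"
    unfolding is_unit_elem_def eq
    using y nz
    by (intro exI[of _ "(- inverse (\<psi> x)) *\<^sub>C y"]) (simp add: mult_scaleC_left mult_scaleC_right scaleC_scaleC)
  with character_not_unit[OF assms] show False by blast
qed

text \<open>The hard half of the spectral radius formula: bounds on character values control the
  norms of powers. This makes power series converge in norm under purely spectral
  assumptions.\<close>

lemma norm_power_bound:
  assumes c: "c \<in> C" and r: "0 \<le> r" "r < R"
    and le: "\<And>\<psi>. character_on C \<psi> \<Longrightarrow> norm (\<psi> c) \<le> r"
  shows "\<exists>K. \<forall>n. norm (c ^ n) \<le> K * R ^ n"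
proof -
  interpret algebra_seminorm C norm
    by standard (auto simp: norm_triangle_ineq norm_scaleC norm_mult_ineq)
  \<comment> \<open>With s strictly between r and R, 1 - z c is invertible on the closed disc of
    radius 1 / s, which exceeds the radius 1 / R where decay is wanted.\<close>
  define s where "s = (r + R) / 2"
  have s: "0 < s" "r < s" "s < R" "0 < R" using r by (auto simp: s_def)
  have "\<exists>g\<in>C. norm (g * (1 - z *\<^sub>C c) - 1) = 0" if z: "norm z \<le> 1 / s" for z
  proof (cases "z = 0")
    case False
    have "is_unit_elem (c - inverse z *\<^sub>C 1)"
    proof (rule ccontr)
      assume "\<not> ?thesis"
      then obtain \<psi> where "character_on C \<psi>" "\<psi> c = inverse z" using exists_character[OF c] by blast
      with le have "norm (inverse z) \<le> r" by metis
      then have "1 \<le> r * norm z" using False by (simp add: norm_inverse norm_divide field_simps)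
      moreover have "r * norm z < s * norm z" using False s by simp
      ultimately show False using z s by (simp add: field_simps)
    qed
    then obtain y where y: "(c - inverse z *\<^sub>C 1) * y = 1" "y * (c - inverse z *\<^sub>C 1) = 1"
      unfolding is_unit_elem_def by blast
    have yC: "y \<in> C" using y by (intro inverse[OF _ y]) (auto intro!: closed_rules c)
    have "(- inverse z) *\<^sub>C y \<in> C" by (intro closed_rules yC)
    moreover have "1 - z *\<^sub>C c = (- z) *\<^sub>C (c - inverse z *\<^sub>C 1)"
      using False scaleC_diff_left[of 0 z c] by (simp add: scaleC_diff_right scaleC_scaleC scaleC_minus_one)
    ultimately show ?thesis using y(2) False
      by (intro bexI[of _ "(- inverse z) *\<^sub>C y"]) (simp_all add: mult_scaleC_left mult_scaleC_right scaleC_scaleC)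
  qed (auto intro!: bexI[of _ 1] one)
  then have "(\<lambda>n. norm ((complex_of_real (1 / R) *\<^sub>C c) ^ n)) \<longlonglongrightarrow> 0"
    using s by (intro power_tendsto_zero[OF c, of _ "1 / s"]) (auto simp: field_simps)
  then have "Bseq (\<lambda>n. norm ((complex_of_real (1 / R) *\<^sub>C c) ^ n))"
    by (intro convergent_imp_Bseq) (auto simp: convergent_def)
  then obtain K where K: "\<And>n. norm (norm ((complex_of_real (1 / R) *\<^sub>C c) ^ n)) \<le> K"
    unfolding Bseq_def by blast
  have "norm (c ^ n) \<le> K * R ^ n" for n
    using K[of n] s(4) by (simp add: scaleC_power norm_scaleC norm_power power_divide norm_divide field_simps)
  then show ?thesis by blast
qed

end

section \<open>Commutants and bicommutants\<close>

definition commutant :: "'a::semigroup_mult set \<Rightarrow> 'a set"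
  where "commutant S = {x. \<forall>s\<in>S. x * s = s * x}"

text \<open>An inverse of x commutes with everything that x commutes with. As the elements of S
  commute, S lies in its commutant; hence so does the bicommutant, which therefore commutes with
  itself.\<close>

lemma bicommutant_inverse_closed_subalgebra:
  fixes S :: "'a::complex_banach_algebra_1 set"
  assumes S: "\<And>x y. x \<in> S \<Longrightarrow> y \<in> S \<Longrightarrow> x * y = y * x"
  shows "inverse_closed_subalgebra (commutant (commutant S))"
proof
  let ?C = "commutant (commutant S)"
  show "1 \<in> ?C" by (simp add: commutant_def)
  fix x y c assume x: "x \<in> ?C"
  show "c *\<^sub>C x \<in> ?C" using x by (simp add: commutant_def mult_scaleC_left mult_scaleC_right)
  show "y \<in> ?C" if y: "x * y = 1" "y * x = 1"
  proof -
    have "y * s = s * y" if "s \<in> commutant S" for s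
    proof -
      have "x * s = s * x" using x that by (auto simp: commutant_def)
      then have "y * (x * s) * y = y * (s * x) * y" by simp
      then show ?thesis using y by (metis mult.assoc mult_1 mult_1_right)
    qed
    then show ?thesis by (simp add: commutant_def)
  qed
  assume y: "y \<in> ?C"
  show "x + y \<in> ?C" using x y by (simp add: commutant_def distrib_left distrib_right)
  show "x * y \<in> ?C" using x y by (simp add: commutant_def) (metis mult.assoc)
  have "S \<subseteq> commutant S" using S by (auto simp: commutant_def)
  then have "y \<in> commutant S" using y by (auto simp: commutant_def)
  then show "x * y = y * x" using x by (auto simp: commutant_def)
qed

lemma closed_commutant: "closed (commutant (S :: 'a::real_normed_algebra_1 set))"
proof -
  have "commutant S = (\<Inter>s\<in>S. {x. x * s = s * x})" by (auto simp: commutant_def)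
  moreover have "closed {x. x * s = s * x}" for s :: 'a
    by (intro closed_Collect_eq continuous_intros)
  ultimately show ?thesis by auto
qed

lemma subset_bicommutant: "S \<subseteq> commutant (commutant S)"
  by (auto simp: commutant_def)

section \<open>Bounded complex-linear operators\<close>

lemmas blinfun_compose_add_left = bounded_bilinear.add_left[OF bounded_bilinear_blinfun_compose]
  and blinfun_compose_add_right = bounded_bilinear.add_right[OF bounded_bilinear_blinfun_compose]
  and blinfun_compose_diff_left = bounded_bilinear.diff_left[OF bounded_bilinear_blinfun_compose]
  and blinfun_compose_diff_right = bounded_bilinear.diff_right[OF bounded_bilinear_blinfun_compose]

lemma blinfun_compose_assoc: "(f o\<^sub>L g) o\<^sub>L h = f o\<^sub>L (g o\<^sub>L h)"
  by (rule blinfun_eqI) simp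

lemma blinfun_compose_scaleC_left: "(c *\<^sub>C f) o\<^sub>L g = c *\<^sub>C (f o\<^sub>L g)"
  by (rule blinfun_eqI) (simp add: scaleC_blinfun.rep_eq)

lemma blinfun_compose_scaleC_right:
  "complex_linear_op f \<Longrightarrow> f o\<^sub>L (c *\<^sub>C g) = c *\<^sub>C (f o\<^sub>L g)"
  by (rule blinfun_eqI) (simp add: scaleC_blinfun.rep_eq complex_linear_op_def)

lemma scaleR_conv_scaleC: "r *\<^sub>R x = complex_of_real r *\<^sub>C x"
  by (simp add: scaleC_of_real)

lemma scaleC_commute: "c *\<^sub>C d *\<^sub>C x = d *\<^sub>C c *\<^sub>C x"
  by (simp add: scaleC_scaleC mult.commute)

lemma complex_linear_op_zero [simp]: "complex_linear_op 0"
  and complex_linear_op_id [simp]: "complex_linear_op id_blinfun"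
  by (simp_all add: complex_linear_op_def)

lemma complex_linear_op_add [intro]:
  "complex_linear_op f \<Longrightarrow> complex_linear_op g \<Longrightarrow> complex_linear_op (f + g)"
  by (simp add: complex_linear_op_def blinfun.add_left scaleC_add_right)

lemma complex_linear_op_scaleC [intro]: "complex_linear_op f \<Longrightarrow> complex_linear_op (c *\<^sub>C f)"
  by (simp add: complex_linear_op_def scaleC_blinfun.rep_eq scaleC_commute)

lemma complex_linear_op_scaleR [intro]: "complex_linear_op f \<Longrightarrow> complex_linear_op (r *\<^sub>R f)"
  by (simp add: scaleR_conv_scaleC complex_linear_op_scaleC)

lemma complex_linear_op_minus [intro]: "complex_linear_op f \<Longrightarrow> complex_linear_op (- f)"
  by (simp add: complex_linear_op_def blinfun.minus_left)

lemma complex_linear_op_diff [intro]: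
  "complex_linear_op f \<Longrightarrow> complex_linear_op g \<Longrightarrow> complex_linear_op (f - g)"
  by (simp add: complex_linear_op_def blinfun.diff_left scaleC_diff_right)

lemma complex_linear_op_compose [intro]:
  "complex_linear_op f \<Longrightarrow> complex_linear_op g \<Longrightarrow> complex_linear_op (f o\<^sub>L g)"
  by (simp add: complex_linear_op_def)

lemma closed_complex_linear_op:
  "closed {f :: 'a::complex_normed_vector \<Rightarrow>\<^sub>L 'a. complex_linear_op f}"
proof -
  have "closed {f :: 'a \<Rightarrow>\<^sub>L 'a. blinfun_apply f (c *\<^sub>C x) = c *\<^sub>C blinfun_apply f x}" for c x
    by (intro closed_Collect_eq continuous_intros
        continuous_on_compose2[OF linear_continuous_on[OF bounded_linear_scaleC_right, of UNIV]]) auto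
  moreover have "{f :: 'a \<Rightarrow>\<^sub>L 'a. complex_linear_op f} =
      (\<Inter>c. \<Inter>x. {f. blinfun_apply f (c *\<^sub>C x) = c *\<^sub>C blinfun_apply f x})"
    by (auto simp: complex_linear_op_def)
  ultimately show ?thesis by (auto intro!: closed_INT)
qed

text \<open>
  The unitization of the algebra of bounded complex-linear operators. Unlike the latter, it is a
  unital Banach algebra with \<open>1 \<noteq> 0\<close> even over the zero space.
\<close>

typedef (overloaded) ('a::complex_normed_vector) unitization =
  "{(f :: 'a \<Rightarrow>\<^sub>L 'a, c :: complex). complex_linear_op f}"
  by (intro exI[of _ "(0, 0)"]) simp

setup_lifting type_definition_unitization

definition op_part :: "'a::complex_normed_vector unitization \<Rightarrow> ('a \<Rightarrow>\<^sub>L 'a)"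
  where "op_part x = fst (Rep_unitization x)"
definition scalar_part :: "'a::complex_normed_vector unitization \<Rightarrow> complex"
  where "scalar_part x = snd (Rep_unitization x)"

lemma complex_linear_op_part [simp]: "complex_linear_op (op_part x)"
  using Rep_unitization[of x] by (auto simp: op_part_def)

lemma unitization_eqI: "op_part x = op_part y \<Longrightarrow> scalar_part x = scalar_part y \<Longrightarrow> x = y"
  by (simp add: op_part_def scalar_part_def prod_eq_iff flip: Rep_unitization_inject)

instantiation unitization :: (complex_normed_vector) real_vector
begin

lift_definition zero_unitization :: "'a unitization" is "(0, 0)" by simp
lift_definition plus_unitization :: "'a unitization \<Rightarrow> 'a unitization \<Rightarrow> 'a unitization"
  is "\<lambda>(f, c) (g, d). (f + g, c + d)" by auto
lift_definition minus_unitization :: "'a unitization \<Rightarrow> 'a unitization \<Rightarrow> 'a unitization"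
  is "\<lambda>(f, c) (g, d). (f - g, c - d)" by auto
lift_definition uminus_unitization :: "'a unitization \<Rightarrow> 'a unitization"
  is "\<lambda>(f, c). (- f, - c)" by auto
lift_definition scaleR_unitization :: "real \<Rightarrow> 'a unitization \<Rightarrow> 'a unitization"
  is "\<lambda>r (f, c). (r *\<^sub>R f, r *\<^sub>R c)" by auto
lemma part_simps [simp]:
  "op_part 0 = 0" "scalar_part 0 = 0"
  "op_part (x + y) = op_part x + op_part y" "scalar_part (x + y) = scalar_part x + scalar_part y"
  "op_part (x - y) = op_part x - op_part y" "scalar_part (x - y) = scalar_part x - scalar_part y"
  "op_part (- x) = - op_part x" "scalar_part (- x) = - scalar_part x"
  "op_part (r *\<^sub>R x) = r *\<^sub>R op_part x" "scalar_part (r *\<^sub>R x) = r *\<^sub>R scalar_part x"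
  by (auto simp: op_part_def scalar_part_def zero_unitization.rep_eq plus_unitization.rep_eq
      minus_unitization.rep_eq uminus_unitization.rep_eq scaleR_unitization.rep_eq split: prod.split)

instance
proof
  fix x y z :: "'a unitization" and r s :: real
  show "x + y + z = x + (y + z)" "x + y = y + x" "0 + x = x" "- x + x = 0" "x - y = x + - y"
    "r *\<^sub>R (x + y) = r *\<^sub>R x + r *\<^sub>R y" "(r + s) *\<^sub>R x = r *\<^sub>R x + s *\<^sub>R x"
    "r *\<^sub>R s *\<^sub>R x = (r * s) *\<^sub>R x" "1 *\<^sub>R x = x"
    by (auto intro!: unitization_eqI simp: algebra_simps)
qed

end

instantiation unitization :: (complex_normed_vector) real_normed_vector
begin

definition norm_unitization :: "'a unitization \<Rightarrow> real"
  where "norm_unitization x = norm (op_part x) + norm (scalar_part x)"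
definition sgn_unitization :: "'a unitization \<Rightarrow> 'a unitization"
  where "sgn_unitization x = x /\<^sub>R norm x"
definition dist_unitization :: "'a unitization \<Rightarrow> 'a unitization \<Rightarrow> real"
  where "dist_unitization x y = norm (x - y)"
definition uniformity_unitization :: "('a unitization \<times> 'a unitization) filter"
  where "uniformity_unitization = (INF e\<in>{0<..}. principal {(x, y). dist x y < e})"
definition open_unitization :: "'a unitization set \<Rightarrow> bool"
  where "open_unitization U = (\<forall>x\<in>U. \<forall>\<^sub>F (x', y) in uniformity. x' = x \<longrightarrow> y \<in> U)"

instance
proof
  fix x y :: "'a unitization" and r :: real
  show "sgn x = x /\<^sub>R norm x" by (simp add: sgn_unitization_def)
  show "dist x y = norm (x - y)" by (simp add: dist_unitization_def)
  show "norm x = 0 \<longleftrightarrow> x = 0"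
    by (auto simp: norm_unitization_def add_nonneg_eq_0_iff intro: unitization_eqI)
  show "norm (x + y) \<le> norm x + norm y"
    using norm_triangle_ineq[of "op_part x" "op_part y"]
      norm_triangle_ineq[of "scalar_part x" "scalar_part y"]
    by (simp add: norm_unitization_def)
  show "norm (r *\<^sub>R x) = \<bar>r\<bar> * norm x"
    by (simp add: norm_unitization_def algebra_simps)
qed (simp_all add: uniformity_unitization_def open_unitization_def)

end

instantiation unitization :: ("{complex_normed_vector, banach}") complex_banach_algebra_1
begin

lift_definition one_unitization :: "'a unitization" is "(0, 1)" by simp
lift_definition times_unitization :: "'a unitization \<Rightarrow> 'a unitization \<Rightarrow> 'a unitization"
  is "\<lambda>(f, c) (g, d). ((f o\<^sub>L g) + c *\<^sub>C g + d *\<^sub>C f, c * d)" by auto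
lift_definition scaleC_unitization :: "complex \<Rightarrow> 'a unitization \<Rightarrow> 'a unitization"
  is "\<lambda>a (f, c). (a *\<^sub>C f, a * c)" by auto

lemma part_simps_algebra [simp]:
  "op_part 1 = 0" "scalar_part 1 = 1"
  "op_part (x * y) = (op_part x o\<^sub>L op_part y) + scalar_part x *\<^sub>C op_part y + scalar_part y *\<^sub>C op_part x"
  "scalar_part (x * y) = scalar_part x * scalar_part y"
  "op_part (a *\<^sub>C x) = a *\<^sub>C op_part x" "scalar_part (a *\<^sub>C x) = a * scalar_part x"
  by (auto simp: op_part_def scalar_part_def one_unitization.rep_eq times_unitization.rep_eq
      scaleC_unitization.rep_eq split: prod.split)

instance
proof
  fix x y z :: "'a unitization" and a b :: complex and r :: real
  note dist = blinfun_compose_add_left blinfun_compose_add_right blinfun_compose_scaleC_left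
    blinfun_compose_scaleC_right scaleC_add_right scaleC_add_left scaleC_scaleC
  show "x * y * z = x * (y * z)" 
    by (rule unitization_eqI) (simp_all add: dist blinfun_compose_assoc mult.commute mult.left_commute add_ac)
  show "(x + y) * z = x * z + y * z" "x * (y + z) = x * y + x * z"
    by (auto intro!: unitization_eqI simp: dist algebra_simps)
  show "1 * x = x" "x * 1 = x"
    by (auto intro!: unitization_eqI)
  show "(0 :: 'a unitization) \<noteq> 1"
  proof
    assume "(0 :: 'a unitization) = 1"
    then have "scalar_part (0 :: 'a unitization) = scalar_part (1 :: 'a unitization)" by (rule arg_cong)
    then show False unfolding part_simps part_simps_algebra by simp
  qed
  show "r *\<^sub>R x * y = r *\<^sub>R (x * y)" "x * r *\<^sub>R y = r *\<^sub>R (x * y)"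
    by (auto intro!: unitization_eqI simp: scaleR_conv_scaleC scaleC_complex_def dist mult.commute mult.left_commute)
  show "norm (1 :: 'a unitization) = 1" by (simp add: norm_unitization_def)
  show "norm (x * y) \<le> norm x * norm y"
  proof -
    have "norm (op_part (x * y)) \<le> norm (op_part x) * norm (op_part y)
        + norm (scalar_part x) * norm (op_part y) + norm (scalar_part y) * norm (op_part x)"
      using norm_triangle_ineq[of "(op_part x o\<^sub>L op_part y) + scalar_part x *\<^sub>C op_part y" "scalar_part y *\<^sub>C op_part x"]
        norm_triangle_ineq[of "op_part x o\<^sub>L op_part y" "scalar_part x *\<^sub>C op_part y"]
        norm_blinfun_compose[of "op_part x" "op_part y"]
      by (simp add: norm_scaleC)
    then show ?thesis by (simp add: norm_unitization_def norm_mult algebra_simps)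
  qed
  show "a *\<^sub>C (x + y) = a *\<^sub>C x + a *\<^sub>C y" "(a + b) *\<^sub>C x = a *\<^sub>C x + b *\<^sub>C x"
    "a *\<^sub>C b *\<^sub>C x = (a * b) *\<^sub>C x"
    by (auto intro!: unitization_eqI simp: dist algebra_simps)
  show "complex_of_real r *\<^sub>C x = r *\<^sub>R x"
    by (auto intro!: unitization_eqI simp: scaleC_of_real scaleR_conv_of_real)
  show "norm (a *\<^sub>C x) = norm a * norm x"
    by (simp add: norm_unitization_def norm_scaleC norm_mult algebra_simps)
  show "a *\<^sub>C x * y = a *\<^sub>C (x * y)" "x * a *\<^sub>C y = a *\<^sub>C (x * y)"
    by (auto intro!: unitization_eqI simp: dist mult.commute mult.left_commute)
next
  fix X :: "nat \<Rightarrow> 'a unitization" assume X: "Cauchy X"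
  have *: "Cauchy (\<lambda>n. h (X n))" if "\<And>x y. norm (h x - h y) \<le> norm (x - y)"
    for h :: "'a unitization \<Rightarrow> 'b::real_normed_vector"
  proof (rule CauchyI)
    fix e :: real assume "0 < e"
    with X obtain M where "\<forall>m\<ge>M. \<forall>n\<ge>M. norm (X m - X n) < e" using CauchyD by blast
    then show "\<exists>M. \<forall>m\<ge>M. \<forall>n\<ge>M. norm (h (X m) - h (X n)) < e"
      using that by (meson le_less_trans)
  qed
  have "Cauchy (\<lambda>n. op_part (X n))" "Cauchy (\<lambda>n. scalar_part (X n))"
    by (rule *, simp add: norm_unitization_def)+
  then obtain f c where f: "(\<lambda>n. op_part (X n)) \<longlonglongrightarrow> f" and c: "(\<lambda>n. scalar_part (X n)) \<longlonglongrightarrow> c"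
    using Cauchy_convergent convergent_def by metis
  have lin: "complex_linear_op f"
    using closed_sequentially[OF closed_complex_linear_op _ f] by simp
  define x where "x = Abs_unitization (f, c)"
  have x: "op_part x = f" "scalar_part x = c"
    using lin by (simp_all add: x_def op_part_def scalar_part_def Abs_unitization_inverse)
  have "(\<lambda>n. norm (op_part (X n) - f) + norm (scalar_part (X n) - c)) \<longlonglongrightarrow> 0"
    using tendsto_add[OF tendsto_norm_zero[OF LIM_zero[OF f]] tendsto_norm_zero[OF LIM_zero[OF c]]] by simp
  then have "(\<lambda>n. dist (X n) x) \<longlonglongrightarrow> 0"
    by (simp add: dist_norm norm_unitization_def x)
  then show "convergent X" unfolding convergent_def using tendsto_dist_iff by blast
qed

end

text \<open>Meaningful only for complex-linear f; elsewhere the value of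
  \<open>Abs_unitization\<close> is unspecified.\<close>

definition embed_op :: "('a::{complex_normed_vector, banach} \<Rightarrow>\<^sub>L 'a) \<Rightarrow> 'a unitization"
  where "embed_op f = Abs_unitization (f, 0)"

lemma embed_op_parts:
  assumes "complex_linear_op f"
  shows "op_part (embed_op f) = f" "scalar_part (embed_op f) = 0"
  using assms by (simp_all add: embed_op_def op_part_def scalar_part_def Abs_unitization_inverse)

lemma embed_op_op_part: "scalar_part x = 0 \<Longrightarrow> embed_op (op_part x) = x"
  by (rule unitization_eqI) (simp_all add: embed_op_parts)

lemma embed_op_simps:
  assumes "complex_linear_op f" "complex_linear_op g"
  shows "embed_op (f + g) = embed_op f + embed_op g" "embed_op (f - g) = embed_op f - embed_op g"
    "embed_op (f o\<^sub>L g) = embed_op f * embed_op g"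
  by (rule unitization_eqI; use assms in \<open>simp add: embed_op_parts complex_linear_op_add
      complex_linear_op_diff complex_linear_op_compose\<close>)+

lemma embed_op_zero [simp]: "embed_op 0 = 0"
  by (rule unitization_eqI) (simp_all add: embed_op_parts)

lemma embed_op_scaleC:
  assumes "complex_linear_op f" shows "embed_op (c *\<^sub>C f) = c *\<^sub>C embed_op f"
  by (rule unitization_eqI; use assms in \<open>simp add: embed_op_parts complex_linear_op_scaleC\<close>)

lemma norm_embed_op: "complex_linear_op f \<Longrightarrow> norm (embed_op f) = norm f"
  by (simp add: norm_unitization_def embed_op_parts)

lemma norm_op_part_le: "norm (op_part x) \<le> norm x"
  by (simp add: norm_unitization_def)

text \<open>An operator inverse of z - f yields an inverse in the unitization. The value z = 0 is
  excluded because an element with scalar part 0 is never invertible there.\<close>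

lemma embed_op_spectrum:
  fixes f :: "'a::{complex_normed_vector, banach} \<Rightarrow>\<^sub>L 'a"
  assumes f: "complex_linear_op f" and z: "z \<noteq> 0" and "\<not> is_unit_elem (embed_op f - z *\<^sub>C 1)"
  shows "z \<in> op_spectrum f"
proof (rule ccontr)
  assume "z \<notin> op_spectrum f"
  then obtain g where g: "complex_linear_op g" "g o\<^sub>L (z *\<^sub>C id_blinfun - f) = id_blinfun"
      "(z *\<^sub>C id_blinfun - f) o\<^sub>L g = id_blinfun"
    unfolding op_spectrum_def by blast
  \<comment> \<open>Acting as an operator this is - g; the splitting provides the scalar part - 1 /
    z that an inverse of f - z must have.\<close>
  define y where "y = embed_op (inverse z *\<^sub>C id_blinfun - g) - inverse z *\<^sub>C 1"
  have lin: "complex_linear_op (inverse z *\<^sub>C id_blinfun - g)"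
    using g(1) by (intro complex_linear_op_diff complex_linear_op_scaleC complex_linear_op_id)
  have y: "op_part y = inverse z *\<^sub>C id_blinfun - g" "scalar_part y = - inverse z"
    using lin by (simp_all add: y_def embed_op_parts)
  have id_comp: "id_blinfun o\<^sub>L h = h" "h o\<^sub>L id_blinfun = h" for h :: "'a \<Rightarrow>\<^sub>L 'a"
    by (rule blinfun_eqI, simp)+
  have gf: "g o\<^sub>L f = z *\<^sub>C g - id_blinfun" "f o\<^sub>L g = z *\<^sub>C g - id_blinfun"
    using g(2,3) by (simp_all add: blinfun_compose_diff_left blinfun_compose_diff_right
        blinfun_compose_scaleC_left blinfun_compose_scaleC_right[OF g(1)] id_comp algebra_simps)
  have "(embed_op f - z *\<^sub>C 1) * y = 1" "y * (embed_op f - z *\<^sub>C 1) = 1"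
    using z by (auto intro!: unitization_eqI simp: y embed_op_parts[OF f] gf
        blinfun_compose_diff_left blinfun_compose_diff_right blinfun_compose_scaleC_left
        blinfun_compose_scaleC_right[OF f] id_comp scaleC_diff_right scaleC_scaleC)
  with assms(3) show False unfolding is_unit_elem_def by blast
qed

lemma norm_le_spectral_radius:
  assumes "complex_linear_op f" "\<not> is_unit_elem (embed_op f - z *\<^sub>C 1)"
  shows "ennreal (norm z) \<le> spectral_radius f"
proof (cases "z = 0")
  case False
  have "z \<in> op_spectrum f" by (rule embed_op_spectrum[OF assms(1) False assms(2)])
  then show ?thesis unfolding spectral_radius_def by (rule SUP_upper)
qed simp

section \<open>The algebra generated by a semigroup\<close>

lemma closed_op_subalgebra_Inter:
  assumes "\<And>B. B \<in> \<B> \<Longrightarrow> closed_op_subalgebra B"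
  shows "closed_op_subalgebra (\<Inter>\<B>)"
  unfolding closed_op_subalgebra_def
proof (intro conjI ballI allI)
  show "closed (\<Inter>\<B>)" using assms by (intro closed_Inter) (auto simp: closed_op_subalgebra_def)
qed (use assms in \<open>auto simp: closed_op_subalgebra_def\<close>)

lemma closed_op_subalgebra_hull: "closed_op_subalgebra (closed_op_subalgebra hull S)"
  by (rule hull_in) (blast intro: closed_op_subalgebra_Inter)

lemma tendsto_embed_op:
  assumes "\<And>n. complex_linear_op (f n)" "complex_linear_op g" "(f \<longlongrightarrow> g) F"
  shows "((\<lambda>n. embed_op (f n)) \<longlongrightarrow> embed_op g) F"
proof -
  have "((\<lambda>n. norm (f n - g)) \<longlongrightarrow> 0) F"
    using assms(3) by (intro tendsto_norm_zero) (simp add: LIM_zero_iff)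
  then have "((\<lambda>n. dist (embed_op (f n)) (embed_op g)) \<longlongrightarrow> 0) F"
    using assms(1,2)
    by (simp add: dist_norm norm_embed_op complex_linear_op_diff flip: embed_op_simps)
  then show ?thesis by (subst tendsto_dist_iff)
qed

locale sector_semigroup =
  fixes \<alpha> :: real and T :: "complex \<Rightarrow> 'a::{complex_normed_vector, banach} \<Rightarrow>\<^sub>L 'a"
  assumes angle: "0 < \<alpha>" "\<alpha> < pi / 2" and semigroup: "analytic_semigroup \<alpha> T"
begin

abbreviation S where "S \<equiv> sector \<alpha>"

lemma S_iff: "z \<in> S \<longleftrightarrow> 0 < Re z \<and> \<bar>Im z\<bar> < tan \<alpha> * Re z"
  by (rule sector_iff[OF angle])

lemma S_eq: "S = {z. 0 < Re z \<and> \<bar>Im z\<bar> < tan \<alpha> * Re z}"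
  using S_iff by blast

lemma tan_pos: "0 < tan \<alpha>"
  using angle by (rule tan_gt_zero)

lemma S_open: "open S"
  unfolding S_eq by (intro open_Collect_conj open_Collect_less continuous_intros)

lemma S_add: "s \<in> S \<Longrightarrow> t \<in> S \<Longrightarrow> s + t \<in> S"
  by (auto simp: S_iff distrib_left)

lemma S_scale: "s \<in> S \<Longrightarrow> 0 < r \<Longrightarrow> complex_of_real r * s \<in> S"
  by (auto simp: S_iff abs_mult mult.left_commute)

lemma S_of_real: "0 < r \<Longrightarrow> complex_of_real r \<in> S"
  using tan_pos by (simp add: S_iff)

lemma S_convex: "convex S"
proof (rule convexI)
  fix x y :: complex and u v :: real
  assume xy: "x \<in> S" "y \<in> S" and uv: "0 \<le> u" "0 \<le> v" "u + v = 1"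
  show "u *\<^sub>R x + v *\<^sub>R y \<in> S"
  proof (cases "u = 0 \<or> v = 0")
    case True
    with xy uv show ?thesis by auto
  next
    case False
    with uv have "0 < u" "0 < v" by auto
    then show ?thesis
      using S_add[OF S_scale[OF xy(1)] S_scale[OF xy(2)]] by (simp add: scaleR_conv_of_real)
  qed
qed

section \<open>The generated algebra inside a commutative inverse-closed algebra\<close>

definition alg :: "('a \<Rightarrow>\<^sub>L 'a) set"
  where "alg = closed_op_subalgebra hull (T ` S)"

lemma alg_subalgebra: "closed_op_subalgebra alg"
  unfolding alg_def by (rule closed_op_subalgebra_hull)

lemma alg_closed: "closed alg"
  and alg_zero: "0 \<in> alg"
  and alg_add: "f \<in> alg \<Longrightarrow> g \<in> alg \<Longrightarrow> f + g \<in> alg"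
  and alg_scaleC: "f \<in> alg \<Longrightarrow> c *\<^sub>C f \<in> alg"
  and alg_compose: "f \<in> alg \<Longrightarrow> g \<in> alg \<Longrightarrow> f o\<^sub>L g \<in> alg"
  using alg_subalgebra unfolding closed_op_subalgebra_def by auto

lemma alg_diff: "f \<in> alg \<Longrightarrow> g \<in> alg \<Longrightarrow> f - g \<in> alg"
  using alg_add[of f "(-1) *\<^sub>C g"] alg_scaleC[of g "-1"] by (simp add: scaleC_one)

lemma T_alg: "t \<in> S \<Longrightarrow> T t \<in> alg"
  unfolding alg_def using hull_subset[of "T ` S"] by blast

lemma alg_subset: "closed_op_subalgebra B \<Longrightarrow> T ` S \<subseteq> B \<Longrightarrow> alg \<subseteq> B"
  unfolding alg_def by (rule hull_minimal)

lemma T_linear: "t \<in> S \<Longrightarrow> complex_linear_op (T t)"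
  using semigroup by (simp add: analytic_semigroup_def)

lemma T_add: "s \<in> S \<Longrightarrow> t \<in> S \<Longrightarrow> T (s + t) = T s o\<^sub>L T t"
  using semigroup by (simp add: analytic_semigroup_def)

lemma alg_linear: "f \<in> alg \<Longrightarrow> complex_linear_op f"
proof -
  have "alg \<subseteq> {f. complex_linear_op f}"
  proof (rule alg_subset)
    show "closed_op_subalgebra {f :: 'a \<Rightarrow>\<^sub>L 'a. complex_linear_op f}"
      using closed_complex_linear_op by (auto simp: closed_op_subalgebra_def)
  qed (use T_linear in auto)
  then show "f \<in> alg \<Longrightarrow> complex_linear_op f" by blast
qed

text \<open>The bicommutant is preferred to the generated algebra with an identity adjoined, which
  may lack inverses existing among all operators; its characters would not be tied to the operator
  spectrum.\<close>

definition C :: "'a unitization set"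
  where "C = commutant (commutant ((\<lambda>t. embed_op (T t)) ` S))"

lemma C_inverse_closed: "inverse_closed_subalgebra C"
  unfolding C_def
proof (rule bicommutant_inverse_closed_subalgebra)
  fix x y assume "x \<in> (\<lambda>t. embed_op (T t)) ` S" "y \<in> (\<lambda>t. embed_op (T t)) ` S"
  then obtain s t where st: "s \<in> S" "t \<in> S" "x = embed_op (T s)" "y = embed_op (T t)" by blast
  then have "T s o\<^sub>L T t = T t o\<^sub>L T s" using T_add by (metis add.commute)
  with st show "x * y = y * x" by (metis T_linear embed_op_simps(3))
qed

sublocale C: inverse_closed_subalgebra C
  by (rule C_inverse_closed)

lemma closed_C: "closed C"
  unfolding C_def by (rule closed_commutant)

text \<open>Results must belong to the generated algebra, not merely to C; \<open>ealg\<close> is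
  its copy in C and contains no nonzero multiple of the adjoined 1.\<close>

definition ealg :: "'a unitization set" where "ealg = embed_op ` alg"

lemma embed_ealg: "f \<in> alg \<Longrightarrow> embed_op f \<in> ealg"
  by (simp add: ealg_def)

lemma ealg_parts: "x \<in> ealg \<longleftrightarrow> op_part x \<in> alg \<and> scalar_part x = 0"
proof
  assume "x \<in> ealg"
  then show "op_part x \<in> alg \<and> scalar_part x = 0"
    using alg_linear by (auto simp: ealg_def embed_op_parts)
next
  assume "op_part x \<in> alg \<and> scalar_part x = 0"
  then show "x \<in> ealg" using embed_op_op_part[of x] unfolding ealg_def by force
qed

lemma ealg_zero: "0 \<in> ealg"
  and ealg_add: "x \<in> ealg \<Longrightarrow> y \<in> ealg \<Longrightarrow> x + y \<in> ealg"
  and ealg_diff: "x \<in> ealg \<Longrightarrow> y \<in> ealg \<Longrightarrow> x - y \<in> ealg"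
  and ealg_mult: "x \<in> ealg \<Longrightarrow> y \<in> ealg \<Longrightarrow> x * y \<in> ealg"
  and ealg_scaleC: "x \<in> ealg \<Longrightarrow> c *\<^sub>C x \<in> ealg"
  by (simp_all add: ealg_parts alg_zero alg_add alg_diff alg_compose alg_scaleC)

lemma ealg_power: "x \<in> ealg \<Longrightarrow> x ^ Suc n \<in> ealg"
  by (induction n) (auto intro: ealg_mult)

lemma ealg_sum: "(\<And>i. i \<in> I \<Longrightarrow> f i \<in> ealg) \<Longrightarrow> sum f I \<in> ealg"
  by (induction I rule: infinite_finite_induct) (auto intro: ealg_zero ealg_add)

lemma closed_ealg: "closed ealg"
  unfolding closed_sequential_limits
proof (intro allI impI, elim conjE)
  fix X x assume X: "\<forall>n. X n \<in> ealg" "X \<longlonglongrightarrow> x"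
  have *: "(\<lambda>n. h (X n)) \<longlonglongrightarrow> h x" if "\<And>u v. norm (h u - h v) \<le> norm (u - v)"
    for h :: "'a unitization \<Rightarrow> 'b::real_normed_vector"
  proof (rule Lim_null[THEN iffD2])
    have "(\<lambda>n. norm (X n - x)) \<longlonglongrightarrow> 0" using X(2) by (intro tendsto_norm_zero) (simp add: LIM_zero_iff)
    then show "(\<lambda>n. h (X n) - h x) \<longlonglongrightarrow> 0"
      by (rule Lim_null_comparison[rotated]) (use that in simp)
  qed
  have "(\<lambda>n. op_part (X n)) \<longlonglongrightarrow> op_part x" "(\<lambda>n. scalar_part (X n)) \<longlonglongrightarrow> scalar_part x"
    by (rule *, simp add: norm_unitization_def)+
  moreover have "op_part (X n) \<in> alg" "scalar_part (X n) = 0" for n using X(1) by (auto simp: ealg_parts)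
  ultimately have "op_part x \<in> alg" "scalar_part x = 0"
    using closed_sequentially[OF alg_closed, of "\<lambda>n. op_part (X n)"] by (auto simp: LIMSEQ_const_iff)
  then show "x \<in> ealg" by (simp add: ealg_parts)
qed

lemma ealg_subset_C: "ealg \<subseteq> C"
proof -
  have "alg \<subseteq> {f. complex_linear_op f \<and> embed_op f \<in> C}"
  proof (rule alg_subset)
    show "closed_op_subalgebra {f. complex_linear_op f \<and> embed_op f \<in> C}"
      unfolding closed_op_subalgebra_def
    proof (intro conjI ballI allI)
      show "closed {f. complex_linear_op f \<and> embed_op f \<in> C}"
        unfolding closed_sequential_limits
      proof (intro allI impI, elim conjE)
        fix X f assume X: "\<forall>n. X n \<in> {f. complex_linear_op f \<and> embed_op f \<in> C}" "X \<longlonglongrightarrow> f"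
        have lin: "complex_linear_op f"
          using closed_sequentially[OF closed_complex_linear_op _ X(2)] X(1) by simp
        have lim: "(\<lambda>n. embed_op (X n)) \<longlonglongrightarrow> embed_op f"
          by (rule tendsto_embed_op) (use X lin in auto)
        have "embed_op f \<in> C"
          by (rule closed_sequentially[OF closed_C _ lim]) (use X(1) in simp)
        with lin show "f \<in> {f. complex_linear_op f \<and> embed_op f \<in> C}" by simp
      qed
    qed (auto simp: embed_op_simps embed_op_scaleC intro: C.closed_rules)
    show "T ` S \<subseteq> {f. complex_linear_op f \<and> embed_op f \<in> C}"
      using T_linear subset_bicommutant[of "(\<lambda>t. embed_op (T t)) ` S"] by (auto simp: C_def)
  qed
  then show ?thesis by (auto simp: ealg_def)
qed

lemma ealg_C: "x \<in> ealg \<Longrightarrow> x \<in> C"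
  using ealg_subset_C by blast

lemma embed_C: "f \<in> alg \<Longrightarrow> embed_op f \<in> C"
  using embed_ealg ealg_subset_C by blast

lemma alg_commute: "f \<in> alg \<Longrightarrow> g \<in> alg \<Longrightarrow> f o\<^sub>L g = g o\<^sub>L f"
  using C.commute[OF embed_C embed_C, of f g] alg_linear embed_op_simps(3)
  by (metis complex_linear_op_compose embed_op_parts(1))

section \<open>Characters and power series on the generated algebra\<close>

abbreviation chars where "chars \<equiv> {\<psi>. character_on C \<psi>}"

lemma char_simps:
  assumes "\<psi> \<in> chars" "x \<in> C" "y \<in> C"
  shows "\<psi> (x + y) = \<psi> x + \<psi> y" "\<psi> (x - y) = \<psi> x - \<psi> y" "\<psi> (x * y) = \<psi> x * \<psi> y"
proof -
  show "\<psi> (x + y) = \<psi> x + \<psi> y" "\<psi> (x * y) = \<psi> x * \<psi> y"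
    using assms by (auto simp: character_on_def)
  have "\<psi> (x + (-1) *\<^sub>C y) = \<psi> x + \<psi> ((-1) *\<^sub>C y)"
    using assms C.scaleC[OF assms(3), of "-1"] unfolding character_on_def by blast
  also have "\<psi> ((-1) *\<^sub>C y) = - 1 * \<psi> y"
    using assms unfolding character_on_def by blast
  finally show "\<psi> (x - y) = \<psi> x - \<psi> y" by simp
qed

lemma char_scaleC: "\<psi> \<in> chars \<Longrightarrow> x \<in> C \<Longrightarrow> \<psi> (c *\<^sub>C x) = c * \<psi> x"
  by (simp add: character_on_def)

lemma char_one: "\<psi> \<in> chars \<Longrightarrow> \<psi> 1 = 1"
  by (simp add: character_on_def)

lemma char_zero: "\<psi> \<in> chars \<Longrightarrow> \<psi> 0 = 0"
  using char_simps(2)[of \<psi> 0 0] C.zero by simp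

lemma char_sum: "\<psi> \<in> chars \<Longrightarrow> (\<And>i. i \<in> I \<Longrightarrow> f i \<in> C) \<Longrightarrow> \<psi> (sum f I) = (\<Sum>i\<in>I. \<psi> (f i))"
  by (induction I rule: infinite_finite_induct) (auto simp: char_zero char_simps C.sum)

lemma char_power: "\<psi> \<in> chars \<Longrightarrow> x \<in> C \<Longrightarrow> \<psi> (x ^ n) = \<psi> x ^ n"
  by (induction n) (auto simp: char_one char_simps C.power)

lemma char_le: "\<psi> \<in> chars \<Longrightarrow> x \<in> C \<Longrightarrow> norm (\<psi> x) \<le> norm x"
  using C.norm_character_le by simp

lemma char_tendsto:
  assumes \<psi>: "\<psi> \<in> chars" and X: "\<And>n. X n \<in> C" "x \<in> C" "(X \<longlongrightarrow> x) F"
  shows "((\<lambda>n. \<psi> (X n)) \<longlongrightarrow> \<psi> x) F"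
proof (rule Lim_null[THEN iffD2])
  have "((\<lambda>n. norm (X n - x)) \<longlongrightarrow> 0) F" using X(3) by (intro tendsto_norm_zero) (simp add: LIM_zero_iff)
  then show "((\<lambda>n. \<psi> (X n) - \<psi> x) \<longlongrightarrow> 0) F"
    using char_le[OF \<psi> C.diff[OF X(1,2)]] char_simps(2)[OF \<psi> X(1,2)]
    by (intro Lim_null_comparison[of "\<lambda>n. \<psi> (X n) - \<psi> x" "\<lambda>n. norm (X n - x)"]) simp_all
qed

text \<open>The series starts at exponent 1, since a constant term would leave
  \<open>ealg\<close>.\<close>

lemma ealg_series:
  assumes v: "v \<in> ealg" and sm: "summable (\<lambda>n. norm (c n *\<^sub>C v ^ Suc n))"
  shows "(\<Sum>n. c n *\<^sub>C v ^ Suc n) \<in> ealg"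
    and "\<psi> \<in> chars \<Longrightarrow> (\<lambda>n. c n * \<psi> v ^ Suc n) sums \<psi> (\<Sum>n. c n *\<^sub>C v ^ Suc n)"
proof -
  have mem: "c n *\<^sub>C v ^ Suc n \<in> ealg" for n by (intro ealg_scaleC ealg_power v)
  have lim: "(\<lambda>N. \<Sum>n<N. c n *\<^sub>C v ^ Suc n) \<longlonglongrightarrow> (\<Sum>n. c n *\<^sub>C v ^ Suc n)"
    by (rule summable_LIMSEQ[OF summable_norm_cancel[OF sm]])
  show *: "(\<Sum>n. c n *\<^sub>C v ^ Suc n) \<in> ealg"
    by (rule closed_sequentially[OF closed_ealg _ lim]) (intro ealg_sum mem)
  assume \<psi>: "\<psi> \<in> chars"
  have "\<psi> (\<Sum>n<N. c n *\<^sub>C v ^ Suc n) = (\<Sum>n<N. c n * \<psi> v ^ Suc n)" for N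
    using mem ealg_C[OF v] \<psi>
    by (simp add: char_sum ealg_C char_scaleC char_power C.closed_rules del: power_Suc)
  then show "(\<lambda>n. c n * \<psi> v ^ Suc n) sums \<psi> (\<Sum>n. c n *\<^sub>C v ^ Suc n)"
    using char_tendsto[OF \<psi> _ ealg_C[OF *] lim] mem unfolding sums_def
    by (simp add: C.sum ealg_C del: power_Suc)
qed

text \<open>Norm convergence is obtained from the character values alone: they bound the growth of
  \<open>norm (v ^ n)\<close>.\<close>

lemma summable_ealg_series:
  assumes v: "v \<in> ealg" and r: "0 \<le> r" "r < R" and c: "summable (\<lambda>n. norm (c n) * R ^ Suc n)"
    and le: "\<And>\<psi>. \<psi> \<in> chars \<Longrightarrow> norm (\<psi> v) \<le> r"
  shows "summable (\<lambda>n. norm (c n *\<^sub>C v ^ Suc n))"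
proof -
  obtain K where K: "\<And>n. norm (v ^ n) \<le> K * R ^ n"
    using C.norm_power_bound[OF ealg_C[OF v] r] le by auto
  show ?thesis
  proof (rule summable_comparison_test'[of "\<lambda>n. K * (norm (c n) * R ^ Suc n)"])
    show "summable (\<lambda>n. K * (norm (c n) * R ^ Suc n))" by (intro summable_mult c)
    show "norm (norm (c n *\<^sub>C v ^ Suc n)) \<le> K * (norm (c n) * R ^ Suc n)" for n
      using mult_left_mono[OF K[of "Suc n"] norm_ge_zero[of "c n"]]
      by (simp add: norm_scaleC mult.left_commute del: power_Suc)
  qed
qed

section \<open>The derivative of the semigroup and the form of its characters\<close>

definition D :: "complex \<Rightarrow> 'a \<Rightarrow>\<^sub>L 'a"
  where "D t = (SOME d. (T has_derivative (\<lambda>h. h *\<^sub>C d)) (at t))"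

lemma T_has_derivative: "t \<in> S \<Longrightarrow> (T has_derivative (\<lambda>h. h *\<^sub>C D t)) (at t)"
  using semigroup unfolding analytic_semigroup_def D_def by (metis someI_ex)

lemma eventually_S: "t \<in> S \<Longrightarrow> \<forall>\<^sub>F h in at 0. t + h \<in> S"
proof -
  assume t: "t \<in> S"
  have "((\<lambda>h. t + h) \<longlongrightarrow> t + 0) (at 0)" by (intro tendsto_intros)
  then show ?thesis using topological_tendstoD[OF _ S_open, of "\<lambda>h. t + h"] t by simp
qed

text \<open>\<open>D t\<close> stands for the generator, possibly unbounded, times
  \<open>T t\<close>. As a limit of difference quotients it stays in the closed algebra.\<close>

lemma D_alg:
  assumes t: "t \<in> S" shows "D t \<in> alg"
proof -
  define h where "h n = complex_of_real (1 / real (Suc n))" for n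
  have h0: "h \<longlonglongrightarrow> 0" "h n \<noteq> 0" for n
  proof -
    have "(\<lambda>n. 1 / real (Suc n)) \<longlonglongrightarrow> 0"
      using LIMSEQ_inverse_real_of_nat by (simp add: inverse_eq_divide)
    then show "h \<longlonglongrightarrow> 0" unfolding h_def[abs_def] by (metis of_real_0 tendsto_of_real)
    show "h n \<noteq> 0" unfolding h_def of_real_eq_0_iff by simp
  qed
  have th: "t + h n \<in> S" for n
    unfolding h_def by (intro S_add t S_of_real) simp
  define X where "X n = inverse (h n) *\<^sub>C (T (t + h n) - T t)" for n
  have lim: "(\<lambda>k. norm (T (t + k) - T t - k *\<^sub>C D t) / norm k) \<midarrow>0\<rightarrow> 0"
    using T_has_derivative[OF t] by (simp add: has_derivative_at)
  have "filterlim h (at 0) sequentially" using h0 by (simp add: filterlim_at)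
  then have "(\<lambda>n. norm (T (t + h n) - T t - h n *\<^sub>C D t) / norm (h n)) \<longlonglongrightarrow> 0"
    by (rule filterlim_compose[OF lim])
  moreover have "norm (T (t + h n) - T t - h n *\<^sub>C D t) / norm (h n) = norm (X n - D t)" for n
  proof -
    have "X n - D t = inverse (h n) *\<^sub>C (T (t + h n) - T t - h n *\<^sub>C D t)"
      using h0(2)[of n] by (simp add: X_def scaleC_diff_right scaleC_scaleC)
    then show ?thesis by (simp add: norm_scaleC norm_inverse divide_inverse mult.commute)
  qed
  ultimately have "(\<lambda>n. norm (X n - D t)) \<longlonglongrightarrow> 0" by simp
  then have "X \<longlonglongrightarrow> D t" by (simp add: tendsto_norm_zero_iff LIM_zero_iff)
  moreover have "X n \<in> alg" for n
    unfolding X_def by (intro alg_scaleC alg_diff T_alg t th)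
  ultimately show ?thesis using closed_sequentially[OF alg_closed] by blast
qed

text \<open>Characters are contractive, so they carry the difference quotient estimate over to
  scalar functions.\<close>

lemma char_T_derivative:
  assumes \<psi>: "\<psi> \<in> chars" and t: "t \<in> S"
  shows "((\<lambda>t. \<psi> (embed_op (T t))) has_field_derivative \<psi> (embed_op (D t))) (at t)"
proof -
  let ?\<theta> = "\<lambda>t. \<psi> (embed_op (T t))"
  have lim: "(\<lambda>h. norm (T (t + h) - T t - h *\<^sub>C D t) / norm h) \<midarrow>0\<rightarrow> 0"
    using T_has_derivative[OF t] by (simp add: has_derivative_at)
  have le: "\<forall>\<^sub>F h in at 0. norm (?\<theta> (t + h) - ?\<theta> t - \<psi> (embed_op (D t)) * h) / norm h
      \<le> norm (T (t + h) - T t - h *\<^sub>C D t) / norm h"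
    using eventually_S[OF t]
  proof eventually_elim
    case (elim h)
    note mem = T_alg[OF elim] T_alg[OF t] D_alg[OF t] alg_scaleC[OF D_alg[OF t], of h]
    have mem': "T (t + h) - T t \<in> alg" "T (t + h) - T t - h *\<^sub>C D t \<in> alg" by (intro alg_diff mem)+
    have "embed_op (T (t + h) - T t - h *\<^sub>C D t) = embed_op (T (t + h)) - embed_op (T t) - h *\<^sub>C embed_op (D t)"
      using mem mem' by (simp add: embed_op_simps embed_op_scaleC alg_linear)
    then have "\<psi> (embed_op (T (t + h) - T t - h *\<^sub>C D t)) = ?\<theta> (t + h) - ?\<theta> t - \<psi> (embed_op (D t)) * h"
      using mem \<psi> by (simp add: char_simps char_scaleC embed_C C.closed_rules)
    then have "norm (?\<theta> (t + h) - ?\<theta> t - \<psi> (embed_op (D t)) * h) \<le> norm (T (t + h) - T t - h *\<^sub>C D t)"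
      using char_le[OF \<psi> embed_C[OF mem'(2)]] norm_embed_op[OF alg_linear[OF mem'(2)]] by simp
    then show ?case by (rule divide_right_mono) simp
  qed
  have "(\<lambda>h. norm (?\<theta> (t + h) - ?\<theta> t - \<psi> (embed_op (D t)) * h) / norm h) \<midarrow>0\<rightarrow> 0"
    by (rule tendsto_sandwich[OF _ le tendsto_const lim]) simp
  then show ?thesis
    unfolding has_field_derivative_def has_derivative_at by (simp add: bounded_linear_mult_right)
qed

lemma char_semigroup:
  assumes \<psi>: "\<psi> \<in> chars"
  shows "(\<forall>f\<in>alg. \<psi> (embed_op f) = 0) \<or>
    (\<exists>z. \<forall>t\<in>S. \<psi> (embed_op (T t)) = exp (- t * z) \<and> \<psi> (embed_op (D t)) = - z * exp (- t * z))"
proof (cases "\<forall>t\<in>S. \<psi> (embed_op (T t)) = 0")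
  case True
  \<comment> \<open>By continuity of \<psi> its null space in \<open>alg\<close> is a closed
    subalgebra; it contains the semigroup, hence everything.\<close>
  have "alg \<subseteq> {f \<in> alg. \<psi> (embed_op f) = 0}"
  proof (rule alg_subset)
    show "closed_op_subalgebra {f \<in> alg. \<psi> (embed_op f) = 0}"
      unfolding closed_op_subalgebra_def
    proof (intro conjI ballI allI)
      show "closed {f \<in> alg. \<psi> (embed_op f) = 0}"
        unfolding closed_sequential_limits
      proof (intro allI impI, elim conjE)
        fix X f assume X: "\<forall>n. X n \<in> {f \<in> alg. \<psi> (embed_op f) = 0}" "X \<longlonglongrightarrow> f"
        have f: "f \<in> alg" by (rule closed_sequentially[OF alg_closed _ X(2)]) (use X(1) in simp)
        have "(\<lambda>n. embed_op (X n)) \<longlonglongrightarrow> embed_op f"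
          by (rule tendsto_embed_op) (use X f alg_linear in auto)
        then have "(\<lambda>n. \<psi> (embed_op (X n))) \<longlonglongrightarrow> \<psi> (embed_op f)"
          by (intro char_tendsto[OF \<psi>] embed_C f) (use X(1) in auto)
        with X(1) f show "f \<in> {f \<in> alg. \<psi> (embed_op f) = 0}" by (simp add: LIMSEQ_const_iff)
      qed
    qed (use \<psi> in \<open>auto simp: embed_op_simps embed_op_scaleC alg_linear char_simps char_scaleC embed_C char_zero
        intro: alg_zero alg_add alg_scaleC alg_compose\<close>)
  qed (use True T_alg in auto)
  then show ?thesis by blast
next
  case False
  define \<theta> where "\<theta> t = \<psi> (embed_op (T t))" for t
  define \<theta>' where "\<theta>' t = \<psi> (embed_op (D t))" for t
  have der: "(\<theta> has_field_derivative \<theta>' t) (at t)" if "t \<in> S" for t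
    unfolding \<theta>_def[abs_def] \<theta>'_def by (rule char_T_derivative[OF \<psi> that])
  have add: "\<theta> (s + t) = \<theta> s * \<theta> t" if "s \<in> S" "t \<in> S" for s t
    using that \<psi> by (simp add: \<theta>_def T_add embed_op_simps T_linear char_simps embed_C T_alg)
  have der_add: "\<theta>' (s + t) = \<theta>' s * \<theta> t" if st: "s \<in> S" "t \<in> S" for s t
  proof -
    have "((\<lambda>x. \<theta> (x + t)) has_field_derivative \<theta>' (s + t)) (at s)"
      using der[OF S_add[OF st]] by (simp add: DERIV_shift)
    moreover have "((\<lambda>x. \<theta> (x + t)) has_field_derivative \<theta>' s * \<theta> t) (at s)"
      by (rule has_field_derivative_transform_within_open[OF DERIV_cmult_right[OF der[OF st(1)]] S_open st(1)])
         (use add st(2) in simp)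
    ultimately show ?thesis by (rule DERIV_unique)
  qed
  obtain t1 where t1: "t1 \<in> S" "\<theta> t1 \<noteq> 0" using False by (auto simp: \<theta>_def)
  define c where "c = \<theta>' t1 / \<theta> t1"
  \<comment> \<open>Differentiating \<theta>(s + t1) in either variable gives \<theta>' s \<theta>
    t1 = \<theta>' t1 \<theta> s, a linear differential equation with constant c; the exponent is z
    = - c.\<close>
  have \<theta>': "\<theta>' s = c * \<theta> s" if s: "s \<in> S" for s
    using der_add[OF s t1(1)] der_add[OF t1(1) s] t1(2) by (simp add: c_def field_simps)
  have "((\<lambda>s. \<theta> s * exp (- c * s)) has_field_derivative 0) (at s)" if s: "s \<in> S" for s
    by (rule derivative_eq_intros der s refl)+ (simp add: \<theta>'[OF s])
  then have "\<exists>\<kappa>. \<forall>s\<in>S. \<theta> s * exp (- c * s) = \<kappa>"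
    by (intro has_field_derivative_zero_constant S_convex) (blast intro: has_field_derivative_at_within)
  then obtain \<kappa> where "\<And>s. s \<in> S \<Longrightarrow> \<theta> s * exp (- c * s) = \<kappa>" by blast
  then have \<kappa>: "\<theta> s = \<kappa> * exp (c * s)" if "s \<in> S" for s
    using that by (simp add: exp_minus field_simps)
  \<comment> \<open>After cancelling exponentials the semigroup law at t1 + t1 reads \<kappa> =
    \<kappa>^2, and \<kappa> is not 0.\<close>
  have "\<kappa> * exp (c * (t1 + t1)) = \<kappa> * exp (c * t1) * (\<kappa> * exp (c * t1))"
    using add[OF t1(1) t1(1)] by (simp only: \<kappa>[OF t1(1)] \<kappa>[OF S_add[OF t1(1) t1(1)]])
  moreover have "exp (c * (t1 + t1)) = exp (c * t1) * exp (c * t1)"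
    by (simp only: distrib_left exp_add)
  moreover have "\<kappa> \<noteq> 0" using t1(2) \<kappa>[OF t1(1)] by auto
  ultimately have "\<kappa> = 1" by simp
  then have "\<forall>t\<in>S. \<theta> t = exp (- t * (- c)) \<and> \<theta>' t = - (- c) * exp (- t * (- c))"
    using \<kappa> \<theta>' by (simp add: mult.commute)
  then show ?thesis unfolding \<theta>_def \<theta>'_def by blast
qed

end

section \<open>The quotient by the radical\<close>

text \<open>Re y > 0 keeps the argument of y inside (- pi / 2, pi / 2), so doubling it does not
  cross the branch cut of the principal power.\<close>

lemma powr_minus_half_square:
  fixes y :: complex
  assumes "0 < Re y"
  shows "(y * y) powr (- 1 / 2) = 1 / y"
proof -
  have y: "y \<noteq> 0" using assms by auto
  have "\<bar>Im (Ln y)\<bar> < pi / 2" using assms by (rule Re_Ln_pos_lt_imp)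
  then have "Ln (y * y) = Ln y + Ln y" using y by (intro Ln_times_simple) auto
  then have "(y * y) powr (- 1 / 2) = exp (- Ln y)" using y by (simp add: powr_def)
  also have "\<dots> = 1 / y" using y by (simp add: exp_minus inverse_eq_divide)
  finally show ?thesis .
qed

context sector_semigroup
begin

abbreviation \<A> where "\<A> \<equiv> generated_alg (T ` S)"
abbreviation \<R> where "\<R> \<equiv> jacobson_radical \<A>"
abbreviation \<Q> where "\<Q> \<equiv> quotient_alg \<A> \<R>"

lemma gen_simps:
  "acarrier \<A> = alg" "azero \<A> = 0" "aplus \<A> f g = f + g" "ascale \<A> c f = c *\<^sub>C f"
  "atimes \<A> f g = f o\<^sub>L g" "anorm \<A> f = norm f" "aminus \<A> f g = f - g"
  by (simp_all add: generated_alg_def alg_def aminus_def)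

text \<open>
  An element \<open>d\<close> on which all characters vanish is quasinilpotent, so every \<open>y\<close> has the form
  \<open>x - x d\<close>. If \<open>a\<close> is outside a maximal modular ideal \<open>I\<close> with modular unit \<open>u\<close>, some such \<open>d\<close> in
  the ideal generated by \<open>a\<close> is congruent to \<open>u\<close> modulo \<open>I\<close>, whence \<open>y = x - x d \<in> I\<close> for all \<open>y\<close>.
\<close>

lemma quasi_inverse:
  assumes d: "d \<in> alg" "\<And>\<psi>. \<psi> \<in> chars \<Longrightarrow> \<psi> (embed_op d) = 0" and y: "y \<in> alg"
  shows "\<exists>x\<in>alg. x - (x o\<^sub>L d) = y"
proof -
  define e where "e = embed_op d"
  have e: "e \<in> ealg" using d(1) by (simp add: e_def embed_ealg)
  \<comment> \<open>All characters vanish on e, so any positive radius is admissible; 1/2 makes the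
    Neumann series of e converge in norm.\<close>
  have "summable (\<lambda>n. norm (1::complex) * (1/2) ^ Suc n)"
    using summable_geometric[of "1/2::real"] by (simp add: summable_mult)
  then have sm: "summable (\<lambda>n. norm (1 *\<^sub>C e ^ Suc n))"
    using d(2) by (intro summable_ealg_series[OF e, of 0 "1/2"]) (auto simp: e_def)
  define q where "q = (\<Sum>n. e ^ Suc n)"
  have q: "q \<in> ealg" using ealg_series(1)[OF e sm] by (simp add: q_def)
  have sums: "(\<lambda>n. e ^ Suc n) sums q"
    using summable_sums[OF summable_norm_cancel[OF sm]] by (simp add: q_def)
  have "(\<lambda>n. e ^ Suc n * e) sums (q * e)"
    using sums by (rule sums_mult2)
  then have "(\<lambda>n. e ^ Suc (Suc n)) sums (q * e)"
    by (simp only: power_Suc2)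
  then have "(\<lambda>n. e ^ Suc n) sums (q * e + e ^ Suc 0)"
    by (subst (asm) sums_Suc_iff)
  then have qe: "q = q * e + e" using sums sums_unique2 by fastforce
  define Y where "Y = embed_op y"
  have Y: "Y \<in> ealg" using y by (simp add: Y_def embed_ealg)
  \<comment> \<open>This is Y times the inverse of 1 - e, written without the identity.\<close>
  define X where "X = Y + Y * q"
  have X: "X \<in> ealg" unfolding X_def by (intro ealg_add ealg_mult Y q)
  have "X - X * e = Y + Y * (q - q * e - e)" by (simp add: X_def algebra_simps)
  moreover have "q - q * e - e = 0" by (subst (1) qe) simp
  ultimately have XY: "X - X * e = Y" by simp
  have "op_part (X - X * e) = op_part X - (op_part X o\<^sub>L d)"
    using X d(1) by (simp add: ealg_parts e_def embed_op_parts alg_linear)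
  moreover have "op_part Y = y" using y by (simp add: Y_def embed_op_parts alg_linear)
  ultimately show ?thesis using X XY by (intro bexI[of _ "op_part X"]) (auto simp: ealg_parts)
qed

lemma radicalI:
  assumes a: "a \<in> alg" and zero: "\<And>\<psi>. \<psi> \<in> chars \<Longrightarrow> \<psi> (embed_op a) = 0"
  shows "a \<in> \<R>"
proof -
  have "a \<in> I" if mm: "maximal_modular_left_ideal \<A> I" for I
  proof (rule ccontr)
    assume aI: "a \<notin> I"
    note mm' = mm[unfolded maximal_modular_left_ideal_def gen_simps]
    note modular = mm'[THEN conjunct1] and proper = mm'[THEN conjunct2, THEN conjunct1]
      and maximal = mm'[THEN conjunct2, THEN conjunct2]
    from modular obtain u where I: "left_ideal \<A> I" "u \<in> alg" "\<And>x. x \<in> alg \<Longrightarrow> x - (x o\<^sub>L u) \<in> I"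
      unfolding modular_left_ideal_def gen_simps by blast
    have I': "I \<subseteq> alg" "0 \<in> I" "\<And>x y. x \<in> I \<Longrightarrow> y \<in> I \<Longrightarrow> x + y \<in> I"
      "\<And>c x. x \<in> I \<Longrightarrow> c *\<^sub>C x \<in> I" "\<And>x y. x \<in> alg \<Longrightarrow> y \<in> I \<Longrightarrow> x o\<^sub>L y \<in> I"
      using I(1) unfolding left_ideal_def by (auto simp: gen_simps)
    \<comment> \<open>The left ideal generated by I and a. Without an identity, a need not be among
      the products b a, hence the separate multiples of a.\<close>
    define J where "J = {i + ((b o\<^sub>L a) + c *\<^sub>C a) | i b c. i \<in> I \<and> b \<in> alg}"
    have JI: "i + ((b o\<^sub>L a) + c *\<^sub>C a) \<in> J" if "i \<in> I" "b \<in> alg" for i b c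
      unfolding J_def using that by blast
    have JE: "\<exists>i b c. x = i + ((b o\<^sub>L a) + c *\<^sub>C a) \<and> i \<in> I \<and> b \<in> alg" if "x \<in> J" for x
      using that unfolding J_def by blast
    have "left_ideal \<A> J"
      unfolding left_ideal_def gen_simps
    proof (intro conjI ballI allI subsetI)
      show "x \<in> alg" if "x \<in> J" for x
        using JE[OF that] I'(1) a by (auto intro!: alg_add alg_compose alg_scaleC)
      show "0 \<in> J" using JI[OF I'(2) alg_zero, of 0] by (simp add: bounded_bilinear.zero_left[OF bounded_bilinear_blinfun_compose])
      show "x + y \<in> J" if "x \<in> J" "y \<in> J" for x y
      proof -
        obtain i b c j b' c' where x: "x = i + ((b o\<^sub>L a) + c *\<^sub>C a)" "i \<in> I" "b \<in> alg"
          and y: "y = j + ((b' o\<^sub>L a) + c' *\<^sub>C a)" "j \<in> I" "b' \<in> alg" using JE[OF \<open>x \<in> J\<close>] JE[OF \<open>y \<in> J\<close>] by blast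
        have "x + y = (i + j) + (((b + b') o\<^sub>L a) + (c + c') *\<^sub>C a)"
          by (simp add: x(1) y(1) blinfun_compose_add_left scaleC_add_left add_ac)
        then show ?thesis using JI[OF I'(3)[OF x(2) y(2)] alg_add[OF x(3) y(3)]] by simp
      qed
      show "z *\<^sub>C x \<in> J" if "x \<in> J" for x z
      proof -
        obtain i b c where x: "x = i + ((b o\<^sub>L a) + c *\<^sub>C a)" "i \<in> I" "b \<in> alg" using JE[OF \<open>x \<in> J\<close>] by blast
        have "z *\<^sub>C x = z *\<^sub>C i + (((z *\<^sub>C b) o\<^sub>L a) + (z * c) *\<^sub>C a)"
          by (simp add: x(1) blinfun_compose_scaleC_left scaleC_add_right scaleC_scaleC)
        then show ?thesis using JI[OF I'(4)[OF x(2)] alg_scaleC[OF x(3)]] by simp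
      qed
      show "y o\<^sub>L x \<in> J" if "y \<in> alg" "x \<in> J" for x y
      proof -
        obtain i b c where x: "x = i + ((b o\<^sub>L a) + c *\<^sub>C a)" "i \<in> I" "b \<in> alg" using JE[OF \<open>x \<in> J\<close>] by blast
        have "y o\<^sub>L x = (y o\<^sub>L i) + ((((y o\<^sub>L b) + c *\<^sub>C y) o\<^sub>L a) + 0 *\<^sub>C a)"
          by (simp add: x(1) blinfun_compose_scaleC_left blinfun_compose_add_right blinfun_compose_add_left
              blinfun_compose_scaleC_right[OF alg_linear[OF that(1)]] blinfun_compose_assoc)
        moreover have "(y o\<^sub>L b) + c *\<^sub>C y \<in> alg" using that(1) x(3) by (intro alg_add alg_compose alg_scaleC)
        ultimately show ?thesis using JI[OF I'(5)[OF that(1) x(2)]] by metis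
      qed
    qed
    moreover have "I \<subseteq> J"
      using JI[OF _ alg_zero, of _ 0] by (auto simp: bounded_bilinear.zero_left[OF bounded_bilinear_blinfun_compose])
    moreover have "a \<in> J"
      using JI[OF I'(2) alg_zero, of 1] by (simp add: bounded_bilinear.zero_left[OF bounded_bilinear_blinfun_compose])
    ultimately have "J = alg" using maximal aI by blast
    then obtain i b c where u: "u = i + ((b o\<^sub>L a) + c *\<^sub>C a)" "i \<in> I" "b \<in> alg" using JE[of u] I(2) by blast
    define d where "d = (b o\<^sub>L a) + c *\<^sub>C a"
    have d: "d \<in> alg" unfolding d_def using a u(3) by (intro alg_add alg_compose alg_scaleC)
    have d0: "\<psi> (embed_op d) = 0" if "\<psi> \<in> chars" for \<psi>
    proof -
      have lin: "complex_linear_op a" "complex_linear_op b" using a u(3) by (auto intro: alg_linear)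
      have "embed_op d = embed_op b * embed_op a + c *\<^sub>C embed_op a"
        unfolding d_def using lin
        by (simp add: embed_op_simps embed_op_scaleC complex_linear_op_compose complex_linear_op_scaleC)
      then show ?thesis using that zero[OF that] embed_C[OF a] embed_C[OF u(3)]
        by (simp add: char_simps char_scaleC C.closed_rules)
    qed
    have "y \<in> I" if y: "y \<in> alg" for y
    proof -
      have "\<exists>x\<in>alg. x - (x o\<^sub>L d) = y" by (rule quasi_inverse) (fact d d0 y)+
      then obtain x where x: "x \<in> alg" "x - (x o\<^sub>L d) = y" by blast
      \<comment> \<open>Since u = i + d, the element x - x d splits as (x - x u) + x i, and both
        summands lie in I.\<close>
      have "y = (x - (x o\<^sub>L u)) + (x o\<^sub>L i)"
        unfolding x(2)[symmetric] u(1) d_def by (simp add: blinfun_compose_add_right)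
      then show ?thesis using I'(3)[OF I(3)[OF x(1)] I'(5)[OF x(1) u(2)]] by simp
    qed
    with I'(1) proper show False by blast
  qed
  then show ?thesis using a unfolding jacobson_radical_def by (simp add: gen_simps)
qed

section \<open>Operations on cosets of the radical\<close>

lemma radical_ideal:
  shows "\<R> \<subseteq> alg" and radical_zero: "0 \<in> \<R>"
    and radical_add: "x \<in> \<R> \<Longrightarrow> y \<in> \<R> \<Longrightarrow> x + y \<in> \<R>"
    and radical_scaleC: "x \<in> \<R> \<Longrightarrow> c *\<^sub>C x \<in> \<R>"
    and radical_compose: "y \<in> alg \<Longrightarrow> x \<in> \<R> \<Longrightarrow> y o\<^sub>L x \<in> \<R>"
  using alg_zero alg_add alg_scaleC alg_compose
  unfolding jacobson_radical_def maximal_modular_left_ideal_def modular_left_ideal_def left_ideal_def gen_simps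
  by auto

lemma radical_compose_right: "y \<in> alg \<Longrightarrow> x \<in> \<R> \<Longrightarrow> x o\<^sub>L y \<in> \<R>"
  using radical_compose[of y x] alg_commute[of x y] radical_ideal by auto

lemma radical_diff: "x \<in> \<R> \<Longrightarrow> y \<in> \<R> \<Longrightarrow> x - y \<in> \<R>"
  using radical_add[of x "(-1) *\<^sub>C y"] radical_scaleC[of y "-1"] by simp

abbreviation \<pi> where "\<pi> \<equiv> acoset \<A> \<R>"

lemma coset_def': "\<pi> x = {x + r | r. r \<in> \<R>}"
  by (auto simp: acoset_def gen_simps)

lemma in_coset_iff: "y \<in> \<pi> x \<longleftrightarrow> y - x \<in> \<R>"
  unfolding coset_def' by (auto intro: exI[of _ "y - x"])

lemma coset_eq: "x - y \<in> \<R> \<Longrightarrow> \<pi> x = \<pi> y"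
proof (intro set_eqI iffI; unfold in_coset_iff)
  fix z assume xy: "x - y \<in> \<R>"
  show "z - y \<in> \<R>" if "z - x \<in> \<R>" using radical_add[OF that xy] by simp
  show "z - x \<in> \<R>" if "z - y \<in> \<R>" using radical_diff[OF that xy] by simp
qed

lemma coset_self: "x \<in> \<pi> x"
  using radical_zero by (simp add: in_coset_iff)

lemma coset_nonempty [simp]: "\<pi> x \<noteq> {}"
  using coset_self by blast

lemma quotient_carrier: "acarrier \<Q> = \<pi> ` alg"
  by (simp add: quotient_alg_def gen_simps)

lemma quotient_zero: "azero \<Q> = \<pi> 0"
  by (simp add: quotient_alg_def gen_simps)

text \<open>All cosets in the union that defines the operation coincide, so the union is a single
  coset.\<close>

lemma quotient_plus: "aplus \<Q> (\<pi> x) (\<pi> y) = \<pi> (x + y)"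
proof -
  have "\<pi> (x' + y') = \<pi> (x + y)" if "x' \<in> \<pi> x" "y' \<in> \<pi> y" for x' y'
    using radical_add[of "x' - x" "y' - y"] that
    by (intro coset_eq) (simp add: in_coset_iff algebra_simps)
  then show ?thesis by (simp add: quotient_alg_def gen_simps)
qed

lemma quotient_scale: "ascale \<Q> c (\<pi> x) = \<pi> (c *\<^sub>C x)"
proof -
  have "\<pi> (c *\<^sub>C x') = \<pi> (c *\<^sub>C x)" if "x' \<in> \<pi> x" for x'
    using radical_scaleC[of "x' - x" c] that
    by (intro coset_eq) (simp add: in_coset_iff scaleC_diff_right)
  then show ?thesis by (simp add: quotient_alg_def gen_simps)
qed

lemma quotient_times:
  assumes "x \<in> alg" "y \<in> alg"
  shows "atimes \<Q> (\<pi> x) (\<pi> y) = \<pi> (x o\<^sub>L y)"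
proof -
  have "\<pi> (x' o\<^sub>L y') = \<pi> (x o\<^sub>L y)" if x': "x' \<in> \<pi> x" and y': "y' \<in> \<pi> y" for x' y'
  proof (rule coset_eq)
    have r: "x' - x \<in> \<R>" "y' - y \<in> \<R>" using x' y' by (simp_all add: in_coset_iff)
    have "x' = x + (x' - x)" by simp
    then have "x' \<in> alg" using alg_add[OF assms(1), of "x' - x"] r(1) radical_ideal by auto
    then have "(x' o\<^sub>L (y' - y)) + ((x' - x) o\<^sub>L y) \<in> \<R>"
      using r assms by (intro radical_add radical_compose radical_compose_right)
    then show "(x' o\<^sub>L y') - (x o\<^sub>L y) \<in> \<R>"
      by (simp add: blinfun_compose_diff_left blinfun_compose_diff_right)
  qed
  then show ?thesis by (simp add: quotient_alg_def gen_simps)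
qed

lemma quotient_norm: "0 \<le> anorm \<Q> (\<pi> x)" "anorm \<Q> (\<pi> x) \<le> norm x"
proof -
  have eq: "anorm \<Q> (\<pi> x) = (INF y\<in>\<pi> x. norm y)" by (simp add: quotient_alg_def gen_simps)
  show "0 \<le> anorm \<Q> (\<pi> x)"
    unfolding eq using coset_self[of x] by (intro cINF_greatest) auto
  show "anorm \<Q> (\<pi> x) \<le> norm x"
    unfolding eq using coset_self[of x] by (intro cINF_lower bdd_belowI2[where m = 0]) auto
qed

text \<open>Elements of \<open>ealg\<close> on which all characters agree differ by an element of
  the radical, so the algebra in the quotient reduces to scalar identities. E represents the
  identity and B the generator.\<close>

lemma bounded_generator_criterion:
  assumes E: "E \<in> ealg" "\<And>\<psi> f. \<psi> \<in> chars \<Longrightarrow> f \<in> alg \<Longrightarrow> \<psi> E * \<psi> (embed_op f) = \<psi> (embed_op f)"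
    and B: "B \<in> ealg" "\<And>\<psi> t. \<psi> \<in> chars \<Longrightarrow> t \<in> S \<Longrightarrow> \<psi> (embed_op (T t)) = exp (t * \<psi> B) * \<psi> E"
  shows "unital_alg \<Q> \<and> has_bounded_generator \<Q> S (\<lambda>t. \<pi> (T t))"
proof -
  note ecl = ealg_zero ealg_add ealg_diff ealg_mult ealg_scaleC
  define \<pi>' where "\<pi>' x = \<pi> (op_part x)" for x
  have alg_part: "op_part x \<in> alg" if "x \<in> ealg" for x using that by (simp add: ealg_parts)
  have plus: "aplus \<Q> (\<pi>' x) (\<pi>' y) = \<pi>' (x + y)" for x y by (simp add: \<pi>'_def quotient_plus)
  have scale: "ascale \<Q> c (\<pi>' x) = \<pi>' (c *\<^sub>C x)" for c x by (simp add: \<pi>'_def quotient_scale)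
  have minus: "aminus \<Q> (\<pi>' x) (\<pi>' y) = \<pi>' (x - y)" for x y
    using plus[of x "(-1) *\<^sub>C y"] by (simp add: aminus_def scale)
  have times: "atimes \<Q> (\<pi>' x) (\<pi>' y) = \<pi>' (x * y)" if "x \<in> ealg" "y \<in> ealg" for x y
    using that by (simp add: \<pi>'_def quotient_times ealg_parts)
  have eq: "\<pi>' x = \<pi>' y" if xy: "x \<in> ealg" "y \<in> ealg" "\<And>\<psi>. \<psi> \<in> chars \<Longrightarrow> \<psi> x = \<psi> y" for x y
  proof -
    have d: "x - y \<in> ealg" by (intro ecl xy)
    have "op_part (x - y) \<in> \<R>"
    proof (rule radicalI)
      show "op_part (x - y) \<in> alg" using d by (rule alg_part)
      show "\<psi> (embed_op (op_part (x - y))) = 0" if \<psi>: "\<psi> \<in> chars" for \<psi>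
      proof -
        have "embed_op (op_part (x - y)) = x - y"
          using d by (intro embed_op_op_part) (simp add: ealg_parts)
        then show ?thesis
          using \<psi> xy(3)[OF \<psi>] xy(1,2) by (simp add: char_simps ealg_C)
      qed
    qed
    then show ?thesis by (simp add: \<pi>'_def coset_eq)
  qed
  have carrier: "acarrier \<Q> = \<pi>' ` ealg"
  proof -
    have "op_part ` ealg = alg"
    proof (intro set_eqI iffI)
      show "f \<in> op_part ` ealg" if "f \<in> alg" for f
        using that embed_ealg[OF that] by (intro image_eqI[of _ _ "embed_op f"]) (simp_all add: embed_op_parts alg_linear)
    qed (use alg_part in auto)
    then have "\<pi> ` alg = \<pi>' ` ealg" unfolding \<pi>'_def by (metis image_image)
    then show ?thesis by (simp add: quotient_carrier)
  qed
  have \<pi>T: "\<pi> (T t) = \<pi>' (embed_op (T t))" if "t \<in> S" for t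
    using that by (simp add: \<pi>'_def embed_op_parts T_linear)
  have charE: "\<psi> (E * x) = \<psi> x" "\<psi> (x * E) = \<psi> x" if "\<psi> \<in> chars" "x \<in> ealg" for \<psi> x
  proof -
    have "embed_op (op_part x) = x" using that(2) by (intro embed_op_op_part) (simp add: ealg_parts)
    with E(2)[OF that(1) alg_part[OF that(2)]] have "\<psi> E * \<psi> x = \<psi> x" by simp
    then show "\<psi> (E * x) = \<psi> x" "\<psi> (x * E) = \<psi> x"
      using that E(1) by (simp_all add: char_simps ealg_C mult.commute)
  qed
  have one: "is_aone \<Q> (\<pi>' E)"
    unfolding is_aone_def carrier
  proof (intro conjI ballI)
    show "\<pi>' E \<in> \<pi>' ` ealg" using E(1) by (rule imageI)
    fix X assume "X \<in> \<pi>' ` ealg"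
    then obtain x where x: "x \<in> ealg" "X = \<pi>' x" by blast
    show "atimes \<Q> (\<pi>' E) X = X" "atimes \<Q> X (\<pi>' E) = X"
      unfolding x(2) times[OF E(1) x(1)] times[OF x(1) E(1)]
      by (intro eq ecl E x charE; assumption)+
  qed
  have aone: "aone \<Q> = \<pi>' E"
    unfolding aone_def
  proof (rule the_equality[where P = "is_aone \<Q>", OF one])
    fix e assume "is_aone \<Q> e"
    with one show "e = \<pi>' E" unfolding is_aone_def by metis
  qed
  have gen: "is_aexp \<Q> (ascale \<Q> t (\<pi>' B)) (\<pi> (T t))" if t: "t \<in> S" for t
  proof -
    define W where "W = t *\<^sub>C B"
    have W: "W \<in> ealg" unfolding W_def by (intro ecl B)
    have WnE: "W ^ n * E \<in> ealg" for n
      by (induction n) (auto simp: mult.assoc intro: E(1) ealg_mult W)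
    \<comment> \<open>The zeroth power in the quotient is the class of E, so every power carries a
      factor E.\<close>
    have power: "apower \<Q> (\<pi>' W) n = \<pi>' (W ^ n * E)" for n
      by (induction n) (simp_all add: aone times[OF W WnE] mult.assoc)
    define P where "P n = (\<Sum>k<n. (1 / fact k) *\<^sub>C (W ^ k * E))" for n
    have partial: "aexp_partial \<Q> (\<pi>' W) n = \<pi>' (P n)" for n
    proof (induction n)
      case 0
      then show ?case by (simp add: P_def \<pi>'_def quotient_zero)
    next
      case (Suc n)
      then show ?case by (simp add: power scale plus P_def)
    qed
    have sm: "summable (\<lambda>n. norm ((1 / fact (Suc n)) *\<^sub>C W ^ Suc n))"
    proof (rule summable_comparison_test'[of "\<lambda>n. inverse (fact (Suc n)) * norm W ^ Suc n"])
      have "summable (\<lambda>n. inverse (fact n) * norm W ^ n)" by (rule summable_exp)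
      then show "summable (\<lambda>n. inverse (fact (Suc n)) * norm W ^ Suc n)" by (subst summable_Suc_iff)
      show "norm (norm ((1 / fact (Suc n)) *\<^sub>C W ^ Suc n)) \<le> inverse (fact (Suc n)) * norm W ^ Suc n" for n
        using norm_power_ineq[of W "Suc n"]
        by (simp add: norm_scaleC norm_divide norm_inverse norm_fact divide_inverse mult_left_mono
            del: power_Suc fact_Suc)
    qed
    \<comment> \<open>H stands for exp W - 1, the part of the exponential series that stays in the
      algebra; the exponential itself is represented by E + H E.\<close>
    define H where "H = (\<Sum>n. (1 / fact (Suc n)) *\<^sub>C W ^ Suc n)"
    have H: "H \<in> ealg" unfolding H_def by (rule ealg_series(1)[OF W sm])
    have H_char: "\<psi> H = exp (\<psi> W) - 1" if "\<psi> \<in> chars" for \<psi>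
    proof -
      have "(\<lambda>n. \<psi> W ^ n /\<^sub>R fact n) sums exp (\<psi> W)" by (rule exp_converges)
      then have "(\<lambda>n. \<psi> W ^ Suc n /\<^sub>R fact (Suc n)) sums (exp (\<psi> W) - 1)"
        by (subst sums_Suc_iff) simp
      moreover have "(\<lambda>n. 1 / fact (Suc n) * \<psi> W ^ Suc n) sums \<psi> H"
        unfolding H_def by (rule ealg_series(2)[OF W sm that])
      moreover have "\<psi> W ^ Suc n /\<^sub>R fact (Suc n) = 1 / fact (Suc n) * \<psi> W ^ Suc n" for n
        by (simp add: scaleR_conv_of_real divide_inverse del: power_Suc fact_Suc)
      ultimately show ?thesis by (simp add: sums_unique2)
    qed
    have "(\<lambda>n. \<Sum>k<n. (1 / fact (Suc k)) *\<^sub>C W ^ Suc k) \<longlonglongrightarrow> H"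
      unfolding H_def by (rule summable_LIMSEQ[OF summable_norm_cancel[OF sm]])
    then have "(\<lambda>n. (\<Sum>k<n. (1 / fact (Suc k)) *\<^sub>C W ^ Suc k) * E) \<longlonglongrightarrow> H * E"
      by (rule tendsto_mult[OF _ tendsto_const])
    then have "(\<lambda>n. E + (\<Sum>k<n. (1 / fact (Suc k)) *\<^sub>C W ^ Suc k) * E) \<longlonglongrightarrow> E + H * E"
      by (rule tendsto_add[OF tendsto_const])
    moreover have "E + (\<Sum>k<n. (1 / fact (Suc k)) *\<^sub>C W ^ Suc k) * E = P (Suc n)" for n
      unfolding P_def sum.lessThan_Suc_shift
      by (simp add: sum_distrib_right mult_scaleC_left del: power_Suc fact_Suc)
    ultimately have "(\<lambda>n. P (Suc n)) \<longlonglongrightarrow> E + H * E" by simp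
    then have "P \<longlonglongrightarrow> E + H * E" by (rule filterlim_sequentially_Suc[THEN iffD1])
    then have lim: "(\<lambda>n. norm (P n - (E + H * E))) \<longlonglongrightarrow> 0"
      by (intro tendsto_norm_zero) (simp add: LIM_zero_iff)
    have \<pi>T': "\<pi> (T t) = \<pi>' (E + H * E)"
      unfolding \<pi>T[OF t]
    proof (rule eq)
      show "embed_op (T t) \<in> ealg" by (intro embed_ealg T_alg t)
      show "E + H * E \<in> ealg" by (intro ecl E H)
      fix \<psi> assume \<psi>: "\<psi> \<in> chars"
      have "\<psi> (E + H * E) = \<psi> E + (exp (t * \<psi> B) - 1) * \<psi> E"
        using \<psi> E(1) H B(1) by (simp add: char_simps char_scaleC ealg_C C.closed_rules H_char W_def)
      then show "\<psi> (embed_op (T t)) = \<psi> (E + H * E)" by (simp add: B(2)[OF \<psi> t] algebra_simps)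
    qed
    show ?thesis
      unfolding is_aexp_def
    proof
      show "\<pi> (T t) \<in> acarrier \<Q>" using T_alg[OF t] by (simp add: quotient_carrier)
      have "anorm \<Q> (aminus \<Q> (aexp_partial \<Q> (ascale \<Q> t (\<pi>' B)) n) (\<pi> (T t)))
          = anorm \<Q> (\<pi>' (P n - (E + H * E)))" for n
        by (simp add: scale W_def[symmetric] partial \<pi>T' minus)
      moreover have "(\<lambda>n. anorm \<Q> (\<pi>' (P n - (E + H * E)))) \<longlonglongrightarrow> 0"
      proof (rule tendsto_sandwich[OF _ _ tendsto_const lim])
        show "\<forall>\<^sub>F n in sequentially. 0 \<le> anorm \<Q> (\<pi>' (P n - (E + H * E)))"
          unfolding \<pi>'_def by (intro always_eventually allI quotient_norm)
        show "\<forall>\<^sub>F n in sequentially. anorm \<Q> (\<pi>' (P n - (E + H * E))) \<le> norm (P n - (E + H * E))"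
          unfolding \<pi>'_def by (intro always_eventually allI order_trans[OF quotient_norm(2) norm_op_part_le])
      qed
      ultimately show "(\<lambda>n. anorm \<Q> (aminus \<Q> (aexp_partial \<Q> (ascale \<Q> t (\<pi>' B)) n) (\<pi> (T t)))) \<longlonglongrightarrow> 0"
        by simp
    qed
  qed
  show ?thesis
    unfolding unital_alg_def has_bounded_generator_def
    using one gen B(1) carrier by blast
qed

text \<open>
  The characters of \<open>T s\<close> for small \<open>s > 0\<close> take the value \<open>0\<close> or values near \<open>1\<close>. The identity of the
  quotient comes from the function that is \<open>0\<close> near \<open>0\<close> and \<open>1\<close> near \<open>1\<close>, written as
  \<open>x + (x - 1/2) ((1 + v)\<^sup>-\<^sup>1\<^sup>/\<^sup>2 - 1)\<close> with \<open>v = 4 (x\<^sup>2 - x)\<close>, that is \<open>1 + v = (2 x - 1)\<^sup>2\<close>: in this form it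
  is given by the binomial series, which converges in norm because \<open>v\<close> has small spectral radius.
\<close>

lemma bounded_spectrum_imp_bounded_generator:
  assumes L: "\<And>\<psi> z. \<psi> \<in> chars \<Longrightarrow> \<forall>t\<in>S. \<psi> (embed_op (T t)) = exp (- t * z) \<Longrightarrow> norm z \<le> L"
  shows "unital_alg \<Q> \<and> has_bounded_generator \<Q> S (\<lambda>t. \<pi> (T t))"
proof -
  note ecl = ealg_zero ealg_add ealg_diff ealg_mult ealg_scaleC
  \<comment> \<open>Exponents have |z| \<le> |L|, so |s z| \<le> 1/16 and |exp (- s z) - 1| \<le>
    3/2 * 1/16 < 1/8. The absolute value and the added 1 allow any real L.\<close>
  define s where "s = 1 / (16 * (\<bar>L\<bar> + 1))"
  have s: "0 < s" "s * \<bar>L\<bar> \<le> 1 / 16" by (auto simp: s_def field_simps)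
  have sS: "complex_of_real s \<in> S" using s(1) by (rule S_of_real)
  define X where "X = embed_op (T (complex_of_real s))"
  have X: "X \<in> ealg" unfolding X_def by (intro embed_ealg T_alg sS)
  define D' where "D' = embed_op (D (complex_of_real s))"
  have D': "D' \<in> ealg" unfolding D'_def by (intro embed_ealg D_alg sS)
  have cases: "(\<forall>f\<in>alg. \<psi> (embed_op f) = 0) \<and> \<psi> X = 0 \<or>
      (\<exists>z. (\<forall>t\<in>S. \<psi> (embed_op (T t)) = exp (- t * z)) \<and> \<psi> D' = - z * \<psi> X \<and> norm (\<psi> X - 1) \<le> 1 / 8)"
    if \<psi>: "\<psi> \<in> chars" for \<psi>
    using char_semigroup[OF \<psi>]
  proof
    assume "\<forall>f\<in>alg. \<psi> (embed_op f) = 0"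
    then show ?thesis using T_alg[OF sS] by (simp add: X_def)
  next
    assume "\<exists>z. \<forall>t\<in>S. \<psi> (embed_op (T t)) = exp (- t * z) \<and> \<psi> (embed_op (D t)) = - z * exp (- t * z)"
    then obtain z where z: "\<And>t. t \<in> S \<Longrightarrow> \<psi> (embed_op (T t)) = exp (- t * z)"
      "\<And>t. t \<in> S \<Longrightarrow> \<psi> (embed_op (D t)) = - z * exp (- t * z)" by blast
    have "norm z \<le> \<bar>L\<bar>" using L[OF \<psi>, of z] z(1) by force
    then have "s * norm z \<le> s * \<bar>L\<bar>" using s(1) by simp
    moreover have "norm (- of_real s * z) = s * norm z" using s(1) by (simp add: norm_mult)
    ultimately have w: "norm (- of_real s * z) \<le> 1 / 16" using s(2) by linarith
    have "norm (exp (- of_real s * z) - 1) \<le> 3 / 2 * norm (- of_real s * z)"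
      using w by (intro norm_exp_bounds) simp
    then have "norm (\<psi> X - 1) \<le> 1 / 8" using w z(1)[OF sS] by (simp add: X_def)
    then show ?thesis using z sS by (auto simp: X_def D'_def)
  qed
  define v where "v = 4 *\<^sub>C (X * X - X)"
  have v: "v \<in> ealg" unfolding v_def by (intro ecl X)
  have v_char: "\<psi> v = 4 * (\<psi> X * \<psi> X - \<psi> X)" if "\<psi> \<in> chars" for \<psi>
    unfolding v_def using that X by (simp add: char_simps char_scaleC ealg_C C.closed_rules)
  \<comment> \<open>For x = \<psi> X with |x - 1| \<le> 1/8 the value |4 x (x - 1)| is at most 4 *
    9/8 * 1/8 = 9/16; for x = 0 it vanishes.\<close>
  have v_le: "norm (\<psi> v) \<le> 9 / 16" if \<psi>: "\<psi> \<in> chars" for \<psi>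
  proof -
    have "norm (\<psi> X * (\<psi> X - 1)) \<le> 9 / 8 * (1 / 8)" if "norm (\<psi> X - 1) \<le> 1 / 8"
      unfolding norm_mult using that norm_triangle_sub[of "\<psi> X" 1] by (intro mult_mono) auto
    then have "norm (\<psi> X * (\<psi> X - 1)) \<le> 9 / 64" using cases[OF \<psi>] by auto
    moreover have "\<psi> v = 4 * (\<psi> X * (\<psi> X - 1))" using v_char[OF \<psi>] by (simp add: algebra_simps)
    then have "norm (\<psi> v) = 4 * norm (\<psi> X * (\<psi> X - 1))"
      by (simp only: norm_mult[of 4] norm_numeral)
    ultimately show ?thesis by linarith
  qed
  define c where "c n = ((- 1 / 2 :: complex) gchoose Suc n)" for n
  \<comment> \<open>3/4 lies above the bound 9/16 for the characters of v, and 4/5 between 3/4 and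
    the radius of convergence 1 of the binomial series.\<close>
  have "summable (\<lambda>n. norm (c n) * (3 / 4) ^ Suc n)"
  proof -
    have "summable (\<lambda>n. ((- 1 / 2 :: complex) gchoose n) * (4 / 5) ^ n)"
      using gen_binomial_complex[of "4 / 5" "- 1 / 2"] by (auto dest: sums_summable)
    then have "summable (\<lambda>n. norm (((- 1 / 2 :: complex) gchoose n) * (3 / 4) ^ n))"
      by (rule powser_insidea) simp
    then have "summable (\<lambda>n. norm (((- 1 / 2 :: complex) gchoose Suc n) * (3 / 4) ^ Suc n))"
      by (subst summable_Suc_iff)
    then show ?thesis by (simp add: c_def norm_mult norm_power norm_divide del: power_Suc)
  qed
  then have sm_f: "summable (\<lambda>n. norm (c n *\<^sub>C v ^ Suc n))"
    by (intro summable_ealg_series[OF v, of "9 / 16" "3 / 4"] v_le) auto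
  define f where "f = (\<Sum>n. c n *\<^sub>C v ^ Suc n)"
  have f: "f \<in> ealg" unfolding f_def by (rule ealg_series(1)[OF v sm_f])
  have f_char: "\<psi> f = (1 + \<psi> v) powr (- 1 / 2) - 1" if \<psi>: "\<psi> \<in> chars" for \<psi>
  proof -
    have "(\<lambda>n. ((- 1 / 2) gchoose n) * \<psi> v ^ n) sums (1 + \<psi> v) powr (- 1 / 2)"
      using v_le[OF \<psi>] by (intro gen_binomial_complex) simp
    then have "(\<lambda>n. c n * \<psi> v ^ Suc n) sums ((1 + \<psi> v) powr (- 1 / 2) - 1)"
      unfolding c_def by (subst sums_Suc_iff) simp
    moreover have "(\<lambda>n. c n * \<psi> v ^ Suc n) sums \<psi> f"
      unfolding f_def by (rule ealg_series(2)[OF v sm_f \<psi>])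
    ultimately show ?thesis by (simp add: sums_unique2)
  qed
  \<comment> \<open>This is (X - 1/2) f + X, multiplied out because a scalar such as 1/2 is not in
    the algebra.\<close>
  define E where "E = X + X * f - (1 / 2) *\<^sub>C f"
  have E: "E \<in> ealg" unfolding E_def by (intro ecl X f)
  have E_char: "\<psi> E = \<psi> X + (\<psi> X - 1 / 2) * \<psi> f" if "\<psi> \<in> chars" for \<psi>
    unfolding E_def using that X f
    by (simp add: char_simps char_scaleC ealg_C C.closed_rules algebra_simps)
  have E_zero: "\<psi> E = 0" if "\<psi> \<in> chars" "\<psi> X = 0" for \<psi>
    using that by (simp add: E_char f_char v_char)
  have E_one: "\<psi> E = 1" if \<psi>: "\<psi> \<in> chars" and near: "norm (\<psi> X - 1) \<le> 1 / 8" for \<psi>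
  proof -
    have "\<bar>Re (\<psi> X - 1)\<bar> \<le> 1 / 8" using near abs_Re_le_cmod[of "\<psi> X - 1"] by linarith
    then have "0 < 2 * Re (\<psi> X) - 1" unfolding minus_complex.sel one_complex.sel by linarith
    then have re: "0 < Re (2 * \<psi> X - 1)" by simp
    then have nz: "2 * \<psi> X - 1 \<noteq> 0" by (metis less_irrefl zero_complex.sel(1))
    have "1 + \<psi> v = (2 * \<psi> X - 1) * (2 * \<psi> X - 1)"
      using v_char[OF \<psi>] by (simp add: algebra_simps)
    then have "\<psi> f = 1 / (2 * \<psi> X - 1) - 1"
      using powr_minus_half_square[OF re] f_char[OF \<psi>] by simp
    then have eq: "(2 * \<psi> X - 1) * \<psi> f = 1 - (2 * \<psi> X - 1)"
      using nz by (simp add: right_diff_distrib)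
    have "\<psi> E = \<psi> X + 1 / 2 * ((2 * \<psi> X - 1) * \<psi> f)"
      unfolding E_char[OF \<psi>] by (simp add: algebra_simps)
    also have "\<dots> = 1" unfolding eq by (simp add: algebra_simps)
    finally show ?thesis .
  qed
  \<comment> \<open>Where x = \<psi> X is near 1, \<psi> u = 1 - x, and E + u + u^2 + ... has
    character 1 / x; where x = 0, \<psi> u = 0. So this sum, Y below, inverts X relative to E modulo
    the radical.\<close>
  define u where "u = E - X"
  have u: "u \<in> ealg" unfolding u_def by (intro ecl E X)
  have u_char: "\<psi> u = \<psi> E - \<psi> X" if "\<psi> \<in> chars" for \<psi>
    unfolding u_def using that E X by (simp add: char_simps ealg_C)
  have u_le: "norm (\<psi> u) \<le> 1 / 8" if "\<psi> \<in> chars" for \<psi>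
    using cases[OF that] E_zero[OF that] E_one[OF that] u_char[OF that] by (auto simp: norm_minus_commute)
  have "summable (\<lambda>n. norm (1::complex) * (1/2) ^ Suc n)"
    using summable_geometric[of "1/2::real"] by (simp add: summable_mult)
  then have sm_g: "summable (\<lambda>n. norm (1 *\<^sub>C u ^ Suc n))"
    by (intro summable_ealg_series[OF u, of "1 / 8" "1 / 2"] u_le) auto
  define Y where "Y = E + (\<Sum>n. 1 *\<^sub>C u ^ Suc n)"
  have Y: "Y \<in> ealg" unfolding Y_def by (intro ecl E ealg_series(1)[OF u sm_g])
  have Y_char: "\<psi> Y = 1 / \<psi> X" if \<psi>: "\<psi> \<in> chars" and near: "norm (\<psi> X - 1) \<le> 1 / 8" for \<psi>
  proof -
    have u1: "\<psi> u = 1 - \<psi> X" using u_char[OF \<psi>] E_one[OF that] by simp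
    have "(\<lambda>n. \<psi> u ^ n) sums (1 / (1 - \<psi> u))"
      using u_le[OF \<psi>] by (intro geometric_sums) simp
    then have "(\<lambda>n. \<psi> u ^ Suc n) sums (1 / \<psi> X - 1)"
      by (subst sums_Suc_iff) (simp add: u1)
    moreover have "(\<lambda>n. 1 * \<psi> u ^ Suc n) sums \<psi> (\<Sum>n. 1 *\<^sub>C u ^ Suc n)"
      by (rule ealg_series(2)[OF u sm_g \<psi>])
    ultimately have "\<psi> (\<Sum>n. 1 *\<^sub>C u ^ Suc n) = 1 / \<psi> X - 1"
      using sums_unique2 by fastforce
    then show ?thesis
      unfolding Y_def using \<psi> E_one[OF that] ealg_C[OF E] ealg_C[OF ealg_series(1)[OF u sm_g]]
      by (simp add: char_simps del: power_Suc)
  qed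
  \<comment> \<open>On a character with exponent z the derivative takes the value - z \<psi> X, so
    multiplication by Y leaves - z.\<close>
  define B where "B = D' * Y"
  have B: "B \<in> ealg" unfolding B_def by (intro ecl D' Y)
  have B_char: "\<psi> B = \<psi> D' * \<psi> Y" if "\<psi> \<in> chars" for \<psi>
    unfolding B_def using that D' Y by (simp add: char_simps ealg_C)
  show ?thesis
  proof (rule bounded_generator_criterion[OF E _ B])
    fix \<psi> assume \<psi>: "\<psi> \<in> chars"
    show "\<psi> E * \<psi> (embed_op g) = \<psi> (embed_op g)" if "g \<in> alg" for g
      using cases[OF \<psi>] E_one[OF \<psi>] that by auto
    fix t assume t: "t \<in> S"
    show "\<psi> (embed_op (T t)) = exp (t * \<psi> B) * \<psi> E"
      using cases[OF \<psi>]
    proof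
      assume "(\<forall>f\<in>alg. \<psi> (embed_op f) = 0) \<and> \<psi> X = 0"
      then show ?thesis using E_zero[OF \<psi>] T_alg[OF t] by simp
    next
      assume "\<exists>z. (\<forall>t\<in>S. \<psi> (embed_op (T t)) = exp (- t * z)) \<and> \<psi> D' = - z * \<psi> X \<and> norm (\<psi> X - 1) \<le> 1 / 8"
      then obtain z where z: "\<forall>t\<in>S. \<psi> (embed_op (T t)) = exp (- t * z)" "\<psi> D' = - z * \<psi> X"
        "norm (\<psi> X - 1) \<le> 1 / 8" by blast
      have "\<psi> X \<noteq> 0" using z(3) by auto
      then have "\<psi> B = - z" using B_char[OF \<psi>] Y_char[OF \<psi> z(3)] z(2) by simp
      then show ?thesis using z(1) t E_one[OF \<psi> z(3)] by simp
    qed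
  qed
qed

end

section \<open>Bounding the exponents\<close>

locale sector_calculus = sector_semigroup \<alpha> T + compact_complex_measure \<mu> K
  for \<alpha> :: real and T :: "complex \<Rightarrow> 'a::{complex_normed_vector, banach} \<Rightarrow>\<^sub>L 'a"
    and \<mu> :: "complex set \<Rightarrow> complex" and K :: "complex set" +
  assumes K_nonempty: "K \<noteq> {}" and K_subset: "K \<subseteq> sector \<alpha>"
begin

text \<open>The same sampling points give Riemann sums for the operator integral and for the
  transform; \<psi> maps the former to the latter and passes to the limit.\<close>

lemma semigroup_calculus_character:
  assumes t: "0 < t" and \<psi>: "\<psi> \<in> chars" and z: "\<forall>s\<in>S. \<psi> (embed_op (T s)) = exp (- s * z)"
  shows "semigroup_calculus \<mu> T t \<in> alg"
    and "\<psi> (embed_op (semigroup_calculus \<mu> T t)) = transform (complex_of_real t * z)"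
proof -
  define f where "f \<xi> = T (complex_of_real t * \<xi>)" for \<xi>
  have tK: "complex_of_real t * \<xi> \<in> S" if "\<xi> \<in> K" for \<xi>
    using that K_subset t by (intro S_scale) auto
  have "isCont T s" if "s \<in> S" for s
    using T_has_derivative[OF that] by (rule has_derivative_continuous)
  then have "continuous_on S T" by (simp add: continuous_at_imp_continuous_on)
  then have cont: "continuous_on K f"
    unfolding f_def[abs_def] by (rule continuous_on_compose2) (use tK in \<open>auto intro!: continuous_intros\<close>)
  obtain c where c: "sample_maps c" using sample_maps_exist[OF K_nonempty] by blast
  have cK: "w \<in> K" if "w \<in> range (c n)" for w n using c that by (auto simp: sample_maps_def)
  define I where "I = semigroup_calculus \<mu> T t"
  have lim: "(\<lambda>n. riemann_sum (c n) f) \<longlonglongrightarrow> I"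
    unfolding I_def semigroup_calculus_def f_def[symmetric] by (intro riemann_sum_tendsto c cont)
  have summand: "\<mu> (c n -` {w}) *\<^sub>C f w \<in> alg" if "w \<in> range (c n)" for w n
    unfolding f_def by (intro alg_scaleC T_alg tK cK[OF that])
  have sum_alg: "(\<forall>i\<in>J. g i \<in> alg) \<Longrightarrow> sum g J \<in> alg \<and> embed_op (sum g J) = (\<Sum>i\<in>J. embed_op (g i))"
    for g and J :: "complex set"
    by (induction J rule: infinite_finite_induct)
      (auto simp: alg_zero alg_add embed_op_simps alg_linear)
  have R: "riemann_sum (c n) f \<in> alg" for n
    unfolding riemann_sum_def using summand by (intro sum_alg[THEN conjunct1]) blast
  show I: "I \<in> alg"
    by (rule closed_sequentially[OF alg_closed _ lim]) (use R in blast)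
  have "\<psi> (embed_op (riemann_sum (c n) f)) = riemann_sum (c n) (\<lambda>\<xi>. exp (- (complex_of_real t * z) * \<xi>))" for n
  proof -
    have "embed_op (riemann_sum (c n) f) = (\<Sum>w\<in>range (c n). embed_op (\<mu> (c n -` {w}) *\<^sub>C f w))"
      unfolding riemann_sum_def using summand by (intro sum_alg[THEN conjunct2]) blast
    also have "\<psi> \<dots> = (\<Sum>w\<in>range (c n). \<psi> (embed_op (\<mu> (c n -` {w}) *\<^sub>C f w)))"
      by (intro char_sum \<psi> embed_C summand)
    also have "\<dots> = (\<Sum>w\<in>range (c n). \<mu> (c n -` {w}) *\<^sub>C exp (- (complex_of_real t * z) * w))"
    proof (rule sum.cong[OF refl])
      fix w assume "w \<in> range (c n)"
      then have w: "complex_of_real t * w \<in> S" by (intro tK cK)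
      show "\<psi> (embed_op (\<mu> (c n -` {w}) *\<^sub>C f w)) = \<mu> (c n -` {w}) *\<^sub>C exp (- (complex_of_real t * z) * w)"
        using w \<psi> z T_alg[OF w]
        by (simp add: f_def embed_op_scaleC T_linear char_scaleC embed_C scaleC_complex_def mult_ac)
    qed
    finally show ?thesis by (simp add: riemann_sum_def)
  qed
  moreover have "(\<lambda>n. \<psi> (embed_op (riemann_sum (c n) f))) \<longlonglongrightarrow> \<psi> (embed_op I)"
    by (intro char_tendsto[OF \<psi>] embed_C R I tendsto_embed_op alg_linear lim)
  moreover have "(\<lambda>n. riemann_sum (c n) (\<lambda>\<xi>. exp (- (complex_of_real t * z) * \<xi>)))
      \<longlonglongrightarrow> transform (complex_of_real t * z)"
    unfolding transform_def by (intro riemann_sum_tendsto c continuous_intros)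
  ultimately show "\<psi> (embed_op I) = transform (complex_of_real t * z)"
    by (simp add: LIMSEQ_unique)
qed

lemma transform_le_spectral_radius:
  assumes "0 < t" "\<psi> \<in> chars" "\<forall>s\<in>S. \<psi> (embed_op (T s)) = exp (- s * z)"
  shows "ennreal (norm (transform (complex_of_real t * z))) \<le> spectral_radius (semigroup_calculus \<mu> T t)"
proof (rule norm_le_spectral_radius)
  note I = semigroup_calculus_character[OF assms]
  show "complex_linear_op (semigroup_calculus \<mu> T t)" using I(1) by (rule alg_linear)
  show "\<not> is_unit_elem (embed_op (semigroup_calculus \<mu> T t) - transform (complex_of_real t * z) *\<^sub>C 1)"
    using C.character_not_unit[OF _ embed_C[OF I(1)], of \<psi>] assms(2) I(2) by simp
qed

text \<open>By compactness |Im \<xi>| \<le> k0 Re \<xi> on K with k0 < tan \<alpha>. For k > k0 the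
  cone k |Im z| \<le> Re z gives Re (z \<xi>) \<ge> (1 - k0 / k) Re z Re \<xi>, and Re \<xi> is
  bounded below by a positive constant.\<close>

lemma exists_decay_cone:
  obtains k k' \<delta> where "0 < k" "k < k'" "k' < tan \<alpha>" "0 < \<delta>"
    "\<And>z. k * \<bar>Im z\<bar> \<le> Re z \<Longrightarrow> norm (transform z) \<le> mass * exp (- \<delta> * Re z)"
proof -
  have pos: "0 < Re \<xi>" "\<bar>Im \<xi>\<bar> / Re \<xi> < tan \<alpha>" if "\<xi> \<in> K" for \<xi>
    using that K_subset S_iff[of \<xi>] by (auto simp: divide_less_eq)
  have "continuous_on K Re" by (intro continuous_intros)
  from continuous_attains_inf[OF compact K_nonempty this]
  obtain \<xi>0 where \<xi>0: "\<xi>0 \<in> K" "\<And>\<xi>. \<xi> \<in> K \<Longrightarrow> Re \<xi>0 \<le> Re \<xi>" by blast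
  have "continuous_on K (\<lambda>\<xi>. \<bar>Im \<xi>\<bar> / Re \<xi>)"
    using pos(1) by (intro continuous_intros) force
  from continuous_attains_sup[OF compact K_nonempty this]
  obtain \<xi>1 where \<xi>1: "\<xi>1 \<in> K" "\<And>\<xi>. \<xi> \<in> K \<Longrightarrow> \<bar>Im \<xi>\<bar> / Re \<xi> \<le> \<bar>Im \<xi>1\<bar> / Re \<xi>1" by blast
  define k0 where "k0 = \<bar>Im \<xi>1\<bar> / Re \<xi>1"
  have k0: "0 \<le> k0" "k0 < tan \<alpha>" using pos[OF \<xi>1(1)] by (auto simp: k0_def)
  have k0_le: "\<bar>Im \<xi>\<bar> \<le> k0 * Re \<xi>" if "\<xi> \<in> K" for \<xi>
    using \<xi>1(2)[OF that] pos(1)[OF that] by (simp add: k0_def pos_divide_le_eq)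
  \<comment> \<open>k and k' cut the interval from k0 to tan \<alpha> into thirds: k > k0 gives
    decay, k' < tan \<alpha> puts 1 + i k' into the sector, and the gap k < k' later absorbs an
    additive constant.\<close>
  define k where "k = (2 * k0 + tan \<alpha>) / 3"
  define k' where "k' = (k0 + 2 * tan \<alpha>) / 3"
  define \<delta> where "\<delta> = Re \<xi>0 * (1 - k0 / k)"
  have k: "0 < k" "k0 < k" "k < k'" "k' < tan \<alpha>" using k0 tan_pos by (auto simp: k_def k'_def)
  have \<delta>: "0 < \<delta>" unfolding \<delta>_def using pos(1)[OF \<xi>0(1)] k by (intro mult_pos_pos) simp_all
  show ?thesis
  proof (rule that[OF k(1,3,4) \<delta>])
    fix z assume z: "k * \<bar>Im z\<bar> \<le> Re z"
    then have Re0: "0 \<le> Re z" using k(1) by (meson abs_ge_zero mult_nonneg_nonneg less_imp_le order_trans)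
    have Im: "\<bar>Im z\<bar> \<le> Re z / k" using z k(1) by (simp add: pos_le_divide_eq mult.commute)
    have "norm (transform z) \<le> mass * exp (- (\<delta> * Re z))"
    proof (rule norm_transform_le[OF K_nonempty])
      fix \<xi> assume \<xi>: "\<xi> \<in> K"
      have "Im z * Im \<xi> \<le> \<bar>Im z\<bar> * \<bar>Im \<xi>\<bar>" by (metis abs_ge_self abs_mult)
      also have "\<dots> \<le> (Re z / k) * (k0 * Re \<xi>)"
        using Im k0_le[OF \<xi>] Re0 k(1) by (intro mult_mono) auto
      finally have "Re z * Re \<xi> - (Re z / k) * (k0 * Re \<xi>) \<le> Re (z * \<xi>)" by simp
      moreover have "Re z * Re \<xi> - (Re z / k) * (k0 * Re \<xi>) = Re \<xi> * ((1 - k0 / k) * Re z)"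
        by (simp add: algebra_simps)
      moreover have "Re \<xi>0 * ((1 - k0 / k) * Re z) \<le> Re \<xi> * ((1 - k0 / k) * Re z)"
        using \<xi>0(2)[OF \<xi>] k Re0 by (intro mult_right_mono mult_nonneg_nonneg) simp_all
      ultimately show "\<delta> * Re z \<le> Re (z * \<xi>)" unfolding \<delta>_def mult.assoc by linarith
    qed
    then show "norm (transform z) \<le> mass * exp (- \<delta> * Re z)" by simp
  qed
qed

lemma character_exponents_bounded:
  assumes sym: "cnj ` K = K" "\<And>E. E \<in> sets borel \<Longrightarrow> \<mu> (cnj ` E) = cnj (\<mu> E)"
    and total: "\<mu> UNIV = 0" and t0: "0 < t0"
    and small: "\<And>t. 0 < t \<Longrightarrow> t \<le> t0 \<Longrightarrow> spectral_radius (semigroup_calculus \<mu> T t)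
        < (SUP x\<in>{0<..}. ennreal (norm (transform (complex_of_real x))))"
  shows "\<exists>L. \<forall>\<psi>\<in>chars. \<forall>z. (\<forall>t\<in>S. \<psi> (embed_op (T t)) = exp (- t * z)) \<longrightarrow> norm z \<le> L"
proof -
  obtain k k' \<delta> where k: "0 < k" "k < k'" "k' < tan \<alpha>" and \<delta>: "0 < \<delta>"
    and decay: "\<And>z. k * \<bar>Im z\<bar> \<le> Re z \<Longrightarrow> norm (transform z) \<le> mass * exp (- \<delta> * Re z)"
    using exists_decay_cone by metis
  \<comment> \<open>A value strictly below the supremum exists in \<open>ennreal\<close>, so the
    supremum is positive.\<close>
  have "\<exists>x>0. transform (complex_of_real x) \<noteq> 0"
  proof (rule ccontr)
    assume "\<not> ?thesis"
    then have "(SUP x\<in>{0<..}. ennreal (norm (transform (complex_of_real x)))) \<le> 0"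
      by (intro SUP_least) auto
    with small[OF t0 order_refl] show False by simp
  qed
  then obtain x1 where "0 < x1" "transform (complex_of_real x1) \<noteq> 0" by blast
  from ray_sup_le[OF transform_holomorphic[OF K_nonempty] _ norm_transform_cnj[OF K_nonempty sym] decay k(1) \<delta> this]
  obtain X where X: "0 < X" "\<And>z. 0 < Re z \<Longrightarrow> k * \<bar>Im z\<bar> \<le> Re z \<Longrightarrow> \<exists>r>0. r * Re z \<le> X \<and>
      (\<forall>x>0. norm (transform (complex_of_real x)) \<le> norm (transform (complex_of_real r * z)))"
    using transform_zero[OF K_nonempty] total by auto
  \<comment> \<open>Re (u z) and Re (cnj u z) are Re z - k' Im z and Re z + k' Im z, so the norms of
    T at these two points confine z to k' |Im z| \<le> Re z + d.\<close>
  define u where "u = Complex 1 k'"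
  \<comment> \<open>Including 1 makes d = ln N nonnegative.\<close>
  define N where "N = max 1 (max (norm (T u)) (norm (T (cnj u))))"
  define d where "d = ln N"
  have uS: "u \<in> S" "cnj u \<in> S" using k by (auto simp: u_def S_iff)
  have N: "1 \<le> N" "norm (T u) \<le> N" "norm (T (cnj u)) \<le> N" by (auto simp: N_def)
  have d: "0 \<le> d" "exp d = N" using N(1) by (auto simp: d_def)
  \<comment> \<open>Beyond the first bound, k' |Im z| \<le> Re z + d implies k |Im z| \<le> Re z, so
    z lies in the decay cone; beyond the second, r Re z \<le> X forces r \<le> t0.\<close>
  define P where "P = max (d * k / (k' - k)) (X / t0)"
  have P0: "0 < P" using X(1) t0 by (simp add: P_def less_max_iff_disj)
  have "norm z \<le> P + d + (P + d) / k'"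
    if \<psi>: "\<psi> \<in> chars" and z: "\<forall>t\<in>S. \<psi> (embed_op (T t)) = exp (- t * z)" for \<psi> z
  proof -
    have "- d \<le> Re (t * z)" if t: "t \<in> S" "norm (T t) \<le> N" for t
    proof -
      have "exp (- Re (t * z)) = norm (\<psi> (embed_op (T t)))" using z t(1) by simp
      also have "\<dots> \<le> norm (T t)"
        using char_le[OF \<psi> embed_C[OF T_alg[OF t(1)]]] norm_embed_op[OF T_linear[OF t(1)]] by simp
      also have "\<dots> \<le> exp d" using t(2) d(2) by simp
      finally show ?thesis by simp
    qed
    from this[OF uS(1) N(2)] this[OF uS(2) N(3)]
    have re: "k' * \<bar>Im z\<bar> \<le> Re z + d" "- d \<le> Re z"
      by (auto simp: u_def abs_if)
    have "Re z \<le> P"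
    proof (rule ccontr)
      assume "\<not> Re z \<le> P"
      then have big: "d * k / (k' - k) < Re z" "X / t0 < Re z" "0 < Re z"
        using P0 by (auto simp: P_def)
      have dk: "d * k < Re z * (k' - k)" using big(1) k(2) by (simp add: pos_divide_less_eq)
      have "k' * (k * \<bar>Im z\<bar>) = k * (k' * \<bar>Im z\<bar>)" by simp
      also have "\<dots> \<le> k * (Re z + d)" using re(1) k(1) by (intro mult_left_mono) auto
      also have "\<dots> \<le> k' * Re z" using dk by (simp add: algebra_simps)
      finally have "k * \<bar>Im z\<bar> \<le> Re z" using k by simp
      with X(2) big(3) obtain r where r: "0 < r" "r * Re z \<le> X"
        "\<And>x. 0 < x \<Longrightarrow> norm (transform (complex_of_real x)) \<le> norm (transform (complex_of_real r * z))" by blast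
      have "r * Re z < t0 * Re z" using big(2) r(2) t0 by (simp add: pos_divide_less_eq mult.commute)
      then have "r \<le> t0" using big(3) by simp
      note ennreal_bound = small[OF r(1) this]
      have "(SUP x\<in>{0<..}. ennreal (norm (transform (complex_of_real x))))
          \<le> ennreal (norm (transform (complex_of_real r * z)))"
        using r(3) by (intro SUP_least ennreal_leI) auto
      also have "\<dots> \<le> spectral_radius (semigroup_calculus \<mu> T r)"
        by (rule transform_le_spectral_radius[OF r(1) \<psi> z])
      finally show False using ennreal_bound by simp
    qed
    moreover from this have "k' * \<bar>Im z\<bar> \<le> P + d" using re(1) by linarith
    then have "\<bar>Im z\<bar> \<le> (P + d) / k'" using k by (simp add: pos_le_divide_eq mult.commute)
    ultimately show ?thesis using cmod_le[of z] re(2) P0 d(1) by linarith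
  qed
  then show ?thesis by blast
qed

end

theorem theorem3p4:
  fixes \<alpha> :: real
    and \<mu> :: "complex set \<Rightarrow> complex"
    and \<phi> :: "(complex \<Rightarrow> complex) \<Rightarrow> complex"
    and F :: "complex \<Rightarrow> complex"
    and T :: "complex \<Rightarrow> 'a::{complex_normed_vector, banach} \<Rightarrow>\<^sub>L 'a"
  assumes "0 < \<alpha>" and "\<alpha> < pi / 2"
    and "complex_borel_measure \<mu>"
    and "compact (measure_support \<mu>)" and "measure_support \<mu> \<subseteq> sector \<alpha>"
    and "symmetric_on (sector \<alpha>) \<mu>"
    and "\<mu> (sector \<alpha>) = 0"
    and "\<phi> \<in> holomorphic_dual (sector \<alpha>)"
    and "\<forall>f. f holomorphic_on sector \<alpha> \<longrightarrow> \<phi> f = cm_integral \<mu> f"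
    and "F = fourier_borel \<phi>"
    and "analytic_semigroup \<alpha> T"
    and "\<not> (\<forall>t\<in>sector \<alpha>. quasinilpotent (T t))"
    and "\<exists>t0>0. \<forall>t. 0 < t \<and> t \<le> t0 \<longrightarrow>
           spectral_radius (semigroup_calculus \<mu> T t)
             < (SUP x\<in>{0<..}. ennreal (norm (F (complex_of_real x))))"
  shows "let A = generated_alg (T ` sector \<alpha>);
             R = jacobson_radical A;
             Q = quotient_alg A R;
             \<pi> = acoset A R
         in unital_alg Q \<and> has_bounded_generator Q (sector \<alpha>) (\<lambda>t. \<pi> (T t))"
proof -
  interpret complex_measure \<mu> by standard (rule assms(3))
  interpret sector_semigroup \<alpha> T by standard (rule assms)+
  (* the point 1 is added so that the set is nonempty even if the measure vanishes *)
  define K where "K = insert 1 (measure_support \<mu> \<union> cnj ` measure_support \<mu>)"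
  have cnjS: "cnj ` sector \<alpha> \<subseteq> sector \<alpha>" by (auto simp: S_iff)
  interpret sector_calculus \<alpha> T \<mu> K
  proof
    have "continuous_on (measure_support \<mu>) cnj" by (intro continuous_intros)
    then show "compact K"
      unfolding K_def using assms(4) by (intro compact_insert compact_Un compact_continuous_image)
    have supp: "measure_support \<mu> \<in> sets borel"
      using assms(4) by (intro borel_closed compact_imp_closed)
    have "emeasure (total_variation \<mu>) (- K) \<le> emeasure (total_variation \<mu>) (- measure_support \<mu>)"
      using supp by (intro emeasure_mono) (auto simp: K_def)
    then show "emeasure (total_variation \<mu>) (- K) = 0" by (simp add: emeasure_support)
    show "K \<noteq> {}" by (simp add: K_def)
    show "K \<subseteq> sector \<alpha>" using assms(5) cnjS S_of_real[of 1] by (auto simp: K_def)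
  qed
  have cnjK: "cnj ` K = K" unfolding K_def by (auto simp: image_Un image_image)
  \<comment> \<open>Symmetry is given for subsets of the sector; it extends to all Borel sets by
    intersecting with K, which carries \<mu> and is stable under conjugation.\<close>
  have sym: "\<mu> (cnj ` E) = cnj (\<mu> E)" if E: "E \<in> sets borel" for E
  proof -
    have "cnj ` E = cnj -` E \<inter> space borel"
      by (auto simp: image_iff) (metis complex_cnj_cnj)
    also have "\<dots> \<in> sets borel"
      using E by (intro measurable_sets[of cnj borel borel])
        (auto intro!: borel_measurable_continuous_onI continuous_intros)
    finally have "\<mu> (cnj ` E) = \<mu> (cnj ` E \<inter> K)" by (simp only: measure_Int)
    also have "cnj ` E \<inter> K = cnj ` (E \<inter> K)" by (subst (1) cnjK[symmetric]) auto
    also have "\<mu> \<dots> = cnj (\<mu> (E \<inter> K))"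
      using assms(6) E K_subset K_borel(1) unfolding symmetric_on_def by blast
    also have "\<mu> (E \<inter> K) = \<mu> E" using E by (rule measure_Int)
    finally show ?thesis .
  qed
  have total: "\<mu> UNIV = 0"
  proof -
    have "sector \<alpha> \<in> sets borel" using S_open by (rule borel_open)
    then have "\<mu> (sector \<alpha> \<inter> K) = \<mu> (sector \<alpha>)" by (rule measure_Int)
    then show ?thesis using measure_Int[of UNIV] K_subset assms(7) by (simp add: Int_absorb1)
  qed
  have F: "F z = transform z" for z
  proof -
    have "(\<lambda>\<xi>. exp (- z * \<xi>)) holomorphic_on sector \<alpha>" by (intro holomorphic_intros)
    then show ?thesis using assms(9) by (simp add: assms(10) fourier_borel_def transform_def)
  qed
  obtain t0 where "0 < t0" "\<And>t. 0 < t \<Longrightarrow> t \<le> t0 \<Longrightarrow> spectral_radius (semigroup_calculus \<mu> T t)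
        < (SUP x\<in>{0<..}. ennreal (norm (transform (complex_of_real x))))"
    using assms(13) unfolding F by blast
  from character_exponents_bounded[OF cnjK sym total this]
  obtain L where "\<forall>\<psi>\<in>chars. \<forall>z. (\<forall>t\<in>S. \<psi> (embed_op (T t)) = exp (- t * z)) \<longrightarrow> norm z \<le> L" by blast
  then show ?thesis
    unfolding Let_def by (intro bounded_spectrum_imp_bounded_generator[of L]) blast
qed

end
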